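(* Let $\mathbb{F}$ be $\mathbb{C}$ or $\mathbb{F}_p$ ($p$ prime). For all $\epsilon>0$ and $0<\gamma<1$ there is a $\delta>0$ such that the following holds for all $N>0$. Let $Y\subseteq\mathbb{F}$ with $|Y|=N$ and let $L$ be a set of $N^\epsilon$ lines in $\mathbb{F}^2$, each $N^{-\delta}$-rich in $Y\times Y$. \begin{itemize} \item If $\mathbb{F}=\mathbb{C}$, then there is a subset $L'\subseteq L$ with $|L'|\gg|L|^{1-\gamma}$ whose lines are either all parallel or all concurrent. \item If $\mathbb{F}=\mathbb{F}_p$, the same conclusion holds provided that $N\ll p^{1-O(\gamma\epsilon)}$. \end{itemize} Further, one may take $\delta=1/(J2^J)$ for a positive integer $J$ of order $1/(\gamma\epsilon)$.
   Context: A line $\ell$ is $\alpha$-rich in $Y\times Y$ if $|\ell\cap(Y\times Y)|\geq\alpha|Y|$. Lines are graphs of affine maps $x\mapsto ax+b$ with $a\neq0$. $f\gg g$ means $f\geq cg$ for a constant $c>0$; as a hypothesis, "$N\ll p^{1-O(\gamma\epsilon)}$" means $N\leq c\,p^{1-c'\gamma\epsilon}$ for suitable constants $c,c'>0$. *)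

theory Defs
  imports
    "HOL-Analysis.Analysis"
    "HOL-Algebra.Algebraic_Closure_Type"
    "HOL-Number_Theory.Residues"
begin

text \<open>
  Fields are records of HOL-Algebra, so that the complex numbers
  (\<open>ring_of_type_algebra :: complex ring\<close>) and the prime fields (\<open>residue_ring (int p)\<close>)
  are treated by the same definitions and constants can be chosen before the prime \<open>p\<close>.
\<close>

definition affine_line :: "('a, 'm) ring_scheme \<Rightarrow> 'a \<Rightarrow> 'a \<Rightarrow> ('a \<times> 'a) set" where
  "affine_line F a b = {(x, a \<otimes>\<^bsub>F\<^esub> x \<oplus>\<^bsub>F\<^esub> b) | x. x \<in> carrier F}"

definition affine_lines :: "('a, 'm) ring_scheme \<Rightarrow> ('a \<times> 'a) set set" where
  "affine_lines F = {affine_line F a b | a b. a \<in> carrier F - {\<zero>\<^bsub>F\<^esub>} \<and> b \<in> carrier F}"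

definition rich :: "real \<Rightarrow> 'a set \<Rightarrow> ('a \<times> 'a) set \<Rightarrow> bool" where
  "rich \<alpha> Y l \<longleftrightarrow> real (card (l \<inter> (Y \<times> Y))) \<ge> \<alpha> * real (card Y)"

definition all_parallel :: "('a, 'm) ring_scheme \<Rightarrow> ('a \<times> 'a) set set \<Rightarrow> bool" where
  "all_parallel F L \<longleftrightarrow>
    (\<exists>a\<in>carrier F - {\<zero>\<^bsub>F\<^esub>}. \<forall>l\<in>L. \<exists>b\<in>carrier F. l = affine_line F a b)"

definition all_concurrent :: "('a, 'm) ring_scheme \<Rightarrow> ('a \<times> 'a) set set \<Rightarrow> bool" where
  "all_concurrent F L \<longleftrightarrow> (\<exists>P\<in>carrier F \<times> carrier F. \<forall>l\<in>L. P \<in> l)"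

text \<open>
  A set of \<open>N\<^sup>\<epsilon>\<close> lines has \<open>N\<^sup>\<epsilon>\<close> elements up to rounding: \<open>N\<^sup>\<epsilon>\<close> itself if this is an
  integer, and otherwise its floor or its ceiling.
\<close>

definition rich_lines_config ::
    "('a, 'm) ring_scheme \<Rightarrow> real \<Rightarrow> real \<Rightarrow> nat \<Rightarrow> 'a set \<Rightarrow> ('a \<times> 'a) set set \<Rightarrow> bool" where
  "rich_lines_config F \<epsilon> \<delta> N Y L \<longleftrightarrow>
     Y \<subseteq> carrier F \<and> finite Y \<and> card Y = N \<and>
     L \<subseteq> affine_lines F \<and> finite L \<and> \<bar>real (card L) - real N powr \<epsilon>\<bar> < 1 \<and>
     (\<forall>l\<in>L. rich (real N powr (-\<delta>)) Y l)"

definition has_large_pencil ::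
    "('a, 'm) ring_scheme \<Rightarrow> real \<Rightarrow> real \<Rightarrow> ('a \<times> 'a) set set \<Rightarrow> bool" where
  "has_large_pencil F c \<gamma> L \<longleftrightarrow>
     (\<exists>L'\<subseteq>L. real (card L') \<ge> c * real (card L) powr (1 - \<gamma>) \<and>
              (all_parallel F L' \<or> all_concurrent F L'))"

end

theory Submission
  imports Defs
begin

text \<open>
  Let \<open>\<mu>\<close> be the uniform distribution on the affine maps given by \<open>L\<close> and let \<open>\<nu>\<^sub>0 = \<mu>\<close>,
  \<open>\<nu>\<^sub>j\<^sub>+\<^sub>1(g) = \<Sum>a. \<nu>\<^sub>j(a) \<nu>\<^sub>j(g\<inverse> a)\<close>. By Cauchy-Schwarz the mean of \<open>|g Y \<inter> Y| / |Y|\<close> under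
  \<open>\<nu>\<^sub>j\<close> is at least \<open>N\<close> to the power \<open>- \<delta> 2\<^sup>j \<ge> - 1 / J\<close>. As an affine map is determined by two
  points, this bounds the largest value of \<open>\<nu>\<^sub>J\<close> from below by \<open>N\<close> to the power \<open>-6\<close>, so for some
  \<open>j\<close> two consecutive steps flatten \<open>\<nu>\<^sub>j\<close> by a factor of at most \<open>K\<close>, which is \<open>N\<close> to the power
  \<open>24 / J\<close>; no constants are lost on the way. The Balog-Szemeredi-Gowers theorem then produces an
  approximate group \<open>H\<close> of affine maps, one coset of which contains a proportion \<open>(2 K)\<^sup>-\<^sup>O\<^sup>(\<^sup>1\<^sup>)\<close> of \<open>L\<close>.
  If \<open>H\<close> is commutative, it consists of translations or has a fixed point. Otherwise \<open>H\<close>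
  generates a translation, and a pivot argument makes the translations in \<open>H\<close> grow by a factor
  comparable to the number of slopes of \<open>H\<close>. Hence there are few slopes, or \<open>H\<close> has size comparable
  to \<open>p\<close> times the number of slopes; in the latter case the second moment bound for incidences
  over a finite field again shows that there are few slopes.
\<close>

text \<open>Every loss has to be a power of \<open>N\<close> whose exponent is a constant times 1 /
  J, since only about |L| to the power \<gamma> may be given away. From index 1 on the largest value
  of \<nu>(j) is its value at 0, and \<nu>(j + 2) at 0 is the sum of squares of \<nu>(j + 1), which
  is the energy of \<nu>(j); this is why flatness is measured over two steps. At least J / 4
  disjoint double steps share a total decay of at most \<open>N\<close> to the power 6, which gives
  the exponent 24 / J. All later losses are powers of 2 K, together at most the 6000th, hence the
  condition J \<ge> 144000 / (\<gamma> \<epsilon>). The coset is found for \<nu>(j), not for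
  \<open>L\<close>; it can be pulled back because an autocorrelation only averages the masses of
  cosets. Over a prime field translations cannot grow beyond the whole field, so \<open>H\<close>
  may contain nearly all of them; excluding many slopes there is what the bound on \<open>N\<close>
  in terms of \<open>p\<close> is for.\<close>

section \<open>Counting by fibres\<close>

lemma card_fibres_le:
  assumes "finite P" "finite Z" "\<And>x. x \<in> Z \<Longrightarrow> k \<le> real (card {q \<in> P. f q = x})"
  shows "real (card Z) * k \<le> real (card P)"
proof -
  have "real (card Z) * k = (\<Sum>x\<in>Z. k)" by simp
  also have "\<dots> \<le> (\<Sum>x\<in>Z. real (card {q \<in> P. f q = x}))"
    by (intro sum_mono assms)
  also have "\<dots> = real (card (\<Union>x\<in>Z. {q \<in> P. f q = x}))"
    using assms by (subst card_UN_disjoint) auto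
  also have "\<dots> \<le> real (card P)"
    using assms by (intro of_nat_mono card_mono) auto
  finally show ?thesis .
qed

lemma card_le_fibres:
  assumes "finite P" "\<And>x. x \<in> f ` P \<Longrightarrow> real (card {q \<in> P. f q = x}) \<le> k"
  shows "real (card P) \<le> real (card (f ` P)) * k"
proof -
  have "P = (\<Union>x\<in>f ` P. {q \<in> P. f q = x})" by auto
  then have "real (card P) = real (card (\<Union>x\<in>f ` P. {q \<in> P. f q = x}))" by simp
  also have "\<dots> = (\<Sum>x\<in>f ` P. real (card {q \<in> P. f q = x}))"
    using assms by (subst card_UN_disjoint) auto
  also have "\<dots> \<le> (\<Sum>x\<in>f ` P. k)"
    by (intro sum_mono assms)
  finally show ?thesis by simp
qed

lemma exists_fibre_ge:
  assumes "finite P" "real (card (f ` P)) \<le> k" "k > 0" "P \<noteq> {}"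
  shows "\<exists>x. real (card P) / k \<le> real (card {q \<in> P. f q = x})"
proof (rule ccontr)
  assume *: "\<not> ?thesis"
  then have lt: "real (card {q \<in> P. f q = x}) < real (card P) / k" for x
    by (meson not_le)
  have "P = (\<Union>x\<in>f ` P. {q \<in> P. f q = x})" by auto
  then have "real (card P) = real (card (\<Union>x\<in>f ` P. {q \<in> P. f q = x}))" by simp
  also have "\<dots> = (\<Sum>x\<in>f ` P. real (card {q \<in> P. f q = x}))"
    using assms by (subst card_UN_disjoint) auto
  also have "\<dots> < (\<Sum>x\<in>f ` P. real (card P) / k)"
    using assms lt by (intro sum_strict_mono) auto
  also have "\<dots> = real (card (f ` P)) * (real (card P) / k)" by simp
  also have "\<dots> \<le> k * (real (card P) / k)"
    using assms by (intro mult_right_mono) auto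
  finally show False using assms by simp
qed

section \<open>Autocorrelations of finitely supported probability distributions\<close>

definition fprob :: "('g \<Rightarrow> real) \<Rightarrow> bool" where
  "fprob f \<longleftrightarrow> finite {x. f x \<noteq> 0} \<and> (\<forall>x. 0 \<le> f x) \<and> sum f {x. f x \<noteq> 0} = 1"

text \<open>The law of \<open>a - b\<close> for independent \<open>a\<close> and \<open>b\<close>
  with law \<open>f\<close>: the element \<open>- g + a\<close> is the \<open>b\<close> with
  \<open>a - b = g\<close>. Unlike a self-convolution it is symmetric under inversion and largest at
  0.\<close>

definition autocorr :: "('g::group_add \<Rightarrow> real) \<Rightarrow> 'g \<Rightarrow> real" where
  "autocorr f g = (\<Sum>a | f a \<noteq> 0. f a * f (- g + a))"

definition diffset :: "'g::group_add set \<Rightarrow> 'g set" where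
  "diffset S = (\<lambda>(a, b). a - b) ` (S \<times> S)"

lemma finite_diffset [simp]: "finite S \<Longrightarrow> finite (diffset S)"
  by (simp add: diffset_def)

lemma minus_minus_add_cancel: "- (a - b) + a = (b::'g::group_add)"
  by (metis add_diff_cancel diff_add_cancel minus_diff_eq)

lemma inj_on_add_left: "inj_on (\<lambda>x. g + x) (A::'g::group_add set)"
  by (rule inj_onI) (metis minus_add_cancel)

lemma diff_minus_add: "a - (- g + a) = (g::'g::group_add)"
  by (metis add_diff_cancel diff_diff_eq2 minus_add_cancel minus_minus_add_cancel neg_equal_iff_equal)

lemma fprob_finite: "fprob f \<Longrightarrow> finite {x. f x \<noteq> 0}"
  by (simp add: fprob_def)

lemma fprob_nonneg: "fprob f \<Longrightarrow> 0 \<le> f x"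
  by (simp add: fprob_def)

lemma fprob_sum: "fprob f \<Longrightarrow> sum f {x. f x \<noteq> 0} = 1"
  unfolding fprob_def by blast

lemma fprob_sum_le:
  assumes "fprob f" "finite A" shows "sum f A \<le> 1"
proof -
  have "sum f A = sum f (A \<inter> {x. f x \<noteq> 0})"
    using assms by (intro sum.mono_neutral_right) auto
  also have "\<dots> \<le> sum f {x. f x \<noteq> 0}"
    using assms fprob_finite fprob_nonneg by (intro sum_mono2) auto
  finally show ?thesis using assms by (simp add: fprob_sum)
qed

lemma autocorr_nonneg: "fprob f \<Longrightarrow> 0 \<le> autocorr f g"
  by (simp add: autocorr_def sum_nonneg fprob_nonneg)

lemma autocorr_support: "{g. autocorr f g \<noteq> 0} \<subseteq> diffset {x. f x \<noteq> 0}"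
proof
  fix g assume "g \<in> {g. autocorr f g \<noteq> 0}"
  then have "(\<Sum>a | f a \<noteq> 0. f a * f (- g + a)) \<noteq> 0" by (simp add: autocorr_def)
  then obtain a where "f a \<noteq> 0" "f a * f (- g + a) \<noteq> 0"
    by (metis (mono_tags, lifting) mem_Collect_eq sum.neutral)
  then show "g \<in> diffset {x. f x \<noteq> 0}"
    unfolding diffset_def using diff_minus_add[of a g] by (force simp: image_iff)
qed

text \<open>Both sides are the expectation of \<phi> at \<open>a - b\<close>. Total mass, coset
  masses and mean incidences of an autocorrelation are all read off from this identity.\<close>

lemma sum_autocorr:
  assumes f: "fprob f" and W: "finite W" "{g. autocorr f g \<noteq> 0} \<subseteq> W"
  shows "(\<Sum>g\<in>W. autocorr f g * \<phi> g) = (\<Sum>a | f a \<noteq> 0. \<Sum>b | f b \<noteq> 0. f a * f b * \<phi> (a - b))"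
proof -
  define V where "V = {x. f x \<noteq> 0}"
  have V: "finite V" using f fprob_finite by (auto simp: V_def)
  define W' where "W' = W \<union> diffset V"
  have W': "finite W'" using V W by (simp add: W'_def)
  have "(\<Sum>g\<in>W. autocorr f g * \<phi> g) = (\<Sum>g\<in>W'. autocorr f g * \<phi> g)"
    using W W' by (intro sum.mono_neutral_left) (auto simp: W'_def)
  also have "\<dots> = (\<Sum>g\<in>W'. \<Sum>a\<in>V. f a * f (- g + a) * \<phi> g)"
    by (simp add: autocorr_def V_def sum_distrib_right)
  also have "\<dots> = (\<Sum>a\<in>V. \<Sum>g\<in>W'. f a * f (- g + a) * \<phi> g)"
    by (rule sum.swap)
  also have "\<dots> = (\<Sum>a\<in>V. \<Sum>b\<in>V. f a * f b * \<phi> (a - b))"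
  proof (rule sum.cong[OF refl])
    fix a assume a: "a \<in> V"
    have "(\<Sum>b\<in>V. f a * f b * \<phi> (a - b)) = (\<Sum>g\<in>(\<lambda>b. a - b) ` V. f a * f (- g + a) * \<phi> g)"
      by (subst sum.reindex) (auto intro!: inj_onI simp: minus_minus_add_cancel dest: arg_cong[where f = "\<lambda>x. - x + a"])
    also have "\<dots> = (\<Sum>g\<in>W'. f a * f (- g + a) * \<phi> g)"
    proof (rule sum.mono_neutral_left[OF W'])
      show "(\<lambda>b. a - b) ` V \<subseteq> W'" using a by (auto simp: W'_def diffset_def)
      show "\<forall>g\<in>W' - (\<lambda>b. a - b) ` V. f a * f (- g + a) * \<phi> g = 0"
      proof
        fix g assume g: "g \<in> W' - (\<lambda>b. a - b) ` V"
        then have "- g + a \<notin> V" using diff_minus_add[of a g] by (metis DiffD2 image_eqI)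
        then show "f a * f (- g + a) * \<phi> g = 0" by (simp add: V_def)
      qed
    qed
    finally show "(\<Sum>g\<in>W'. f a * f (- g + a) * \<phi> g) = (\<Sum>b\<in>V. f a * f b * \<phi> (a - b))" ..
  qed
  finally show ?thesis by (simp add: V_def)
qed

lemma fprob_autocorr:
  assumes f: "fprob f" shows "fprob (autocorr f)"
proof -
  have fin: "finite {g. autocorr f g \<noteq> 0}"
    by (rule finite_subset[OF autocorr_support]) (simp add: f fprob_finite)
  have "sum (autocorr f) {g. autocorr f g \<noteq> 0} = (\<Sum>g | autocorr f g \<noteq> 0. autocorr f g * 1)"
    by simp
  also have "\<dots> = (\<Sum>a | f a \<noteq> 0. \<Sum>b | f b \<noteq> 0. f a * f b * 1)"
    by (rule sum_autocorr[OF f fin]) simp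
  also have "\<dots> = (\<Sum>a | f a \<noteq> 0. f a) * (\<Sum>b | f b \<noteq> 0. f b)"
    by (simp add: sum_product)
  also have "\<dots> = 1" using f by (simp add: fprob_sum)
  finally show ?thesis using fin f by (simp add: fprob_def autocorr_nonneg)
qed

lemma autocorr_0: "autocorr f 0 = (\<Sum>a | f a \<noteq> 0. (f a)\<^sup>2)"
  by (simp add: autocorr_def power2_eq_square)

lemma sum_translate_le:
  fixes f h :: "'g::group_add \<Rightarrow> real"
  assumes f: "fprob f" and h: "\<And>x. 0 \<le> h x" "\<And>x. f x = 0 \<Longrightarrow> h x = 0"
  shows "(\<Sum>a | f a \<noteq> 0. h (- g + a)) \<le> (\<Sum>a | f a \<noteq> 0. h a)"
proof -
  let ?V = "{a. f a \<noteq> 0}"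
  have V: "finite ?V" using f fprob_finite by auto
  have "(\<Sum>a\<in>?V. h (- g + a)) = (\<Sum>b\<in>(\<lambda>a. - g + a) ` ?V. h b)"
    by (subst sum.reindex) (auto intro: inj_on_add_left)
  also have "\<dots> = (\<Sum>b\<in>(\<lambda>a. - g + a) ` ?V \<inter> ?V. h b)"
    using V h by (intro sum.mono_neutral_right) auto
  also have "\<dots> \<le> (\<Sum>a\<in>?V. h a)"
    using V h by (intro sum_mono2) auto
  finally show ?thesis .
qed

text \<open>Cauchy-Schwarz in the form 2 x y \<le> x^2 + y^2, together with the fact that
  translating \<open>f\<close> does not increase its sum of squares over the support.\<close>

lemma autocorr_le_0:
  assumes f: "fprob f" shows "autocorr f g \<le> autocorr f 0"
proof -
  let ?V = "{a. f a \<noteq> 0}"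
  have "2 * autocorr f g = (\<Sum>a\<in>?V. 2 * (f a * f (- g + a)))"
    by (simp add: autocorr_def sum_distrib_left)
  also have "\<dots> \<le> (\<Sum>a\<in>?V. (f a)\<^sup>2 + (f (- g + a))\<^sup>2)"
    by (intro sum_mono) (use sum_squares_bound in \<open>simp add: mult.assoc[symmetric]\<close>)
  also have "\<dots> = (\<Sum>a\<in>?V. (f a)\<^sup>2) + (\<Sum>a\<in>?V. (f (- g + a))\<^sup>2)"
    by (simp add: sum.distrib)
  also have "\<dots> \<le> (\<Sum>a\<in>?V. (f a)\<^sup>2) + (\<Sum>a\<in>?V. (f a)\<^sup>2)"
    using sum_translate_le[OF f, of "\<lambda>x. (f x)\<^sup>2" g] by simp
  finally show ?thesis by (simp add: autocorr_0)
qed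

text \<open>For fixed \<open>b\<close>, the condition \<open>a - b - z \<in> H\<close> puts
  \<open>a\<close> into the right coset of \<open>z + b\<close>. So each coset mass of the
  autocorrelation is an average of coset masses of \<open>f\<close>.\<close>

lemma autocorr_coset_mass_le:
  assumes f: "fprob f"
    and c: "\<And>z. (\<Sum>x | f x \<noteq> 0 \<and> x - z \<in> H. f x) \<le> c"
  shows "(\<Sum>x | autocorr f x \<noteq> 0 \<and> x - z \<in> H. autocorr f x) \<le> c"
proof -
  let ?V = "{a. f a \<noteq> 0}"
  have V: "finite ?V" using f fprob_finite by auto
  have fin: "finite {g. autocorr f g \<noteq> 0}"
    using f by (simp add: fprob_autocorr fprob_finite)
  have "(\<Sum>x | autocorr f x \<noteq> 0 \<and> x - z \<in> H. autocorr f x)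
      = (\<Sum>x | autocorr f x \<noteq> 0. autocorr f x * of_bool (x - z \<in> H))"
    using fin by (intro sum.mono_neutral_cong_left) auto
  also have "\<dots> = (\<Sum>a\<in>?V. \<Sum>b\<in>?V. f a * f b * of_bool (a - b - z \<in> H))"
    by (rule sum_autocorr[OF f fin]) simp
  also have "\<dots> = (\<Sum>b\<in>?V. \<Sum>a\<in>?V. f a * f b * of_bool (a - b - z \<in> H))"
    by (rule sum.swap)
  also have "\<dots> = (\<Sum>b\<in>?V. f b * (\<Sum>x | f x \<noteq> 0 \<and> x - (z + b) \<in> H. f x))"
  proof (rule sum.cong[OF refl])
    fix b
    have "(\<Sum>a\<in>?V. f a * f b * of_bool (a - b - z \<in> H))
        = (\<Sum>x | f x \<noteq> 0 \<and> x - (z + b) \<in> H. f b * f x)"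
      using V by (intro sum.mono_neutral_cong_right)
        (auto simp: diff_conv_add_uminus minus_add add.assoc simp del: add_uminus_conv_diff)
    then show "(\<Sum>a\<in>?V. f a * f b * of_bool (a - b - z \<in> H))
        = f b * (\<Sum>x | f x \<noteq> 0 \<and> x - (z + b) \<in> H. f x)"
      by (simp add: sum_distrib_left)
  qed
  also have "\<dots> \<le> (\<Sum>b\<in>?V. f b * c)"
    by (intro sum_mono mult_left_mono c fprob_nonneg[OF f])
  also have "\<dots> = c" using f by (simp add: sum_distrib_right[symmetric] fprob_sum)
  finally show ?thesis .
qed

text \<open>The number of ways to write \<open>g\<close> as a difference of two elements of
  \<open>S\<close>, counted by the first of them. The sum of its squares is the energy of
  \<open>S\<close>.\<close>

definition popdiff :: "'g::group_add set \<Rightarrow> 'g \<Rightarrow> nat" where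
  "popdiff S g = card {a \<in> S. - g + a \<in> S}"

lemma popdiff_nonzero:
  assumes "popdiff S g \<noteq> 0" shows "g \<in> diffset S"
proof -
  from assms have "{a \<in> S. - g + a \<in> S} \<noteq> {}"
    by (metis card.empty popdiff_def)
  then obtain a where "a \<in> S" "- g + a \<in> S" by auto
  then show ?thesis using diff_minus_add[of a g] by (force simp: diffset_def image_iff)
qed

lemma sum_popdiff:
  assumes S: "finite S"
  shows "(\<Sum>g\<in>diffset S. popdiff S g) = card S * card S"
proof -
  have "(\<Sum>g\<in>diffset S. popdiff S g) = card (SIGMA g:diffset S. {a \<in> S. - g + a \<in> S})"
    using S by (simp add: popdiff_def)
  also have "\<dots> = card (S \<times> S)"
  proof (rule bij_betw_same_card)
    show "bij_betw (\<lambda>(g, a). (a, - g + a)) (SIGMA g:diffset S. {a \<in> S. - g + a \<in> S}) (S \<times> S)"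
      by (rule bij_betw_byWitness[where f' = "\<lambda>(a, b). (a - b, a)"])
        (auto simp: diffset_def minus_minus_add_cancel diff_minus_add)
  qed
  finally show ?thesis by (simp add: card_cartesian_product)
qed

lemma sum_popdiff_square_le:
  assumes S: "finite S"
  shows "(\<Sum>g\<in>diffset S. real (popdiff S g) ^ 2) \<le> real (card S) ^ 3"
proof -
  have "(\<Sum>g\<in>diffset S. real (popdiff S g) ^ 2) \<le> (\<Sum>g\<in>diffset S. real (card S) * real (popdiff S g))"
    using S by (intro sum_mono) (auto simp: power2_eq_square popdiff_def intro!: mult_right_mono card_mono)
  also have "\<dots> = real (card S) * real (\<Sum>g\<in>diffset S. popdiff S g)"
    by (simp add: sum_distrib_left)
  also have "\<dots> = real (card S) ^ 3" using S by (simp add: sum_popdiff power3_eq_cube)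
  finally show ?thesis .
qed

text \<open>The hypothesis \<open>flat\<close> is a lower bound for the energy of \<open>f\<close>.
  Values below \<open>m / (8 * K)\<close> account for at most half of it, so the indicator of the
  level set \<open>S\<close>, scaled by \<open>m\<close>, must carry the rest.\<close>

lemma level_set_energy:
  assumes f: "fprob f" and m: "\<And>x. f x \<le> m" "m > 0" and K: "K \<ge> 1"
    and flat: "m / K \<le> autocorr (autocorr f) 0"
  defines "S \<equiv> {x. m / (8 * K) \<le> f x}"
  shows "finite S" "real (card S) \<le> 8 * K / m"
    "1 / (8 * K * m ^ 3) \<le> (\<Sum>g\<in>diffset S. real (popdiff S g) ^ 2)"
proof -
  let ?V = "{a. f a \<noteq> 0}"
  define t where "t = m / (8 * K)"
  have t: "t > 0" using m K by (simp add: t_def)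
  have V: "finite ?V" using f fprob_finite by auto
  have SV: "S \<subseteq> ?V" using t by (auto simp: S_def t_def)
  show S: "finite S" using SV V finite_subset by blast
  have "real (card S) * t = (\<Sum>x\<in>S. t)" by simp
  also have "\<dots> \<le> sum f S" by (intro sum_mono) (auto simp: S_def t_def)
  also have "\<dots> \<le> 1" using f S fprob_sum_le by blast
  finally show "real (card S) \<le> 8 * K / m"
    using m K by (simp add: t_def field_simps)
  define E where "E = (\<Sum>g\<in>diffset S. real (popdiff S g) ^ 2)"
  let ?D = "{g. autocorr f g \<noteq> 0}"
  have fD: "fprob (autocorr f)" using f by (rule fprob_autocorr)
  have D: "finite ?D" using fD fprob_finite by auto
  \<comment> \<open>Pairs inside \<open>S\<close> contribute at most m^2 each. If a member of the
    pair is outside \<open>S\<close>, the product is at most \<open>t\<close> times the other value,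
    and each of the two sums of these values is at most 1.\<close>
  have ub: "autocorr f g \<le> m\<^sup>2 * real (popdiff S g) + 2 * t" for g
  proof -
    have pt: "f a * f b \<le> m\<^sup>2 * of_bool (a \<in> S \<and> b \<in> S) + t * f a + t * f b" for a b
    proof -
      have nn: "0 \<le> f a" "0 \<le> f b" using f by (simp_all add: fprob_nonneg)
      consider "a \<in> S \<and> b \<in> S" | "a \<notin> S" | "b \<notin> S" by blast
      then show ?thesis
      proof cases
        case 1
        have "f a * f b \<le> m * m" using nn m by (intro mult_mono) auto
        then show ?thesis using 1 nn t by (simp add: power2_eq_square add_nonneg_nonneg add_increasing2)
      next
        case 2
        then have "f a * f b \<le> t * f b" using nn by (intro mult_right_mono) (auto simp: S_def t_def)
        then show ?thesis using 2 nn t by (simp add: add_increasing)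
      next
        case 3
        then have "f a * f b \<le> f a * t" using nn by (intro mult_left_mono) (auto simp: S_def t_def)
        then show ?thesis using 3 nn t by (simp add: mult.commute add_increasing2)
      qed
    qed
    have "autocorr f g \<le> (\<Sum>a\<in>?V. m\<^sup>2 * of_bool (a \<in> S \<and> - g + a \<in> S) + t * f a + t * f (- g + a))"
      unfolding autocorr_def by (intro sum_mono pt)
    also have "\<dots> = m\<^sup>2 * (\<Sum>a\<in>?V. of_bool (a \<in> S \<and> - g + a \<in> S)) + t * (\<Sum>a\<in>?V. f a) + t * (\<Sum>a\<in>?V. f (- g + a))"
      by (simp add: sum.distrib sum_distrib_left)
    also have "(\<Sum>a\<in>?V. of_bool (a \<in> S \<and> - g + a \<in> S)) = real (popdiff S g)"
    proof -
      have "(\<Sum>a\<in>?V. of_bool (a \<in> S \<and> - g + a \<in> S)) = (\<Sum>a\<in>{a \<in> S. - g + a \<in> S}. 1::real)"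
        using V SV by (intro sum.mono_neutral_cong_right) auto
      then show ?thesis by (simp add: popdiff_def)
    qed
    also have "(\<Sum>a\<in>?V. f a) = 1" using f by (rule fprob_sum)
    also have "m\<^sup>2 * real (popdiff S g) + t * 1 + t * (\<Sum>a\<in>?V. f (- g + a)) \<le> m\<^sup>2 * real (popdiff S g) + t * 1 + t * 1"
      using sum_translate_le[OF f, of f g] f t fprob_nonneg[OF f] fprob_sum[OF f]
      by (intro add_left_mono mult_left_mono) auto
    finally show ?thesis by simp
  qed
  \<comment> \<open>Either the part from \<open>S\<close> is at least half of the autocorrelation,
    or the whole is at most \<open>4 * t\<close>. Summed over \<open>g\<close>, the second term
    costs \<open>4 * t\<close>, that is \<open>m / (2 * K)\<close>, half of the assumed
    energy.\<close>
  have sq: "(autocorr f g)\<^sup>2 \<le> 4 * m ^ 4 * real (popdiff S g) ^ 2 + 4 * t * autocorr f g" for g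
  proof (cases "autocorr f g \<le> 2 * (m\<^sup>2 * real (popdiff S g))")
    case True
    then have "(autocorr f g)\<^sup>2 \<le> (2 * (m\<^sup>2 * real (popdiff S g)))\<^sup>2"
      using f autocorr_nonneg by (intro power_mono) auto
    also have "\<dots> = 4 * m ^ 4 * real (popdiff S g) ^ 2"
      by (simp add: power_mult_distrib flip: power_mult)
    finally show ?thesis using t f autocorr_nonneg[OF f, of g] by (simp add: add_increasing2)
  next
    case False
    then have "autocorr f g \<le> 4 * t" using ub[of g] by linarith
    then have "(autocorr f g)\<^sup>2 \<le> 4 * t * autocorr f g"
      using autocorr_nonneg[OF f, of g] by (simp add: power2_eq_square mult_right_mono)
    then show ?thesis by (simp add: add_increasing)
  qed
  have "m / K \<le> (\<Sum>g\<in>?D. (autocorr f g)\<^sup>2)" using flat by (simp add: autocorr_0)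
  also have "\<dots> \<le> (\<Sum>g\<in>?D. 4 * m ^ 4 * real (popdiff S g) ^ 2 + 4 * t * autocorr f g)"
    by (intro sum_mono sq)
  also have "\<dots> = 4 * m ^ 4 * (\<Sum>g\<in>?D. real (popdiff S g) ^ 2) + 4 * t * (\<Sum>g\<in>?D. autocorr f g)"
    by (simp add: sum.distrib sum_distrib_left)
  also have "(\<Sum>g\<in>?D. autocorr f g) = 1" using fD by (rule fprob_sum)
  also have "(\<Sum>g\<in>?D. real (popdiff S g) ^ 2) \<le> E"
  proof -
    have "(\<Sum>g\<in>?D. real (popdiff S g) ^ 2) = (\<Sum>g\<in>?D \<inter> diffset S. real (popdiff S g) ^ 2)"
      using D popdiff_nonzero[of S] by (intro sum.mono_neutral_right) auto
    also have "\<dots> \<le> E" unfolding E_def using S by (intro sum_mono2) auto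
    finally show ?thesis .
  qed
  finally have "m / K \<le> 4 * m ^ 4 * E + 4 * t" using m by (simp add: mult_left_mono)
  then have "m / (2 * K) \<le> 4 * m ^ 4 * E" using K by (simp add: t_def field_simps)
  then have "m \<le> m * (8 * K * m ^ 3 * E)" using K by (simp add: field_simps power_eq_if)
  then have "1 \<le> 8 * K * m ^ 3 * E" using m by simp
  then show "1 / (8 * K * m ^ 3) \<le> (\<Sum>g\<in>diffset S. real (popdiff S g) ^ 2)"
    using m K unfolding E_def[symmetric] by (simp add: field_simps)
qed

section \<open>The Balog--Szemeredi--Gowers theorem in a group\<close>

text \<open>The counterpart of \<open>popdiff\<close> for left quotients. In a noncommutative group
  \<open>a - b\<close> and \<open>- a + b\<close> have to be told apart, and the next theorem passes
  from the first kind to the second.\<close>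

definition reps :: "'g::group_add set \<Rightarrow> 'g \<Rightarrow> ('g \<times> 'g) set" where
  "reps S x = {(t, s). t \<in> S \<and> s \<in> S \<and> - t + s = x}"

definition lquot :: "'g::group_add set \<Rightarrow> 'g set \<Rightarrow> 'g set" where
  "lquot A B = (\<lambda>(a, b). - a + b) ` (A \<times> B)"

lemma finite_lquot [simp]: "finite A \<Longrightarrow> finite B \<Longrightarrow> finite (lquot A B)"
  by (simp add: lquot_def)

lemma lquotI: "a \<in> A \<Longrightarrow> b \<in> B \<Longrightarrow> - a + b \<in> lquot A B"
  by (auto simp: lquot_def)

lemma lquotE: "x \<in> lquot A B \<Longrightarrow> (\<And>a b. a \<in> A \<Longrightarrow> b \<in> B \<Longrightarrow> x = - a + b \<Longrightarrow> thesis) \<Longrightarrow> thesis"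
  by (auto simp: lquot_def)

lemma reps_subset: "reps S x \<subseteq> S \<times> S"
  by (auto simp: reps_def)

lemma finite_reps [simp]: "finite S \<Longrightarrow> finite (reps S x)"
  by (rule finite_subset[OF reps_subset]) simp

lemma uminus_minus_add: "- (- t + s) = - s + (t::'g::group_add)"
  by (simp add: minus_add)

lemma card_reps_minus: "card (reps S (- x)) = card (reps S x)"
proof (rule bij_betw_same_card)
  show "bij_betw prod.swap (reps S (- x)) (reps S x)"
    by (rule bij_betw_byWitness[where f' = prod.swap])
      (auto simp: reps_def, (metis uminus_minus_add minus_minus)+)
qed

text \<open>Translating the pair back by \<open>g\<close> leaves its left quotient unchanged, and
  \<open>g\<close> can be recovered from the translated pair.\<close>

lemma card_translates_containing_pair:
  fixes S :: "'g::group_add set"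
  assumes S: "finite S"
  shows "card {g \<in> diffset S. - g + a \<in> S \<and> - g + b \<in> S} \<le> card (reps S (- b + a))"
proof (rule card_inj_on_le)
  let ?f = "\<lambda>g. (- g + b, - g + a)"
  show "inj_on ?f {g \<in> diffset S. - g + a \<in> S \<and> - g + b \<in> S}"
    by (rule inj_onI) simp
  have "- (- g + b) + (- g + a) = - b + a" for g
    by (simp add: uminus_minus_add add.assoc)
  then show "?f ` {g \<in> diffset S. - g + a \<in> S \<and> - g + b \<in> S} \<subseteq> reps S (- b + a)"
    by (auto simp: reps_def)
  show "finite (reps S (- b + a))" using S by simp
qed

lemma minus_add_add_minus_add: "(- c + b) + (- b + a) = - c + (a::'g::group_add)"
  by (simp add: add.assoc)

text \<open>Averaging yields a \<open>g\<close> for which \<open>T g\<close>, the intersection of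
  \<open>S\<close> with its translate by \<open>g\<close>, is large and contains few pairs with a
  rare left quotient. Let \<open>A\<close> consist of the points of \<open>T g\<close> with few such
  partners. Two points \<open>c\<close>, \<open>a\<close> of \<open>A\<close> share at least half of
  \<open>T g\<close> as good partners \<open>b\<close>, and
  \<open>- c + a = (- c + b) + (- b + a)\<close> then has so many representations by quadruples from
  \<open>S\<close> that there is room for few values only.\<close>

lemma balog_szemeredi_gowers:
  fixes S :: "'g::group_add set"
  assumes S: "finite S" "S \<noteq> {}" and K: "K \<ge> 1"
    and energy: "real (card S) ^ 3 / K \<le> (\<Sum>g\<in>diffset S. real (popdiff S g) ^ 2)"
  shows "\<exists>A\<subseteq>S. real (card S) / (4 * K) \<le> real (card A) \<and>
    real (card (lquot A A)) \<le> 4096 * K ^ 3 * real (card S)"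
proof -
  define n where "n = real (card S)"
  have n: "n > 0" using S by (simp add: n_def card_gt_0_iff)
  define T where "T g = {a \<in> S. - g + a \<in> S}" for g
  have T: "finite (T g)" "T g \<subseteq> S" for g using S by (auto simp: T_def)
  have popT: "popdiff S g = card (T g)" for g by (simp add: popdiff_def T_def)
  \<comment> \<open>With this threshold a bad pair lies in \<open>T g \<times> T g\<close> for at
    most \<open>n / (32 * K)\<close> elements \<open>g\<close>, so that 16 times the number of all
    occurrences of bad pairs is at most half of n^3 / K.\<close>
  define bad where "bad = {(a, b) \<in> S \<times> S. real (card (reps S (- b + a))) < n / (32 * K)}"
  have bad: "finite bad" "bad \<subseteq> S \<times> S"
    using S by (auto simp: bad_def intro: finite_subset[of _ "S \<times> S"])
  define B where "B g = bad \<inter> T g \<times> T g" for g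
  have finB: "finite (B g)" for g using bad by (simp add: B_def)
  have "(\<Sum>g\<in>diffset S. real (card (B g))) \<le> n ^ 3 / (32 * K)"
  proof -
    have "(\<Sum>g\<in>diffset S. card (B g)) = card (SIGMA g:diffset S. B g)"
      using S finB by simp
    also have "\<dots> = card (SIGMA p:bad. {g \<in> diffset S. p \<in> B g})"
      by (rule bij_betw_same_card[of prod.swap], rule bij_betw_byWitness[where f' = prod.swap])
        (auto simp: B_def)
    also have "\<dots> = (\<Sum>p\<in>bad. card {g \<in> diffset S. p \<in> B g})"
      using bad S by simp
    finally have "(\<Sum>g\<in>diffset S. real (card (B g))) = (\<Sum>p\<in>bad. real (card {g \<in> diffset S. p \<in> B g}))"
      by (metis (mono_tags, lifting) of_nat_sum sum.cong)
    also have "\<dots> \<le> (\<Sum>p\<in>bad. n / (32 * K))"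
    proof (rule sum_mono)
      fix p assume p: "p \<in> bad"
      obtain a b where ab: "p = (a, b)" by fastforce
      have "card {g \<in> diffset S. p \<in> B g} \<le> card {g \<in> diffset S. - g + a \<in> S \<and> - g + b \<in> S}"
        using S by (intro card_mono) (auto simp: B_def T_def ab)
      also have "\<dots> \<le> card (reps S (- b + a))"
        using S by (intro card_translates_containing_pair)
      finally show "real (card {g \<in> diffset S. p \<in> B g}) \<le> n / (32 * K)"
        using p by (simp add: bad_def ab)
    qed
    also have "\<dots> = real (card bad) * (n / (32 * K))" by simp
    also have "\<dots> \<le> (n * n) * (n / (32 * K))"
    proof (rule mult_right_mono)
      have "card bad \<le> card (S \<times> S)" using bad S by (intro card_mono) auto
      then show "real (card bad) \<le> n * n"
        unfolding n_def card_cartesian_product by (metis of_nat_le_iff of_nat_mult)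
      show "0 \<le> n / (32 * K)" using n K by simp
    qed
    finally show ?thesis by (simp add: power3_eq_cube)
  qed
  moreover have "n ^ 3 / K \<le> (\<Sum>g\<in>diffset S. real (card (T g)) ^ 2)"
    using energy by (simp add: n_def popT)
  moreover have "(\<Sum>g\<in>diffset S. real (card (T g))) = n ^ 2"
    using sum_popdiff[OF S(1)] unfolding popT n_def power2_eq_square
    by (metis (mono_tags, lifting) of_nat_mult of_nat_sum sum.cong)
  \<comment> \<open>One weighted average serves two purposes: a \<open>g\<close> that does at least
    as well as the average has both \<open>T g\<close> of size at least \<open>n / (2 * K)\<close>
    and at most a sixteenth of its pairs bad.\<close>
  ultimately have "n / (2 * K) * (\<Sum>g\<in>diffset S. real (card (T g)))
      \<le> (\<Sum>g\<in>diffset S. real (card (T g)) ^ 2) - 16 * (\<Sum>g\<in>diffset S. real (card (B g)))"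
    using n K by (simp add: field_simps power3_eq_cube power2_eq_square)
  then have le: "(\<Sum>g\<in>diffset S. n / (2 * K) * real (card (T g)))
      \<le> (\<Sum>g\<in>diffset S. real (card (T g)) ^ 2 - 16 * real (card (B g)))"
    by (simp add: sum_subtractf sum_distrib_left)
  have ne: "diffset S \<noteq> {}" using S by (auto simp: diffset_def)
  obtain g where g: "g \<in> diffset S"
    and le: "n / (2 * K) * real (card (T g)) \<le> real (card (T g)) ^ 2 - 16 * real (card (B g))"
  proof -
    have "\<exists>g\<in>diffset S. n / (2 * K) * real (card (T g)) \<le> real (card (T g)) ^ 2 - 16 * real (card (B g))"
    proof (rule ccontr)
      assume "\<not> ?thesis"
      then have "(\<Sum>g\<in>diffset S. real (card (T g)) ^ 2 - 16 * real (card (B g)))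
          < (\<Sum>g\<in>diffset S. n / (2 * K) * real (card (T g)))"
        using S ne by (intro sum_strict_mono) (auto simp: not_le)
      then show False using le by simp
    qed
    then show ?thesis using that by blast
  qed
  define \<tau> where "\<tau> = real (card (T g))"
  have \<tau>: "\<tau> > 0"
  proof -
    obtain a b where "a \<in> S" "b \<in> S" "g = a - b" using g by (auto simp: diffset_def)
    then have "a \<in> T g" by (simp add: T_def minus_minus_add_cancel)
    then show ?thesis using T by (auto simp: \<tau>_def card_gt_0_iff)
  qed
  have "n / (2 * K) * \<tau> \<le> \<tau> * \<tau>"
    using le by (simp add: \<tau>_def power2_eq_square)
  then have \<tau>n: "n / (2 * K) \<le> \<tau>" using \<tau> by (simp only: mult_le_cancel_right_pos)
  have "0 \<le> n / (2 * K) * real (card (T g))" using n K by simp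
  then have Bg: "16 * real (card (B g)) \<le> \<tau> ^ 2"
    using le by (simp add: \<tau>_def)
  define N where "N a = {b \<in> T g. (a, b) \<in> bad}" for a
  define A where "A = {a \<in> T g. 4 * real (card (N a)) \<le> \<tau>}"
  have finN: "finite (N a)" for a using T by (simp add: N_def)
  have A: "finite A" "A \<subseteq> T g" using T by (auto simp: A_def)
  have "real (card (T g - A)) * (\<tau> / 4) \<le> real (card (B g))"
  proof (rule card_fibres_le[where f = fst])
    show "finite (B g)" "finite (T g - A)" using finB T by auto
    have fin: "finite {q \<in> B g. fst q = a}" for a using finB by simp
    fix a assume a: "a \<in> T g - A"
    have "card (N a) = card ((\<lambda>b. (a, b)) ` N a)"
      by (subst card_image) (auto simp: inj_on_def)
    also have "\<dots> \<le> card {q \<in> B g. fst q = a}"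
      using a by (intro card_mono fin) (auto simp: N_def B_def)
    finally show "\<tau> / 4 \<le> real (card {q \<in> B g. fst q = a})" using a by (auto simp: A_def)
  qed
  then have "real (card (T g - A)) * \<tau> * 4 \<le> \<tau> * \<tau>" using Bg by (simp add: power2_eq_square)
  then have "real (card (T g - A)) * 4 \<le> \<tau>" using \<tau> by (metis mult.assoc mult.commute mult_le_cancel_left_pos)
  moreover have "real (card (T g - A)) = \<tau> - real (card A)"
    using A T by (simp add: card_Diff_subset \<tau>_def of_nat_diff card_mono)
  \<comment> \<open>At most a quarter of \<open>T g\<close> has more than a quarter of
    \<open>T g\<close> as bad partners, by the bound of one sixteenth.\<close>
  ultimately have "3 / 4 * \<tau> \<le> real (card A)" by simp
  then have cA: "n / (4 * K) \<le> real (card A)" using \<tau>n \<tau> by (simp add: field_simps)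
  have many: "\<tau> / 2 * (n / (32 * K))\<^sup>2 \<le> real (card {q \<in> (S \<times> S) \<times> (S \<times> S).
      (- fst (fst q) + snd (fst q)) + (- fst (snd q) + snd (snd q)) = x})" (is "_ \<le> real (card ?P)")
    if x: "x \<in> lquot A A" for x
  proof -
    obtain c a where ca: "c \<in> A" "a \<in> A" "x = - c + a" using x by (rule lquotE)
    define G where "G = T g - N a - N c"
    have G: "finite G" "G \<subseteq> S" using T by (auto simp: G_def)
    have "card (T g) \<le> card (G \<union> N a \<union> N c)"
      using T finN G by (intro card_mono) (auto simp: G_def)
    also have "\<dots> \<le> card G + card (N a) + card (N c)"
      by (meson add_le_mono1 card_Un_le le_trans)
    finally have "\<tau> \<le> real (card G) + real (card (N a)) + real (card (N c))"
      by (simp add: \<tau>_def)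
    then have cG: "\<tau> / 2 \<le> real (card G)" using ca by (simp add: A_def)
    have r1: "n / (32 * K) \<le> real (card (reps S (- c + b)))"
      and r2: "n / (32 * K) \<le> real (card (reps S (- b + a)))" if b: "b \<in> G" for b
    proof -
      have "(c, b) \<notin> bad" "(a, b) \<notin> bad" "a \<in> S" "b \<in> S" "c \<in> S"
        using b ca A T by (auto simp: G_def N_def)
      then show "n / (32 * K) \<le> real (card (reps S (- c + b)))" "n / (32 * K) \<le> real (card (reps S (- b + a)))"
        using card_reps_minus[of S "- b + c"] by (auto simp: bad_def uminus_minus_add)
    qed
    have "\<tau> / 2 * (n / (32 * K))\<^sup>2 \<le> real (card G) * (n / (32 * K))\<^sup>2"
      using cG by (intro mult_right_mono) auto
    also have "\<dots> = (\<Sum>b\<in>G. n / (32 * K) * (n / (32 * K)))" by (simp add: power2_eq_square)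
    also have "\<dots> \<le> (\<Sum>b\<in>G. real (card (reps S (- c + b))) * real (card (reps S (- b + a))))"
      using n K r1 r2 by (intro sum_mono mult_mono) auto
    also have "\<dots> = (\<Sum>b\<in>G. real (card (reps S (- c + b) \<times> reps S (- b + a))))"
      by (simp add: card_cartesian_product)
    also have "\<dots> = real (card (\<Union>b\<in>G. reps S (- c + b) \<times> reps S (- b + a)))"
    proof -
      have fin: "\<forall>b\<in>G. finite (reps S (- c + b) \<times> reps S (- b + a))" using S by simp
      have disj: "\<forall>b\<in>G. \<forall>b'\<in>G. b \<noteq> b' \<longrightarrow>
          (reps S (- c + b) \<times> reps S (- b + a)) \<inter> (reps S (- c + b') \<times> reps S (- b' + a)) = {}"
        by (auto simp: reps_def)
      show ?thesis by (subst card_UN_disjoint[OF G(1) fin disj]) (rule of_nat_sum[symmetric])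
    qed
    also have "\<dots> \<le> real (card ?P)"
      using S ca by (intro of_nat_mono card_mono) (auto simp: reps_def minus_add_add_minus_add)
    finally show ?thesis .
  qed
  have "real (card (lquot A A)) * (\<tau> / 2 * (n / (32 * K))\<^sup>2) \<le> real (card ((S \<times> S) \<times> (S \<times> S)))"
    by (rule card_fibres_le[OF _ _ many]) (use S A in auto)
  also have "\<dots> = n ^ 4"
    by (simp add: card_cartesian_product n_def power_eq_if)
  finally have "real (card (lquot A A)) * (\<tau> / 2 * (n / (32 * K))\<^sup>2) \<le> n ^ 4" .
  moreover have "real (card (lquot A A)) * ((n / (2 * K)) / 2 * (n / (32 * K))\<^sup>2)
      \<le> real (card (lquot A A)) * (\<tau> / 2 * (n / (32 * K))\<^sup>2)"
    using \<tau>n by (intro mult_left_mono mult_right_mono) auto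
  ultimately have "real (card (lquot A A)) * (n ^ 3 / (4096 * K ^ 3)) \<le> n * n ^ 3"
    by (simp add: power_divide power_mult_distrib power2_eq_square power3_eq_cube power4_eq_xxxx mult_ac)
  then have "real (card (lquot A A)) / (4096 * K ^ 3) * n ^ 3 \<le> n * n ^ 3" by simp
  then have "real (card (lquot A A)) / (4096 * K ^ 3) \<le> n" using n by (subst (asm) mult_le_cancel_right) auto
  then have "real (card (lquot A A)) \<le> 4096 * K ^ 3 * n" using K by (simp add: field_simps)
  then show ?thesis using A T cA by (intro exI[of _ A]) (auto simp: n_def)
qed

section \<open>From small doubling to approximate groups\<close>

definition sumset :: "'g::group_add set \<Rightarrow> 'g set \<Rightarrow> 'g set" where
  "sumset A B = (\<lambda>(a, b). a + b) ` (A \<times> B)"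

text \<open>The words of length exactly \<open>n\<close>; when \<open>H\<close> contains 0, shorter
  words are among them.\<close>

primrec nsum :: "'g::group_add set \<Rightarrow> nat \<Rightarrow> 'g set" where
  "nsum H 0 = {0}"
| "nsum H (Suc n) = sumset H (nsum H n)"

lemma finite_sumset [simp]: "finite A \<Longrightarrow> finite B \<Longrightarrow> finite (sumset A B)"
  by (simp add: sumset_def)

lemma finite_nsum [simp]: "finite H \<Longrightarrow> finite (nsum H n)"
  by (induction n) auto

lemma sumsetI: "a \<in> A \<Longrightarrow> b \<in> B \<Longrightarrow> a + b \<in> sumset A B"
  by (auto simp: sumset_def)

lemma sumset_assoc: "sumset (sumset A B) C = sumset A (sumset B C)"
  by (fastforce simp: sumset_def image_iff add.assoc)

text \<open>The differences with many representations: their sums stay under control because the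
  inner differences \<open>- b + a'\<close> of a sum of \<open>a - b\<close> and \<open>a' - b'\<close> lie in the small set \<open>lquot A A\<close>.\<close>

definition popular :: "real \<Rightarrow> 'g::group_add set \<Rightarrow> 'g set" where
  "popular k A = {g \<in> diffset A. k \<le> real (popdiff A g)}"

lemma popdiff_minus: "popdiff A (- g) = popdiff A (g::'g::group_add)"
  unfolding popdiff_def
  by (rule bij_betw_same_card[of "\<lambda>a. g + a"], rule bij_betw_byWitness[where f' = "\<lambda>a. - g + a"]) 
    (auto simp: add.assoc[symmetric])

lemma popular_minus: "g \<in> popular k A \<Longrightarrow> - g \<in> popular k A"
  unfolding popular_def popdiff_minus by (auto simp: diffset_def image_iff popdiff_minus) (metis minus_diff_eq)

text \<open>If \<open>b\<close> and \<open>- h + b\<close> are in \<open>A\<close>, then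
  \<open>- a + (h + x)\<close> is the sum of \<open>- a + b\<close> and
  \<open>- (- h + b) + x\<close>. A popular \<open>h\<close> offers at least \<open>k\<close> such
  \<open>b\<close>, so every element on the left has \<open>k\<close> representations. Iterated,
  this bounds products of popular differences without any growth inequality for general
  sets.\<close>

lemma card_lquot_popular:
  fixes A Z :: "'g::group_add set"
  assumes A: "finite A" and Z: "finite Z"
  shows "real (card (lquot A (sumset (popular k A) Z))) * k \<le> real (card (lquot A A)) * real (card (lquot A Z))"
proof -
  have fp: "finite (popular k A)" using A by (simp add: popular_def)
  have "real (card (lquot A (sumset (popular k A) Z))) * k \<le> real (card (lquot A A \<times> lquot A Z))"
  proof (rule card_fibres_le[where f = "\<lambda>(u, v). u + v"])
    show "finite (lquot A A \<times> lquot A Z)" "finite (lquot A (sumset (popular k A) Z))"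
      using A Z fp by auto
    fix z assume "z \<in> lquot A (sumset (popular k A) Z)"
    then obtain a h x where z: "a \<in> A" "h \<in> popular k A" "x \<in> Z" "z = - a + (h + x)"
      by (auto simp: lquot_def sumset_def)
    let ?f = "\<lambda>b. (- a + b, - (- h + b) + x)"
    have "popdiff A h \<le> card {q \<in> lquot A A \<times> lquot A Z. (\<lambda>(u, v). u + v) q = z}"
      unfolding popdiff_def
    proof (rule card_inj_on_le[of ?f])
      show "inj_on ?f {b \<in> A. - h + b \<in> A}"
        by (rule inj_onI) simp
      have "- a + b + (- (- h + b) + x) = z" for b
        by (simp add: z(4) uminus_minus_add add.assoc)
      then show "?f ` {b \<in> A. - h + b \<in> A} \<subseteq> {q \<in> lquot A A \<times> lquot A Z. (\<lambda>(u, v). u + v) q = z}"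
        using z by (auto intro!: lquotI)
      show "finite {q \<in> lquot A A \<times> lquot A Z. (\<lambda>(u, v). u + v) q = z}" using A Z by auto
    qed
    then show "k \<le> real (card {q \<in> lquot A A \<times> lquot A Z. (\<lambda>(u, v). u + v) q = z})"
      using z(2) by (simp add: popular_def)
  qed
  then show ?thesis by (simp add: card_cartesian_product)
qed

lemma card_le_card_lquot:
  assumes "finite A" "A \<noteq> {}" "finite Z"
  shows "card Z \<le> card (lquot A Z)"
proof -
  obtain a where "a \<in> A" using assms by auto
  have "inj_on (\<lambda>x. - a + x) Z" by (rule inj_on_add_left)
  moreover have "(\<lambda>x. - a + x) ` Z \<subseteq> lquot A Z" using \<open>a \<in> A\<close> by (auto intro: lquotI)
  ultimately show ?thesis using assms by (meson card_inj_on_le finite_lquot)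
qed

lemma card_translate_right:
  "card ((\<lambda>x. x + (a::'g::group_add)) ` Z) = card Z"
  by (intro card_image inj_onI) simp

text \<open>The equations \<open>a - b = c - d\<close> and \<open>- a + c = - b + d\<close> are
  equivalent in every group. Hence the energy can be computed with left quotients, where
  Cauchy-Schwarz over the small set \<open>lquot A A\<close> applies.\<close>

lemma diffset_energy:
  fixes A :: "'g::group_add set"
  assumes A: "finite A" "A \<noteq> {}" and K: "real (card (lquot A A)) \<le> K * real (card A)" "K \<ge> 1"
  shows "real (card A) ^ 3 / K \<le> (\<Sum>g\<in>diffset A. real (popdiff A g) ^ 2)"
proof -
  define n where "n = real (card A)"
  have n: "n > 0" using A by (simp add: n_def card_gt_0_iff)
  have eq: "(\<Sum>g\<in>diffset A. popdiff A g ^ 2) = (\<Sum>x\<in>lquot A A. card (reps A x) ^ 2)"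
  proof -
    have "(\<Sum>g\<in>diffset A. popdiff A g ^ 2) = card (SIGMA g:diffset A. {a \<in> A. - g + a \<in> A} \<times> {a \<in> A. - g + a \<in> A})"
      using A by (simp add: popdiff_def power2_eq_square card_cartesian_product)
    also have "\<dots> = card (SIGMA x:lquot A A. reps A x \<times> reps A x)"
    proof (rule bij_betw_same_card)
      show "bij_betw (\<lambda>(g, a, c). (- a + c, (a, c), (- g + a, - g + c)))
          (SIGMA g:diffset A. {a \<in> A. - g + a \<in> A} \<times> {a \<in> A. - g + a \<in> A})
          (SIGMA x:lquot A A. reps A x \<times> reps A x)"
      proof (rule bij_betw_byWitness[where f' = "\<lambda>(x, (a, c), (b, d)). (a - b, a, c)"])
        have d: "- (a - b) + c = d" if "- a + c = - b + d" for a b c d :: 'g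
        proof -
          have "- (a - b) + c = b + (- a + c)"
            by (metis add.assoc add_uminus_conv_diff minus_diff_eq)
          then show ?thesis using that by (metis add_minus_cancel)
        qed
        have d': "c - a + b = d" if "- c + d = - a + b" for a b c d :: 'g
        proof -
          have "c - a + b = c + (- a + b)"
            by (metis add.assoc add_uminus_conv_diff)
          then show ?thesis using that by (metis add_minus_cancel)
        qed
        have e: "- (- g + a) + (- g + c) = - a + c" for g a c :: 'g
          by (simp add: uminus_minus_add add.assoc)
        show "\<forall>a\<in>SIGMA g:diffset A. {a \<in> A. - g + a \<in> A} \<times> {a \<in> A. - g + a \<in> A}.
            (\<lambda>(x, (a, c), b, d). (a - b, a, c)) ((\<lambda>(g, a, c). (- a + c, (a, c), - g + a, - g + c)) a) = a"
          by (auto simp: diff_minus_add)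
        show "\<forall>a'\<in>SIGMA x:lquot A A. reps A x \<times> reps A x.
            (\<lambda>(g, a, c). (- a + c, (a, c), - g + a, - g + c)) ((\<lambda>(x, (a, c), b, d). (a - b, a, c)) a') = a'"
          by (auto simp: reps_def minus_minus_add_cancel intro: d d')
        show "(\<lambda>(g, a, c). (- a + c, (a, c), - g + a, - g + c)) `
            (SIGMA g:diffset A. {a \<in> A. - g + a \<in> A} \<times> {a \<in> A. - g + a \<in> A})
            \<subseteq> (SIGMA x:lquot A A. reps A x \<times> reps A x)"
          by (auto simp: reps_def e intro: lquotI)
        show "(\<lambda>(x, (a, c), b, d). (a - b, a, c)) ` (SIGMA x:lquot A A. reps A x \<times> reps A x)
            \<subseteq> (SIGMA g:diffset A. {a \<in> A. - g + a \<in> A} \<times> {a \<in> A. - g + a \<in> A})"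
          by (auto simp: reps_def diffset_def minus_minus_add_cancel d d')
      qed
    qed
    also have "\<dots> = (\<Sum>x\<in>lquot A A. card (reps A x) ^ 2)"
      using A by (simp add: power2_eq_square card_cartesian_product)
    finally show ?thesis .
  qed
  have tot: "(\<Sum>x\<in>lquot A A. real (card (reps A x))) = n * n"
  proof -
    have "(\<Sum>x\<in>lquot A A. card (reps A x)) = card (SIGMA x:lquot A A. reps A x)"
      using A by simp
    also have "\<dots> = card (A \<times> A)"
      by (rule bij_betw_same_card[of snd], rule bij_betw_byWitness[where f' = "\<lambda>(a, b). (- a + b, (a, b))"])
        (auto simp: reps_def intro: lquotI)
    finally have "real (\<Sum>x\<in>lquot A A. card (reps A x)) = real (card A * card A)"
      by (simp add: card_cartesian_product)
    then show ?thesis by (simp add: n_def)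
  qed
  have "(n * n)\<^sup>2 \<le> (\<Sum>x\<in>lquot A A. (real (card (reps A x)))\<^sup>2) * (\<Sum>x\<in>lquot A A. 1\<^sup>2)"
    using Cauchy_Schwarz_ineq_sum[of "\<lambda>x. real (card (reps A x))" "\<lambda>_. 1" "lquot A A"]
    unfolding tot[symmetric] by simp
  also have "\<dots> = (\<Sum>x\<in>lquot A A. (real (card (reps A x)))\<^sup>2) * real (card (lquot A A))" by simp
  also have "\<dots> \<le> (\<Sum>x\<in>lquot A A. (real (card (reps A x)))\<^sup>2) * (K * n)"
    using K by (intro mult_left_mono) (auto simp: n_def intro: sum_nonneg)
  finally have "n * n ^ 3 \<le> n * ((\<Sum>x\<in>lquot A A. (real (card (reps A x)))\<^sup>2) * K)"
    by (simp add: power2_eq_square power3_eq_cube mult_ac)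
  then have "n ^ 3 \<le> (\<Sum>x\<in>lquot A A. (real (card (reps A x)))\<^sup>2) * K" using n by simp
  also have "(\<Sum>x\<in>lquot A A. (real (card (reps A x)))\<^sup>2) = (\<Sum>g\<in>diffset A. real (popdiff A g) ^ 2)"
    using eq by (metis (mono_tags, lifting) of_nat_power of_nat_sum sum.cong)
  finally show ?thesis using K by (simp add: n_def field_simps)
qed

text \<open>Each factor \<open>H\<close> enlarges \<open>lquot A Z\<close> by at most
  \<open>2 * K\<^sup>2\<close>. This starts from \<open>Z = A\<close>, and the sets
  \<open>nsum H n\<close> are compared with \<open>H\<close> itself through a lower bound for the
  size of \<open>H\<close>.\<close>

lemma approximate_group_of_small_doubling:
  fixes A :: "'g::group_add set"
  assumes A: "finite A" "A \<noteq> {}" and K: "real (card (lquot A A)) \<le> K * real (card A)" "K \<ge> 1"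
  defines "H \<equiv> popular (real (card A) / (2 * K)) A"
  shows "finite H" "0 \<in> H" "\<And>h. h \<in> H \<Longrightarrow> - h \<in> H" "H \<subseteq> diffset A"
    "\<And>n. real (card (nsum H n)) \<le> (2 * K\<^sup>2) ^ Suc n * real (card H)"
    "real (card H) \<le> 2 * K ^ 3 * real (card A)"
    "\<exists>x. real (card A) / (4 * K ^ 4) \<le> real (card {a \<in> A. a - x \<in> H})"
proof -
  define n where "n = real (card A)"
  have n: "n > 0" using A by (simp add: n_def card_gt_0_iff)
  show fH: "finite H" using A by (simp add: H_def popular_def)
  show HA: "H \<subseteq> diffset A" by (auto simp: H_def popular_def)
  have "0 \<in> diffset A" using A by (force simp: diffset_def)
  moreover have "n / (2 * K) \<le> n" using n K by (simp add: field_simps)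
  ultimately show H0: "0 \<in> H" by (simp add: H_def popular_def popdiff_def n_def)
  show "- h \<in> H" if "h \<in> H" for h using that popular_minus unfolding H_def by blast
  have step: "real (card (lquot A (sumset H Z))) \<le> 2 * K\<^sup>2 * real (card (lquot A Z))" if "finite Z" for Z
  proof -
    have "real (card (lquot A (sumset H Z))) * (n / (2 * K)) \<le> real (card (lquot A A)) * real (card (lquot A Z))"
      using card_lquot_popular[OF A(1) that] unfolding H_def n_def by blast
    also have "\<dots> \<le> (K * n) * real (card (lquot A Z))"
      using K by (intro mult_right_mono) (auto simp: n_def)
    finally have "n * real (card (lquot A (sumset H Z))) \<le> n * (2 * K\<^sup>2 * real (card (lquot A Z)))"
      using K by (simp add: field_simps power2_eq_square)
    then show ?thesis using n by simp
  qed
  have pow: "real (card (lquot A (sumset (nsum H k) A))) \<le> (2 * K\<^sup>2) ^ k * (K * n)" for k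
  proof (induction k)
    case 0
    then show ?case using K by (simp add: sumset_def n_def image_def)
  next
    case (Suc k)
    have "real (card (lquot A (sumset (nsum H (Suc k)) A))) \<le> 2 * K\<^sup>2 * real (card (lquot A (sumset (nsum H k) A)))"
      using step[of "sumset (nsum H k) A"] A fH by (simp add: sumset_assoc)
    also have "\<dots> \<le> 2 * K\<^sup>2 * ((2 * K\<^sup>2) ^ k * (K * n))"
      using Suc by (intro mult_left_mono) auto
    finally show ?case by simp
  qed
  have le1: "real (card (nsum H k)) \<le> real (card (sumset (nsum H k) A))" for k
  proof -
    obtain a where a: "a \<in> A" using A by auto
    have "card ((\<lambda>x. x + a) ` nsum H k) \<le> card (sumset (nsum H k) A)"
      using a A fH by (intro card_mono) (auto intro: sumsetI)
    then show ?thesis by (simp add: card_translate_right)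
  qed
  have le2: "real (card (sumset (nsum H k) A)) \<le> (2 * K\<^sup>2) ^ k * (K * n)" for k
    using pow[of k] card_le_card_lquot[OF A, of "sumset (nsum H k) A"] fH A
    by (meson finite_nsum finite_sumset of_nat_mono order_trans)
  have HsA: "real (card (sumset H A)) \<le> 2 * K ^ 3 * n"
    using le2[of 1] by (simp add: sumset_def image_def power2_eq_square power3_eq_cube mult_ac)
  show cH: "real (card H) \<le> 2 * K ^ 3 * real (card A)"
    using le1[of 1] HsA by (simp add: sumset_def image_def n_def)
  \<comment> \<open>Differences below the popularity threshold carry at most half of the energy n^3
    / K; each popular one carries at most n^2.\<close>
  have Hlow: "n / (2 * K) \<le> real (card H)"
  proof -
    have "n ^ 3 / K \<le> (\<Sum>g\<in>diffset A. real (popdiff A g) ^ 2)"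
      using diffset_energy[OF A K] by (simp add: n_def)
    also have "\<dots> \<le> (\<Sum>g\<in>diffset A. of_bool (g \<in> H) * n\<^sup>2 + n / (2 * K) * real (popdiff A g))"
    proof (rule sum_mono)
      fix g assume g: "g \<in> diffset A"
      have le: "real (popdiff A g) \<le> n" using A by (auto simp: popdiff_def n_def intro!: card_mono)
      show "real (popdiff A g) ^ 2 \<le> of_bool (g \<in> H) * n\<^sup>2 + n / (2 * K) * real (popdiff A g)"
      proof (cases "g \<in> H")
        case True
        have "real (popdiff A g) ^ 2 \<le> n\<^sup>2" using le by (intro power_mono) auto
        then show ?thesis using True n K by (simp add: add_increasing2)
      next
        case False
        then have "real (popdiff A g) \<le> n / (2 * K)" using g by (auto simp: H_def popular_def n_def)
        from mult_right_mono[OF this, of "real (popdiff A g)"]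
          show ?thesis using False by (simp add: power2_eq_square)
      qed
    qed
    also have "\<dots> = (\<Sum>g\<in>diffset A. of_bool (g \<in> H)) * n\<^sup>2 + n / (2 * K) * (\<Sum>g\<in>diffset A. real (popdiff A g))"
      by (simp add: sum.distrib sum_distrib_left sum_distrib_right)
    also have "(\<Sum>g\<in>diffset A. of_bool (g \<in> H)) = real (card H)"
    proof -
      have "(\<Sum>g\<in>diffset A. of_bool (g \<in> H)) = (\<Sum>g\<in>H. 1::real)"
        using A HA by (intro sum.mono_neutral_cong_right) auto
      then show ?thesis by simp
    qed
    also have "(\<Sum>g\<in>diffset A. real (popdiff A g)) = n\<^sup>2"
      using sum_popdiff[OF A(1)] unfolding n_def power2_eq_square
      by (metis (mono_tags, lifting) of_nat_mult of_nat_sum sum.cong)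
    finally have "n\<^sup>2 * (n / (2 * K)) \<le> n\<^sup>2 * real (card H)"
      using K by (simp add: field_simps power2_eq_square power3_eq_cube)
    then show ?thesis using n by (simp only: mult_le_cancel_left_pos zero_less_power)
  qed
  show "real (card (nsum H k)) \<le> (2 * K\<^sup>2) ^ Suc k * real (card H)" for k
  proof -
    have "real (card (nsum H k)) \<le> (2 * K\<^sup>2) ^ k * (K * n)" using le1 le2 order_trans by blast
    also have "\<dots> = (2 * K\<^sup>2) ^ Suc k * (n / (2 * K))" using K by (simp add: field_simps power2_eq_square)
    also have "\<dots> \<le> (2 * K\<^sup>2) ^ Suc k * real (card H)" using Hlow by (intro mult_left_mono) auto
    finally show ?thesis .
  qed
  show "\<exists>x. real (card A) / (4 * K ^ 4) \<le> real (card {a \<in> A. a - x \<in> H})"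
  proof -
    \<comment> \<open>The map takes values in the small set \<open>sumset H A\<close>, as
      \<open>H\<close> is symmetric. A value \<open>x\<close> that is taken often gives many
      \<open>a = h + x\<close>, that is, many points of \<open>A\<close> in one right translate of
      \<open>H\<close>.\<close>
    let ?f = "\<lambda>(h, a). - h + a"
    have "H \<times> A \<noteq> {}" using H0 A by auto
    moreover have "?f ` (H \<times> A) \<subseteq> sumset H A"
      using popular_minus[of _ _ A] by (auto simp: H_def intro!: sumsetI)
    then have "real (card (?f ` (H \<times> A))) \<le> 2 * K ^ 3 * n"
      using HsA A fH by (meson card_mono finite_sumset of_nat_mono order_trans)
    ultimately obtain x where x: "real (card (H \<times> A)) / (2 * K ^ 3 * n) \<le> real (card {q \<in> H \<times> A. ?f q = x})"
      using exists_fibre_ge[of "H \<times> A" ?f "2 * K ^ 3 * n"] A fH n K by auto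
    have "real (card A) / (4 * K ^ 4) = n / (2 * K) / (2 * K ^ 3)"
      using K by (simp add: n_def power_eq_if)
    also have "\<dots> \<le> real (card H) / (2 * K ^ 3)"
      using Hlow K by (intro divide_right_mono) auto
    also have "\<dots> = real (card (H \<times> A)) / (2 * K ^ 3 * n)"
      using n by (simp add: card_cartesian_product n_def)
    also note x
    also have "card {q \<in> H \<times> A. ?f q = x} \<le> card {a \<in> A. a - x \<in> H}"
    proof (rule card_inj_on_le[of snd])
      show "inj_on snd {q \<in> H \<times> A. ?f q = x}"
        by (rule inj_onI) auto
      show "snd ` {q \<in> H \<times> A. ?f q = x} \<subseteq> {a \<in> A. a - x \<in> H}"
        by (auto simp: diff_minus_add)
      show "finite {a \<in> A. a - x \<in> H}" using A by simp
    qed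
    finally show ?thesis by auto
  qed
qed

text \<open>All losses are stated as powers of \<open>2 * K\<close>: in each of them the exponent of
  2 exceeds that of \<open>K\<close>, so it can serve for both.\<close>

lemma approximate_group_of_flat:
  fixes f :: "'g::group_add \<Rightarrow> real"
  assumes f: "fprob f" and m: "\<And>x. f x \<le> m" "m > 0" and K: "K \<ge> 1"
    and flat: "m / K \<le> autocorr (autocorr f) 0"
  shows "\<exists>H. finite H \<and> 0 \<in> H \<and> (\<forall>h\<in>H. - h \<in> H) \<and> H \<subseteq> diffset {x. f x \<noteq> 0} \<and>
    (\<forall>n. real (card (nsum H n)) \<le> (2 * K) ^ (125 * Suc n) * real (card H)) \<and>
    real (card H) \<le> (2 * K) ^ 190 / m \<and>
    (\<exists>z. 1 / (2 * K) ^ 268 \<le> (\<Sum>x | f x \<noteq> 0 \<and> x - z \<in> H. f x))"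
proof -
  define S where "S = {x. m / (8 * K) \<le> f x}"
  define E where "E = (\<Sum>g\<in>diffset S. real (popdiff S g) ^ 2)"
  define s where "s = real (card S)"
  have S: "finite S" and s: "s \<le> 8 * K / m" and E: "1 / (8 * K * m ^ 3) \<le> E"
    using level_set_energy[OF f m K flat] unfolding S_def E_def s_def by blast+
  have SV: "S \<subseteq> {x. f x \<noteq> 0}" using m K by (auto simp: S_def field_simps)
  have s3: "E \<le> s ^ 3" using sum_popdiff_square_le[OF S] by (simp add: E_def s_def)
  \<comment> \<open>The energy of a set is at most the cube of its size, so the energy bound also
    forces the level set to be large.\<close>
  have slow: "1 / (2 * K * m) \<le> s"
  proof (rule power_le_imp_le_base)
    have "(1 / (2 * K * m)) ^ Suc 2 = 1 / (8 * K ^ 3 * m ^ 3)"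
      by (simp add: power_divide power_mult_distrib)
    also have "\<dots> \<le> 1 / (8 * K * m ^ 3)"
      using K m self_le_power[OF K, of 3] by (intro divide_left_mono mult_right_mono) auto
    finally show "(1 / (2 * K * m)) ^ Suc 2 \<le> s ^ Suc 2" using E s3 by (simp add: eval_nat_numeral)
    show "0 \<le> s" by (simp add: s_def)
  qed
  have s0: "s > 0" using slow K m by (smt (verit) divide_pos_pos mult_pos_pos)
  then have Sne: "S \<noteq> {}" by (auto simp: s_def)
  have ge1: "1 \<le> 2 ^ i * K ^ j" for i j :: nat
  proof -
    have "1 * 1 \<le> 2 ^ i * K ^ j" by (rule mult_mono) (use one_le_power[OF K] in auto)
    then show ?thesis by (simp only: mult_1)
  qed
  \<comment> \<open>The energy of the level set relative to its size: (8 K / m)^3 divided by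
    \<open>K1\<close> equals 1 / (8 K m^3).\<close>
  define K1 where "K1 = 2 ^ 12 * K ^ 4"
  have K1: "K1 \<ge> 1" unfolding K1_def by (rule ge1)
  have "s ^ 3 / K1 \<le> (8 * K / m) ^ 3 / K1"
    using s s0 K1 by (intro divide_right_mono power_mono) auto
  also have "\<dots> = 1 / (8 * K * m ^ 3)"
    using K m unfolding K1_def
    by (simp add: power_divide power_mult_distrib field_simps) (simp add: power_numeral_reduce)
  also note E
  finally obtain A where A: "A \<subseteq> S" "s / (4 * K1) \<le> real (card A)"
      "real (card (lquot A A)) \<le> 4096 * K1 ^ 3 * s"
    using balog_szemeredi_gowers[OF S Sne K1] unfolding s_def E_def by blast
  \<comment> \<open>The doubling of \<open>A\<close> relative to its own size: the bound for
    \<open>lquot A A\<close> in terms of \<open>s\<close>, times the loss \<open>4 * K1\<close> in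
    passing from \<open>s\<close> to the size of \<open>A\<close>.\<close>
  define K2 where "K2 = 2 ^ 62 * K ^ 16"
  have K2: "K2 \<ge> 1" unfolding K2_def by (rule ge1)
  have K2_K1: "K2 = 4096 * K1 ^ 3 * (4 * K1)"
    unfolding K1_def K2_def by (simp add: power_mult_distrib)
  have finA: "finite A" using A S finite_subset by blast
  have "s / (4 * K1) > 0" using s0 K1 by simp
  then have Ane: "A \<noteq> {}" using A by auto
  have "4096 * K1 ^ 3 * s = K2 * (s / (4 * K1))" using K1 by (simp add: K2_K1)
  also have "\<dots> \<le> K2 * real (card A)" using A K2 by (intro mult_left_mono) auto
  finally have dbl: "real (card (lquot A A)) \<le> K2 * real (card A)" using A by linarith
  define H where "H = popular (real (card A) / (2 * K2)) A"
  note H = approximate_group_of_small_doubling[OF finA Ane dbl K2, folded H_def]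
  have powK: "K ^ i \<le> K ^ j" if "i \<le> j" for i j using that K by (rule power_increasing)
  have pow2K: "2 ^ j * K ^ i \<le> (2 * K) ^ j" if "i \<le> j" for i j :: nat
    using powK[OF that] by (simp add: power_mult_distrib)
  have "H \<subseteq> diffset {x. f x \<noteq> 0}"
    using H(4) A SV by (force simp: diffset_def)
  moreover have "real (card (nsum H n)) \<le> (2 * K) ^ (125 * Suc n) * real (card H)" for n
  proof -
    have "2 * K2\<^sup>2 = 2 ^ 125 * K ^ 32"
      unfolding K2_def by (simp add: power_mult_distrib)
    also have "\<dots> \<le> (2 * K) ^ 125" by (rule pow2K) simp
    finally have "(2 * K2\<^sup>2) ^ Suc n \<le> ((2 * K) ^ 125) ^ Suc n" by (intro power_mono) auto
    then have "(2 * K2\<^sup>2) ^ Suc n * real (card H) \<le> (2 * K) ^ (125 * Suc n) * real (card H)"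
      unfolding power_mult by (intro mult_right_mono) auto
    then show ?thesis using H(5)[of n] by linarith
  qed
  moreover have "real (card H) \<le> (2 * K) ^ 190 / m"
  proof -
    have "real (card H) \<le> 2 * K2 ^ 3 * real (card A)" by (rule H(6))
    also have "\<dots> \<le> 2 * K2 ^ 3 * (8 * K / m)"
      using A S s K2 card_mono[OF S A(1)] by (intro mult_left_mono) (auto simp: s_def)
    also have "\<dots> = 2 ^ 190 * K ^ 49 / m"
      unfolding K2_def by (simp add: power_mult_distrib) (simp add: power_numeral_reduce mult_ac)
    also have "\<dots> \<le> (2 * K) ^ 190 / m" using m by (intro divide_right_mono pow2K) auto
    finally show ?thesis .
  qed
  moreover have "\<exists>z. 1 / (2 * K) ^ 268 \<le> (\<Sum>x | f x \<noteq> 0 \<and> x - z \<in> H. f x)"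
  proof -
    obtain z where z: "real (card A) / (4 * K2 ^ 4) \<le> real (card {a \<in> A. a - z \<in> H})"
      using H(7) by blast
    have "1 / (2 * K) ^ 268 \<le> 1 / (2 ^ 268 * K ^ 70)"
      using pow2K[of 70 268] K by (intro divide_left_mono) auto
    also have "\<dots> = m / (8 * K) * (1 / (2 * K * m) / (4 * K1) / (4 * K2 ^ 4))"
    proof -
      have "8 * K * (2 * K) * (4 * K1) * (4 * K2 ^ 4) = 2 ^ 268 * K ^ 70"
        unfolding K1_def K2_def
        by (simp add: power_mult_distrib) (simp add: power_numeral_reduce mult_ac)
      then have "1 / (2 ^ 268 * K ^ 70) = 1 / (8 * K * (2 * K) * (4 * K1) * (4 * K2 ^ 4))" by simp
      also have "\<dots> = m / (8 * K) * (1 / (2 * K * m) / (4 * K1) / (4 * K2 ^ 4))"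
        using m by simp
      finally show ?thesis .
    qed
    also have "\<dots> \<le> m / (8 * K) * (s / (4 * K1) / (4 * K2 ^ 4))"
      using slow m K K1 K2 by (intro mult_left_mono divide_right_mono) auto
    also have "\<dots> \<le> m / (8 * K) * (real (card A) / (4 * K2 ^ 4))"
      using A m K K2 by (intro mult_left_mono divide_right_mono) auto
    also have "\<dots> \<le> m / (8 * K) * real (card {a \<in> A. a - z \<in> H})"
      using z m K by (intro mult_left_mono) auto
    also have "\<dots> = (\<Sum>x\<in>{a \<in> A. a - z \<in> H}. m / (8 * K))" by simp
    also have "\<dots> \<le> (\<Sum>x\<in>{a \<in> A. a - z \<in> H}. f x)"
      using A by (intro sum_mono) (auto simp: S_def)
    also have "\<dots> \<le> (\<Sum>x | f x \<noteq> 0 \<and> x - z \<in> H. f x)"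
      using A SV fprob_finite[OF f] fprob_nonneg[OF f] by (intro sum_mono2) auto
    finally show ?thesis by blast
  qed
  ultimately show ?thesis using H(1-3) by (intro exI[of _ H]) simp
qed

section \<open>Richness along the autocorrelation sequence\<close>

text \<open>The group operation is written additively because \<open>group_add\<close> is the class of possibly
  noncommutative groups.\<close>

typedef 'a bijection = "{f :: 'a \<Rightarrow> 'a. bij f}" morphisms app Bij
  by (rule exI[of _ id]) simp

instantiation bijection :: (type) group_add
begin

definition zero_bijection :: "'a bijection" where "0 = Bij id"
definition plus_bijection :: "'a bijection \<Rightarrow> 'a bijection \<Rightarrow> 'a bijection" where
  "g + h = Bij (app g \<circ> app h)"
definition uminus_bijection :: "'a bijection \<Rightarrow> 'a bijection" where
  "- g = Bij (inv_into UNIV (app g))"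
definition minus_bijection :: "'a bijection \<Rightarrow> 'a bijection \<Rightarrow> 'a bijection" where
  "g - h = g + - (h :: 'a bijection)"

lemma bij_app: "bij (app g)"
  using app by auto

lemma app_plus: "app (g + h) x = app g (app h x)"
  by (simp add: plus_bijection_def Bij_inverse bij_comp bij_app)

lemma app_zero: "app 0 x = x"
  by (simp add: zero_bijection_def Bij_inverse)

lemma app_uminus: "app (- g) = inv_into UNIV (app g)"
  by (simp add: uminus_bijection_def Bij_inverse bij_app bij_imp_bij_inv)

lemma bijection_eqI: "(\<And>x. app g x = app h x) \<Longrightarrow> g = h"
  by (simp add: app_inject[symmetric] fun_eq_iff)

instance
proof
  fix a b c :: "'a bijection"
  show "a + b + c = a + (b + c)" by (rule bijection_eqI) (simp add: app_plus)
  show "0 + a = a" by (rule bijection_eqI) (simp add: app_plus app_zero)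
  show "a + 0 = a" by (rule bijection_eqI) (simp add: app_plus app_zero)
  show "- a + a = 0"
    by (rule bijection_eqI) (simp add: app_plus app_zero app_uminus bij_app bij_is_inj inv_f_f)
  show "a + - b = a - b" by (simp add: minus_bijection_def)
qed

end

lemma app_uminus_app [simp]: "app (- g) (app g x) = x" "app g (app (- g) x) = x"
  by (metis app_plus app_zero left_minus, metis app_plus app_zero right_minus)

lemma app_eq_iff [simp]: "app g x = app g y \<longleftrightarrow> x = y"
  by (metis app_uminus_app(1))

definition hits :: "'a set \<Rightarrow> 'a bijection \<Rightarrow> nat" where
  "hits Y g = card {y \<in> Y. app g y \<in> Y}"

text \<open>Put \<open>y = b z\<close>: then \<open>a z\<close> is the image of \<open>y\<close>
  under \<open>a - b\<close>.\<close>

lemma hits_diff: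
  assumes "finite Y"
  shows "card {z \<in> Y. app a z \<in> Y \<and> app b z \<in> Y} \<le> hits Y (a - b)"
  unfolding hits_def
proof (rule card_inj_on_le)
  show "inj_on (app b) {z \<in> Y. app a z \<in> Y \<and> app b z \<in> Y}" by (rule inj_onI) simp
  have "app (a - b) (app b z) = app a z" for z
    by (metis app_plus diff_add_cancel)
  then show "app b ` {z \<in> Y. app a z \<in> Y \<and> app b z \<in> Y} \<subseteq> {y \<in> Y. app (a - b) y \<in> Y}" by auto
  show "finite {y \<in> Y. app (a - b) y \<in> Y}" using assms by simp
qed

lemma sum_square_le_card_sum:
  fixes F :: "'b \<Rightarrow> real"
  shows "(\<Sum>z\<in>Y. F z)\<^sup>2 \<le> real (card Y) * (\<Sum>z\<in>Y. (F z)\<^sup>2)"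
  using Cauchy_Schwarz_ineq_sum[of "\<lambda>_. 1" F Y] by simp

text \<open>The auxiliary \<open>F z\<close> is the probability that a random map sends
  \<open>z\<close> into \<open>Y\<close>. Cauchy-Schwarz over \<open>z\<close> produces the
  probability that two independent maps \<open>a\<close>, \<open>b\<close> both do so, and then
  \<open>a - b\<close> sends the point \<open>b z\<close> of \<open>Y\<close> back into
  \<open>Y\<close>.\<close>

lemma mean_hits_autocorr:
  assumes f: "fprob f" and Y: "finite Y"
  shows "(\<Sum>g | f g \<noteq> 0. f g * real (hits Y g))\<^sup>2
    \<le> real (card Y) * (\<Sum>g | autocorr f g \<noteq> 0. autocorr f g * real (hits Y g))"
proof -
  let ?V = "{g. f g \<noteq> 0}"
  have V: "finite ?V" using f by (rule fprob_finite)
  define F where "F z = (\<Sum>g\<in>?V. f g * of_bool (app g z \<in> Y))" for z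
  have cnt: "real (card {z \<in> Y. P z}) = (\<Sum>z\<in>Y. of_bool (P z))" for P
    using Y by (simp add: Int_def)
  have "(\<Sum>g\<in>?V. f g * real (hits Y g)) = (\<Sum>z\<in>Y. F z)"
    unfolding hits_def cnt sum_distrib_left F_def by (rule sum.swap)
  then have "(\<Sum>g\<in>?V. f g * real (hits Y g))\<^sup>2 \<le> real (card Y) * (\<Sum>z\<in>Y. (F z)\<^sup>2)"
    using sum_square_le_card_sum[of F Y] by simp
  also have "(\<Sum>z\<in>Y. (F z)\<^sup>2) = (\<Sum>z\<in>Y. \<Sum>a\<in>?V. \<Sum>b\<in>?V. f a * f b * of_bool (app a z \<in> Y \<and> app b z \<in> Y))"
    unfolding F_def power2_eq_square sum_product by (intro sum.cong) (auto simp: mult_ac)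
  also have "\<dots> = (\<Sum>a\<in>?V. \<Sum>b\<in>?V. \<Sum>z\<in>Y. f a * f b * of_bool (app a z \<in> Y \<and> app b z \<in> Y))"
    by (subst sum.swap, rule sum.cong[OF refl], rule sum.swap)
  also have "\<dots> = (\<Sum>a\<in>?V. \<Sum>b\<in>?V. f a * f b * real (card {z \<in> Y. app a z \<in> Y \<and> app b z \<in> Y}))"
    unfolding cnt sum_distrib_left ..
  also have "\<dots> \<le> (\<Sum>a\<in>?V. \<Sum>b\<in>?V. f a * f b * real (hits Y (a - b)))"
    using f Y by (intro sum_mono mult_left_mono of_nat_mono hits_diff mult_nonneg_nonneg fprob_nonneg) auto
  also have "\<dots> = (\<Sum>g | autocorr f g \<noteq> 0. autocorr f g * real (hits Y g))"
    by (rule sum_autocorr[OF f _ order_refl, symmetric]) (intro fprob_finite fprob_autocorr f)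
  finally show ?thesis by (simp add: mult_left_mono)
qed

lemma fprob_autocorr_iter: "fprob f \<Longrightarrow> fprob ((autocorr ^^ j) f)"
  by (induction j) (auto intro: fprob_autocorr)

lemma mean_hits_autocorr_iter:
  assumes f: "fprob f" and Y: "finite Y" "Y \<noteq> {}" and \<alpha>: "\<alpha> \<ge> 0"
    and rich: "\<alpha> * real (card Y) \<le> (\<Sum>g | f g \<noteq> 0. f g * real (hits Y g))"
  shows "\<alpha> ^ 2 ^ j * real (card Y)
    \<le> (\<Sum>g | (autocorr ^^ j) f g \<noteq> 0. (autocorr ^^ j) f g * real (hits Y g))"
proof (induction j)
  case 0
  then show ?case using rich by simp
next
  case (Suc j)
  let ?f = "(autocorr ^^ j) f"
  have N: "real (card Y) > 0" using Y by (simp add: card_gt_0_iff)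
  have "real (card Y) * (\<alpha> ^ 2 ^ Suc j * real (card Y)) = (\<alpha> ^ 2 ^ j * real (card Y))\<^sup>2"
    by (simp add: power2_eq_square power_add mult_2 mult_ac)
  also have "\<dots> \<le> (\<Sum>g | ?f g \<noteq> 0. ?f g * real (hits Y g))\<^sup>2"
    using Suc \<alpha> by (intro power_mono) auto
  also have "\<dots> \<le> real (card Y) * (\<Sum>g | autocorr ?f g \<noteq> 0. autocorr ?f g * real (hits Y g))"
    by (intro mean_hits_autocorr fprob_autocorr_iter f Y)
  finally show ?case using N by simp
qed

text \<open>Elements with at most one incidence contribute at most 1 to the mean; the others are
  determined by two points of \<open>Y\<close> and their images.\<close>

lemma mean_hits_le:
  assumes f: "fprob f" and m: "\<And>x. f x \<le> m" and Y: "finite Y"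
    and det: "\<And>g h x y. f g \<noteq> 0 \<Longrightarrow> f h \<noteq> 0 \<Longrightarrow> x \<noteq> y \<Longrightarrow> x \<in> Y \<Longrightarrow> y \<in> Y \<Longrightarrow>
      app g x = app h x \<Longrightarrow> app g y = app h y \<Longrightarrow> g = h"
  shows "(\<Sum>g | f g \<noteq> 0. f g * real (hits Y g)) \<le> 1 + m * real (card Y) ^ 5"
proof -
  let ?V = "{g. f g \<noteq> 0}"
  have V: "finite ?V" using f by (rule fprob_finite)
  have m0: "m \<ge> 0" using m[of 0] fprob_nonneg[OF f] by (meson order_trans)
  define P where "P = {g. f g \<noteq> 0 \<and> hits Y g \<ge> 2}"
  have P: "finite P" "P \<subseteq> ?V" using V by (auto simp: P_def)
  have "\<exists>x y. x \<noteq> y \<and> x \<in> Y \<and> y \<in> Y \<and> app g x \<in> Y \<and> app g y \<in> Y" if "g \<in> P" for g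
  proof -
    have "\<not> card {y \<in> Y. app g y \<in> Y} \<le> Suc 0" using that by (auto simp: P_def hits_def)
    then show ?thesis using Y by (auto simp: card_le_Suc0_iff_eq)
  qed
  then obtain u v where uv: "\<And>g. g \<in> P \<Longrightarrow> u g \<noteq> v g \<and> u g \<in> Y \<and> v g \<in> Y \<and> app g (u g) \<in> Y \<and> app g (v g) \<in> Y"
    by metis
  have "card P \<le> card ((Y \<times> Y) \<times> (Y \<times> Y))"
  proof (rule card_inj_on_le[of "\<lambda>g. ((u g, v g), (app g (u g), app g (v g)))"])
    show "inj_on (\<lambda>g. ((u g, v g), (app g (u g), app g (v g)))) P"
    proof (rule inj_onI)
      fix g h assume gh: "g \<in> P" "h \<in> P"
        and eq: "((u g, v g), (app g (u g), app g (v g))) = ((u h, v h), (app h (u h), app h (v h)))"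
      from gh have "f g \<noteq> 0" "f h \<noteq> 0" by (auto simp: P_def)
      then show "g = h" using det[of g h "u g" "v g"] uv[OF gh(1)] eq by auto
    qed
  qed (use uv Y in auto)
  then have "card P \<le> card Y ^ 4"
    by (simp add: card_cartesian_product eval_nat_numeral mult_ac)
  then have cP: "real (card P) \<le> real (card Y) ^ 4"
    by (metis of_nat_le_iff of_nat_power)
  have "(\<Sum>g\<in>?V. f g * real (hits Y g)) \<le> (\<Sum>g\<in>?V. f g + m * real (card Y) * of_bool (g \<in> P))"
  proof (rule sum_mono)
    fix g assume g: "g \<in> ?V"
    show "f g * real (hits Y g) \<le> f g + m * real (card Y) * of_bool (g \<in> P)"
    proof (cases "g \<in> P")
      case True
      have "hits Y g \<le> card Y" unfolding hits_def using Y by (intro card_mono) auto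
      then have "f g * real (hits Y g) \<le> m * real (card Y)"
        using m m0 by (intro mult_mono) auto
      then show ?thesis using True fprob_nonneg[OF f, of g] by simp
    next
      case False
      then have "hits Y g \<le> 1" using g by (auto simp: P_def)
      then have "f g * real (hits Y g) \<le> f g * 1"
        using fprob_nonneg[OF f, of g] by (intro mult_left_mono) auto
      then show ?thesis using False by simp
    qed
  qed
  also have "\<dots> = (\<Sum>g\<in>?V. f g) + m * real (card Y) * (\<Sum>g\<in>?V. of_bool (g \<in> P))"
    by (simp add: sum.distrib sum_distrib_left)
  also have "(\<Sum>g\<in>?V. of_bool (g \<in> P)) = real (card P)"
    using V P by (simp add: Int_absorb1)
  also have "(\<Sum>g\<in>?V. f g) = 1" using f by (rule fprob_sum)
  also have "1 + m * real (card Y) * real (card P) \<le> 1 + m * real (card Y) * real (card Y) ^ 4"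
    using cP m0 by (intro add_left_mono mult_left_mono) auto
  finally show ?thesis by (simp add: eval_nat_numeral mult_ac)
qed

text \<open>The sum of the squares of a probability distribution is at most its largest value. The
  range begins at 1 because the largest value of \<open>f\<close> itself may lie elsewhere than at
  0.\<close>

lemma autocorr_iter_0_antimono:
  assumes f: "fprob f" and "1 \<le> i" "i \<le> j"
  shows "(autocorr ^^ j) f 0 \<le> (autocorr ^^ i) f 0"
  using assms(3)
proof (induction j rule: dec_induct)
  case (step n)
  obtain k where k: "n = Suc k" using step assms by (cases n) auto
  let ?h = "(autocorr ^^ n) f"
  have h: "fprob ?h" by (intro fprob_autocorr_iter f)
  have le: "?h x \<le> ?h 0" for x
    unfolding k by simp (intro autocorr_le_0 fprob_autocorr_iter f)
  have "autocorr ?h 0 = (\<Sum>x | ?h x \<noteq> 0. (?h x)\<^sup>2)" by (rule autocorr_0)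
  also have "\<dots> \<le> (\<Sum>x | ?h x \<noteq> 0. ?h x * ?h 0)"
    unfolding power2_eq_square by (intro sum_mono mult_left_mono le fprob_nonneg h)
  also have "\<dots> = ?h 0" using fprob_sum[OF h] by (simp flip: sum_distrib_right)
  finally show ?case using step by simp
qed simp

text \<open>Otherwise the disjoint double steps from 1 to 3, from 3 to 5 and so on would each lose
  the factor \<open>N powr (24 / real J)\<close>. There are at least \<open>J / 4\<close> of them,
  so the value at \<open>J\<close> would fall below \<open>N powr (-6)\<close>.\<close>

lemma exists_flat_step:
  fixes a :: "nat \<Rightarrow> real"
  assumes J: "J \<ge> 4" and N: "N \<ge> (1::real)" and a1: "a 1 \<le> 1"
    and anti: "\<And>i j. 1 \<le> i \<Longrightarrow> i \<le> j \<Longrightarrow> a j \<le> a i" and aJ: "N powr (-6) \<le> a J"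
  shows "\<exists>j\<ge>1. j + 2 \<le> J \<and> a j / N powr (24 / real J) \<le> a (j + 2)"
proof (rule ccontr)
  define q where "q = 1 / N powr (24 / real J)"
  have q: "0 < q" "q \<le> 1" using N J by (auto simp: q_def ge_one_powr_ge_zero)
  assume "\<not> ?thesis"
  then have lt: "a (j + 2) < a j * q" if "j \<ge> 1" "j + 2 \<le> J" for j
    using that by (force simp: q_def)
  define n where "n = (J - 1) div 2"
  have n: "n \<ge> 1" "2 * n + 1 \<le> J" "real J / 4 \<le> real n" using J by (auto simp: n_def)
  have "a (2 * k + 3) < q ^ Suc k" if "k < n" for k
    using that
  proof (induction k)
    case 0
    have "a 3 < a 1 * q" using lt[of 1] n 0 by (simp add: eval_nat_numeral)
    also have "\<dots> \<le> 1 * q" using a1 q by (intro mult_right_mono) auto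
    finally show ?case by simp
  next
    case (Suc k)
    have "a (2 * Suc k + 3) < a (2 * k + 3) * q" using lt[of "2 * k + 3"] Suc n by (simp add: add_ac)
    also have "\<dots> \<le> q ^ Suc k * q" using Suc q by (intro mult_right_mono) auto
    finally show ?case by (simp add: mult.commute)
  qed
  from this[of "n - 1"] have "a (2 * n + 1) < q ^ n"
    using n by (cases n) (auto simp: eval_nat_numeral)
  also have "q ^ n = q powr real n" using q by (simp add: powr_realpow)
  also have "\<dots> \<le> q powr (real J / 4)" using q n powr_mono' by auto
  also have "\<dots> = N powr (-6)"
    using N J by (simp add: q_def powr_divide powr_powr powr_minus_divide)
  also have "\<dots> \<le> a J" by (rule aJ)
  also have "\<dots> \<le> a (2 * n + 1)" using n by (intro anti) auto
  finally show False by simp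
qed

section \<open>The affine group of a field\<close>

text \<open>Affine maps are the identity outside the carrier, which makes them elements of one group for
  all fields on the same type.\<close>

definition aff :: "('a, 'm) ring_scheme \<Rightarrow> 'a \<Rightarrow> 'a \<Rightarrow> 'a bijection" where
  "aff F a b = Bij (\<lambda>x. if x \<in> carrier F then a \<otimes>\<^bsub>F\<^esub> x \<oplus>\<^bsub>F\<^esub> b else x)"

definition affs :: "('a, 'm) ring_scheme \<Rightarrow> 'a bijection set" where
  "affs F = {aff F a b | a b. a \<in> carrier F - {\<zero>\<^bsub>F\<^esub>} \<and> b \<in> carrier F}"

definition slope :: "('a, 'm) ring_scheme \<Rightarrow> 'a bijection \<Rightarrow> 'a" where
  "slope F g = app g \<one>\<^bsub>F\<^esub> \<ominus>\<^bsub>F\<^esub> app g \<zero>\<^bsub>F\<^esub>"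

text \<open>Translations are recorded by their displacements, so that they can be added and
  multiplied in the field.\<close>

definition shifts :: "('a, 'm) ring_scheme \<Rightarrow> 'a bijection set \<Rightarrow> 'a set" where
  "shifts F P = {t \<in> carrier F. aff F \<one>\<^bsub>F\<^esub> t \<in> P}"

context field
begin

lemma nonzero_inv:
  assumes "a \<in> carrier R - {\<zero>}"
  shows "inv a \<in> carrier R - {\<zero>}" "inv a \<otimes> a = \<one>" "a \<otimes> inv a = \<one>"
proof -
  have u: "a \<in> Units R" using assms by (simp add: field_Units)
  then show "inv a \<otimes> a = \<one>" "a \<otimes> inv a = \<one>" by simp_all
  show "inv a \<in> carrier R - {\<zero>}" using u Units_inv_Units[of a] field_Units by blast
qed

lemma nonzero_mult:
  assumes "a \<in> carrier R - {\<zero>}" "b \<in> carrier R - {\<zero>}"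
  shows "a \<otimes> b \<in> carrier R - {\<zero>}"
  using assms by (auto simp: integral_iff)

lemma one_nonzero: "\<one> \<in> carrier R - {\<zero>}"
  by simp

text \<open>\<open>Bij\<close> is meaningful for bijections only; the inverse exhibited here
  justifies \<open>aff\<close>, and all later facts about \<open>aff\<close> rest on this
  evaluation.\<close>

lemma app_aff:
  assumes a: "a \<in> carrier R - {\<zero>}" and b: "b \<in> carrier R"
  shows "app (aff R a b) x = (if x \<in> carrier R then a \<otimes> x \<oplus> b else x)"
proof -
  let ?f = "\<lambda>x. if x \<in> carrier R then a \<otimes> x \<oplus> b else x"
  let ?g = "\<lambda>x. if x \<in> carrier R then inv a \<otimes> (x \<ominus> b) else x"
  note i = nonzero_inv[OF a]
  have i': "inv a \<in> carrier R" "a \<in> carrier R" using i a by auto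
  have "?g (?f x) = x" for x
  proof (cases "x \<in> carrier R")
    case True
    then have "(a \<otimes> x \<oplus> b) \<ominus> b = a \<otimes> x" using i' b by algebra
    then show ?thesis using True i' i b by (simp add: m_assoc[symmetric])
  qed simp
  moreover have "?f (?g x) = x" for x
  proof (cases "x \<in> carrier R")
    case True
    then have "a \<otimes> (inv a \<otimes> (x \<ominus> b)) = x \<ominus> b" using i' i b by (simp add: m_assoc[symmetric])
    moreover have "x \<ominus> b \<oplus> b = x" using True b by algebra
    ultimately show ?thesis using True i' b by simp
  qed simp
  ultimately have "bij ?f"
    by (intro o_bij[of ?g]) (auto simp: fun_eq_iff simp del: if_split)
  then show ?thesis by (simp add: aff_def Bij_inverse)
qed

lemma aff_plus:
  assumes "a \<in> carrier R - {\<zero>}" "b \<in> carrier R" "c \<in> carrier R - {\<zero>}" "d \<in> carrier R"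
  shows "aff R a b + aff R c d = aff R (a \<otimes> c) (a \<otimes> d \<oplus> b)"
proof (rule bijection_eqI)
  fix x
  note ac = nonzero_mult[OF assms(1,3)]
  have "a \<in> carrier R" "c \<in> carrier R" using assms by auto
  then have "a \<otimes> (c \<otimes> x \<oplus> d) \<oplus> b = a \<otimes> c \<otimes> x \<oplus> (a \<otimes> d \<oplus> b)" if "x \<in> carrier R"
    using assms(2,4) that by algebra
  then show "app (aff R a b + aff R c d) x = app (aff R (a \<otimes> c) (a \<otimes> d \<oplus> b)) x"
    using assms ac by (simp add: app_plus app_aff)
qed

lemma aff_one_zero: "aff R \<one> \<zero> = 0"
  by (rule bijection_eqI) (simp add: app_aff one_nonzero app_zero)

lemma aff_minus:
  assumes "a \<in> carrier R - {\<zero>}" "b \<in> carrier R"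
  shows "- aff R a b = aff R (inv a) (\<ominus> (inv a \<otimes> b))"
proof -
  note i = nonzero_inv[OF assms(1)]
  have "aff R (inv a) (\<ominus> (inv a \<otimes> b)) + aff R a b = 0"
    using assms i by (subst aff_plus) (auto simp: r_neg aff_one_zero)
  then show ?thesis by (rule eq_neg_iff_add_eq_0[THEN iffD2, symmetric])
qed

lemma aff_in_affs: "a \<in> carrier R - {\<zero>} \<Longrightarrow> b \<in> carrier R \<Longrightarrow> aff R a b \<in> affs R"
  by (auto simp: affs_def)

lemma affsE:
  assumes "g \<in> affs R"
  obtains a b where "a \<in> carrier R - {\<zero>}" "b \<in> carrier R" "g = aff R a b"
  using assms by (auto simp: affs_def)

lemma affs_plus: "g \<in> affs R \<Longrightarrow> h \<in> affs R \<Longrightarrow> g + h \<in> affs R"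
  using nonzero_mult by (elim affsE) (auto simp: aff_plus intro!: aff_in_affs)

lemma affs_minus: "g \<in> affs R \<Longrightarrow> - g \<in> affs R"
  using nonzero_inv by (elim affsE) (auto simp: aff_minus intro!: aff_in_affs)

lemma affs_diff: "g \<in> affs R \<Longrightarrow> h \<in> affs R \<Longrightarrow> g - h \<in> affs R"
  by (metis affs_minus affs_plus diff_conv_add_uminus)

lemma affs_zero: "0 \<in> affs R"
  using aff_in_affs[OF one_nonzero zero_closed] by (simp add: aff_one_zero)

lemma app_aff_0: "a \<in> carrier R - {\<zero>} \<Longrightarrow> b \<in> carrier R \<Longrightarrow> app (aff R a b) \<zero> = b"
  by (simp add: app_aff)

lemma slope_aff: "a \<in> carrier R - {\<zero>} \<Longrightarrow> b \<in> carrier R \<Longrightarrow> slope R (aff R a b) = a"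
proof -
  assume a: "a \<in> carrier R - {\<zero>}" "b \<in> carrier R"
  then have "a \<in> carrier R" "b \<in> carrier R" by auto
  then have "a \<oplus> b \<ominus> b = a" by algebra
  then show "slope R (aff R a b) = a" using a by (simp add: slope_def app_aff)
qed

lemma affs_eq:
  assumes "g \<in> affs R"
  shows "g = aff R (slope R g) (app g \<zero>)" "slope R g \<in> carrier R - {\<zero>}" "app g \<zero> \<in> carrier R"
  using assms by - (erule affsE, simp add: slope_aff app_aff_0)+

lemma affs_app_closed: "g \<in> affs R \<Longrightarrow> x \<in> carrier R \<Longrightarrow> app g x \<in> carrier R"
  by (erule affsE) (simp add: app_aff)

lemma slope_plus: "g \<in> affs R \<Longrightarrow> h \<in> affs R \<Longrightarrow> slope R (g + h) = slope R g \<otimes> slope R h"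
  by (elim affsE) (use nonzero_mult in \<open>auto simp: aff_plus slope_aff\<close>)

lemma slope_minus: "g \<in> affs R \<Longrightarrow> slope R (- g) = inv (slope R g)"
  by (elim affsE) (use nonzero_inv in \<open>auto simp: aff_minus slope_aff\<close>)

lemma affs_determined:
  assumes g: "g \<in> affs R" and h: "h \<in> affs R" and xy: "x \<in> carrier R" "y \<in> carrier R" "x \<noteq> y"
    and eq: "app g x = app h x" "app g y = app h y"
  shows "g = h"
proof -
  obtain a b where ab: "a \<in> carrier R - {\<zero>}" "b \<in> carrier R" "g = aff R a b" using g by (rule affsE)
  obtain c d where cd: "c \<in> carrier R - {\<zero>}" "d \<in> carrier R" "h = aff R c d" using h by (rule affsE)
  have car: "a \<in> carrier R" "c \<in> carrier R" using ab cd by auto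
  have e: "a \<otimes> x \<oplus> b = c \<otimes> x \<oplus> d" "a \<otimes> y \<oplus> b = c \<otimes> y \<oplus> d"
    using eq ab cd xy by (auto simp: app_aff)
  have "(a \<ominus> c) \<otimes> (x \<ominus> y) = (a \<otimes> x \<oplus> b) \<ominus> (a \<otimes> y \<oplus> b) \<ominus> ((c \<otimes> x \<oplus> d) \<ominus> (c \<otimes> y \<oplus> d))"
    using car ab(2) cd(2) xy by algebra
  also have "\<dots> = \<zero>" unfolding e using car cd(2) xy by algebra
  finally have "a \<ominus> c = \<zero> \<or> x \<ominus> y = \<zero>" using car xy by (simp add: integral_iff)
  moreover have "x \<ominus> y \<noteq> \<zero>" using xy by simp
  ultimately have "a = c" using car by simp
  moreover have "b = d" using e(1) car ab(2) cd(2) xy unfolding \<open>a = c\<close> by simp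
  ultimately show ?thesis using ab cd by simp
qed

text \<open>Conjugation turns slopes into multipliers of displacements. This is how multiplication
  in the field is realised by words in \<open>H\<close>, at the price of two letters.\<close>

lemma aff_conj:
  assumes h: "h \<in> affs R" and t: "t \<in> carrier R"
  shows "h + aff R \<one> t - h = aff R \<one> (slope R h \<otimes> t)"
proof -
  obtain a b where ab: "a \<in> carrier R - {\<zero>}" "b \<in> carrier R" "h = aff R a b" using h by (rule affsE)
  have "h + aff R \<one> t = aff R \<one> (slope R h \<otimes> t) + h"
    using ab t one_nonzero by (auto simp: aff_plus slope_aff a_comm)
  then show ?thesis by (metis add_diff_cancel)
qed

end

section \<open>Slopes and translations of words in affine maps\<close>

lemma nsum_add: "x \<in> nsum H m \<Longrightarrow> y \<in> nsum H n \<Longrightarrow> x + y \<in> nsum H (m + n)"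
  by (induction m arbitrary: x) (auto simp: sumset_def add.assoc, fastforce)

lemma nsum_one: "nsum H (Suc 0) = H"
  by (force simp: sumset_def image_iff)

lemma nsum_two: "x \<in> H \<Longrightarrow> y \<in> H \<Longrightarrow> x + y \<in> nsum H 2"
  using nsum_add[of x H "Suc 0" y "Suc 0"] by (simp only: nsum_one numeral_2_eq_2 add_Suc add_0)

lemma nsum_uminus:
  assumes "\<forall>h\<in>H. - h \<in> H"
  shows "x \<in> nsum H n \<Longrightarrow> - x \<in> nsum H n"
proof (induction n arbitrary: x)
  case (Suc n)
  then obtain h y where "x = h + y" "h \<in> H" "y \<in> nsum H n" by (auto simp: sumset_def)
  moreover from this have "- y \<in> nsum H n" "- h \<in> nsum H (Suc 0)"
    using Suc.IH assms by (simp, simp only: nsum_one)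
  ultimately show ?case using nsum_add[of "- y" H n "- h" "Suc 0"] by (simp only: minus_add) simp
qed simp

lemma nsum_mono:
  assumes "0 \<in> H" "m \<le> n"
  shows "nsum H m \<subseteq> nsum H n"
  using assms(2)
proof (induction n rule: dec_induct)
  case (step n)
  have "nsum H n \<subseteq> nsum H (Suc n)" using assms(1) sumsetI[of 0 H] by auto
  then show ?case using step by blast
qed simp

context field
begin

lemma shifts_add:
  assumes "t \<in> shifts R (nsum H m)" "s \<in> shifts R (nsum H n)"
  shows "t \<oplus> s \<in> shifts R (nsum H (m + n))"
  using assms nsum_add[of "aff R \<one> t" H m "aff R \<one> s" n]
  by (simp add: shifts_def aff_plus one_nonzero a_comm)

lemma shifts_minus:
  assumes "\<forall>h\<in>H. - h \<in> H" "t \<in> shifts R (nsum H m)"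
  shows "\<ominus> t \<in> shifts R (nsum H m)"
  using assms nsum_uminus[of H "aff R \<one> t" m]
  by (simp add: shifts_def aff_minus one_nonzero)

lemma shifts_mult:
  assumes "\<forall>h\<in>H. - h \<in> H" "H \<subseteq> affs R" "a \<in> slope R ` H" "t \<in> shifts R (nsum H m)"
  shows "a \<otimes> t \<in> shifts R (nsum H (m + 2))"
proof -
  obtain h where h: "h \<in> H" "a = slope R h" using assms by auto
  have t: "t \<in> carrier R" "aff R \<one> t \<in> nsum H m" using assms by (auto simp: shifts_def)
  have "h \<in> nsum H (Suc 0)" "- h \<in> nsum H (Suc 0)" using h assms by (simp_all only: nsum_one)
  then have "h + aff R \<one> t + - h \<in> nsum H (Suc 0 + m + Suc 0)" using t by (intro nsum_add)
  then have "aff R \<one> (a \<otimes> t) \<in> nsum H (m + 2)"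
    using aff_conj[of h t] h t assms by auto
  then show ?thesis using affs_eq(2)[of h] h assms t by (auto simp: shifts_def)
qed

lemma finite_shifts:
  assumes "finite P" shows "finite (shifts R P)"
proof -
  have "inj_on (\<lambda>t. aff R \<one> t) (shifts R P)"
  proof (rule inj_onI)
    fix t s assume ts: "t \<in> shifts R P" "s \<in> shifts R P" and "aff R \<one> t = aff R \<one> s"
    then have "app (aff R \<one> t) \<zero> = app (aff R \<one> s) \<zero>" by simp
    then show "t = s" using ts by (simp add: shifts_def app_aff_0)
  qed
  moreover have "(\<lambda>t. aff R \<one> t) ` shifts R P \<subseteq> P" by (auto simp: shifts_def)
  ultimately show ?thesis by (rule inj_on_finite[OF _ _ assms])
qed

text \<open>One representative of each slope, followed by the translations, gives distinct maps: the
  slope identifies the representative, and cancelling it identifies the translation.\<close>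

lemma card_slopes_shifts_le:
  assumes H: "finite H" "H \<subseteq> affs R"
  shows "card (slope R ` H) * card (shifts R (nsum H n)) \<le> card (nsum H (Suc n))"
proof -
  let ?T = "shifts R (nsum H n)"
  define h where "h = inv_into H (slope R)"
  have h: "h a \<in> H" "slope R (h a) = a" if "a \<in> slope R ` H" for a
    using that by (auto simp: h_def inv_into_into f_inv_into_f)
  have "card (slope R ` H \<times> ?T) \<le> card (nsum H (Suc n))"
  proof (rule card_inj_on_le[of "\<lambda>(a, t). h a + aff R \<one> t"])
    show "inj_on (\<lambda>(a, t). h a + aff R \<one> t) (slope R ` H \<times> ?T)"
    proof (rule inj_onI, clarsimp)
      fix g t g' t' assume g: "g \<in> H" "g' \<in> H" and t: "t \<in> ?T" "t' \<in> ?T"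
        and eq: "h (slope R g) + aff R \<one> t = h (slope R g') + aff R \<one> t'"
      let ?k = "h (slope R g)" and ?k' = "h (slope R g')"
      have k: "?k \<in> affs R" "?k' \<in> affs R" using h g H by auto
      have t': "t \<in> carrier R" "t' \<in> carrier R" using t by (auto simp: shifts_def)
      have tt: "aff R \<one> t \<in> affs R" "aff R \<one> t' \<in> affs R"
        using t' by (auto intro!: aff_in_affs)
      have sl: "slope R (k + aff R \<one> s) = slope R k" if "s \<in> carrier R" "k \<in> affs R" for s k
        using that affs_eq(2)[of k] by (simp add: slope_plus aff_in_affs one_nonzero slope_aff)
      have "slope R ?k = slope R ?k'" using sl[OF t'(1) k(1)] sl[OF t'(2) k(2)] eq by simp
      then have s: "slope R g = slope R g'" using h g by simp
      then have "aff R \<one> t = aff R \<one> t'" using eq by simp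
      then have "t = t'" using t' by (metis app_aff_0 one_nonzero)
      then show "slope R g = slope R g' \<and> t = t'" using s by simp
    qed
    show "(\<lambda>(a, t). h a + aff R \<one> t) ` (slope R ` H \<times> ?T) \<subseteq> nsum H (Suc n)"
      using h by (auto simp: shifts_def intro!: sumsetI)
    show "finite (nsum H (Suc n))" using H by simp
  qed
  then show ?thesis by (simp add: card_cartesian_product)
qed

text \<open>Two maps of equal slope differ by a translation that is a word of length 2. Together
  with the previous lemma, the size of \<open>H\<close> is governed by the number of slopes times
  the number of translations.\<close>

lemma card_le_slopes_shifts:
  assumes H: "finite H" "H \<subseteq> affs R" "\<forall>h\<in>H. - h \<in> H"
  shows "real (card H) \<le> real (card (slope R ` H)) * real (card (shifts R (nsum H 2)))"
proof (rule card_le_fibres[OF H(1)])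
  fix a assume "a \<in> slope R ` H"
  then obtain h where h: "h \<in> H" "a = slope R h" by auto
  have hA: "h \<in> affs R" using h H by auto
  have "card {q \<in> H. slope R q = a} \<le> card (shifts R (nsum H 2))"
  proof (rule card_inj_on_le[of "\<lambda>q. app (- h + q) \<zero>"])
    have eq: "- h + q = aff R \<one> (app (- h + q) \<zero>)" "app (- h + q) \<zero> \<in> carrier R"
      if "q \<in> H" "slope R q = a" for q
    proof -
      have q: "q \<in> affs R" using that H by auto
      then have "- h + q \<in> affs R" using hA by (intro affs_plus affs_minus)
      moreover have "slope R (- h + q) = \<one>"
        using that h q hA affs_minus[OF hA] nonzero_inv[OF affs_eq(2)[OF hA]]
        by (simp add: slope_plus slope_minus)
      ultimately show "- h + q = aff R \<one> (app (- h + q) \<zero>)" "app (- h + q) \<zero> \<in> carrier R"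
        using affs_eq[of "- h + q"] by auto
    qed
    show "inj_on (\<lambda>q. app (- h + q) \<zero>) {q \<in> H. slope R q = a}"
    proof (rule inj_onI)
      fix p q assume p: "p \<in> {q \<in> H. slope R q = a}" and q: "q \<in> {q \<in> H. slope R q = a}"
        and "app (- h + p) \<zero> = app (- h + q) \<zero>"
      then have "- h + p = - h + q" using eq[of p] eq[of q] by simp
      then show "p = q" by simp
    qed
    have "- h + q \<in> nsum H 2" if "q \<in> H" for q
      using that h H by (intro nsum_two) auto
    then show "(\<lambda>q. app (- h + q) \<zero>) ` {q \<in> H. slope R q = a} \<subseteq> shifts R (nsum H 2)"
      using eq by (auto simp: shifts_def)
    show "finite (shifts R (nsum H 2))" using H by (intro finite_shifts) simp
  qed
  then show "real (card {q \<in> H. slope R q = a}) \<le> real (card (shifts R (nsum H 2)))" by simp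
qed

text \<open>A map of slope \<open>a \<noteq> \<one>\<close> has exactly one fixed point, and every
  map commuting with it must preserve that point.\<close>

lemma commuting_affs:
  assumes H: "H \<subseteq> affs R" and com: "\<And>g h. g \<in> H \<Longrightarrow> h \<in> H \<Longrightarrow> g + h = h + g"
  shows "slope R ` H \<subseteq> {\<one>} \<or> (\<exists>x\<in>carrier R. \<forall>h\<in>H. app h x = x)"
proof (cases "slope R ` H \<subseteq> {\<one>}")
  case False
  then obtain h where h: "h \<in> H" "slope R h \<noteq> \<one>" by auto
  then obtain a b where ab: "a \<in> carrier R - {\<zero>}" "b \<in> carrier R" "h = aff R a b"
    using H by (meson affsE subsetD)
  have a: "a \<in> carrier R" "a \<noteq> \<one>" using ab h by (auto simp: slope_aff)
  have n: "\<one> \<ominus> a \<in> carrier R - {\<zero>}" using a by simp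
  define x where "x = inv (\<one> \<ominus> a) \<otimes> b"
  have x: "x \<in> carrier R" using nonzero_inv[OF n] ab by (simp add: x_def)
  have "(\<one> \<ominus> a) \<otimes> x = b" using nonzero_inv[OF n] n ab by (simp add: x_def m_assoc[symmetric])
  then have "a \<otimes> x \<oplus> (\<one> \<ominus> a) \<otimes> x = a \<otimes> x \<oplus> b" by simp
  moreover have "a \<otimes> x \<oplus> (\<one> \<ominus> a) \<otimes> x = x" using a x by algebra
  ultimately have fx: "app h x = x" using ab x by (simp add: app_aff)
  have "app g x = x" if g: "g \<in> H" for g
  proof (rule ccontr)
    assume ne: "app g x \<noteq> x"
    have "app h (app g x) = app g x" using com[OF g h(1)] fx by (metis app_plus)
    then have "h = 0"
    proof (intro affs_determined[of h 0 "app g x" x])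
      show "app g x \<in> carrier R" using g H x by (intro affs_app_closed) auto
    qed (use h H fx ne x affs_zero in \<open>auto simp: app_zero\<close>)
    then show False using h by (metis aff_one_zero one_nonzero slope_aff zero_closed)
  qed
  then show ?thesis using x by auto
qed simp

text \<open>The commutator is a word of four letters. Its slope is 1, since slopes multiply in a
  commutative group, and it is not the identity.\<close>

lemma noncommuting_translation:
  assumes H: "H \<subseteq> affs R" "\<forall>h\<in>H. - h \<in> H" and gh: "g \<in> H" "h \<in> H" "g + h \<noteq> h + g"
  shows "\<exists>t\<in>shifts R (nsum H 4). t \<noteq> \<zero>"
proof -
  have A: "g \<in> affs R" "h \<in> affs R" using gh H by auto
  define k where "k = (g + h) + (- g + - h)"
  have k: "k \<in> affs R" unfolding k_def by (intro affs_plus affs_minus A)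
  have kH: "k \<in> nsum H (Suc 0 + Suc 0 + (Suc 0 + Suc 0))"
    unfolding k_def using gh H by (intro nsum_add) (simp_all only: nsum_one)
  have s: "slope R k = \<one>"
  proof -
    let ?a = "slope R g" and ?b = "slope R h"
    note a = affs_eq(2)[OF A(1)] and b = affs_eq(2)[OF A(2)]
    note ia = nonzero_inv[OF a] and ib = nonzero_inv[OF b]
    have "slope R k = ?a \<otimes> ?b \<otimes> (inv ?a \<otimes> inv ?b)"
      using A by (simp add: k_def slope_plus slope_minus affs_plus affs_minus del: add_uminus_conv_diff)
    also have "\<dots> = (?a \<otimes> inv ?a) \<otimes> (?b \<otimes> inv ?b)"
      using a b ia(1) ib(1) by (simp add: m_ac)
    also have "\<dots> = \<one>" using ia ib by simp
    finally show ?thesis .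
  qed
  have "k \<noteq> 0"
  proof
    assume "k = 0"
    then have "(g + h) + - (h + g) = 0" by (simp only: k_def group_add_class.minus_add)
    then have "g + h = - (- (h + g))" by (simp only: eq_neg_iff_add_eq_0)
    then show False using gh by simp
  qed
  then have "app k \<zero> \<noteq> \<zero>" using affs_eq(1)[OF k] s aff_one_zero by auto
  moreover have "app k \<zero> \<in> shifts R (nsum H 4)"
    using affs_eq[OF k] s kH by (simp add: shifts_def numeral_eq_Suc)
  ultimately show ?thesis by blast
qed

end

section \<open>The pivot argument\<close>

lemma card_square_le_collisions:
  assumes "finite P"
  shows "real (card P) ^ 2 \<le> real (card (f ` P)) * real (card {(p, q) \<in> P \<times> P. f p = f q})"
proof -
  let ?n = "\<lambda>y. {p \<in> P. f p = y}"
  have "P = (\<Union>y\<in>f ` P. ?n y)" by auto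
  then have "real (card P) = real (card (\<Union>y\<in>f ` P. ?n y))" by simp
  also have "\<dots> = (\<Sum>y\<in>f ` P. real (card (?n y)))"
    using assms by (subst card_UN_disjoint) auto
  finally have "real (card P) ^ 2 \<le> real (card (f ` P)) * (\<Sum>y\<in>f ` P. (real (card (?n y)))\<^sup>2)"
    using sum_square_le_card_sum[of "\<lambda>y. real (card (?n y))" "f ` P"] by simp
  also have "(\<Sum>y\<in>f ` P. (real (card (?n y)))\<^sup>2) = (\<Sum>y\<in>f ` P. real (card (?n y \<times> ?n y)))"
    by (simp add: card_cartesian_product power2_eq_square)
  also have "\<dots> = real (card (\<Union>y\<in>f ` P. ?n y \<times> ?n y))"
    using assms by (subst card_UN_disjoint) auto
  also have "(\<Union>y\<in>f ` P. ?n y \<times> ?n y) = {(p, q) \<in> P \<times> P. f p = f q}" by auto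
  finally show ?thesis .
qed

text \<open>This is all that is needed about the field; it holds for prime fields and in
  characteristic zero.\<close>

definition no_invariant_finite_sets :: "('a, 'm) ring_scheme \<Rightarrow> bool" where
  "no_invariant_finite_sets F \<longleftrightarrow> (\<forall>D \<tau>. finite D \<and> D \<noteq> {} \<and> D \<subseteq> carrier F \<and>
     \<tau> \<in> carrier F - {\<zero>\<^bsub>F\<^esub>} \<and> (\<forall>d\<in>D. d \<oplus>\<^bsub>F\<^esub> \<tau> \<in> D) \<longrightarrow> D = carrier F)"

context field
begin

text \<open>The random choice of \<open>\<xi>\<close>: two distinct pairs collide for at most one value of \<open>\<xi>\<close>.\<close>

lemma exists_expanding_dilate:
  assumes F: "finite (carrier R)" and T: "T \<subseteq> carrier R" and A: "A \<subseteq> carrier R"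
    and ne: "T \<noteq> {}" "A \<noteq> {}"
  shows "\<exists>\<xi>\<in>carrier R. min (real (card A) * real (card T)) (real (card (carrier R)))
    \<le> 2 * real (card ((\<lambda>(s, b). s \<oplus> b \<otimes> \<xi>) ` (T \<times> A)))"
proof -
  define P where "P = T \<times> A"
  define p where "p = real (card (carrier R))"
  define n where "n = real (card P)"
  define f where "f \<xi> = (\<lambda>(s, b). s \<oplus> b \<otimes> \<xi>)" for \<xi>
  define C where "C \<xi> = {(x, y) \<in> P \<times> P. f \<xi> x = f \<xi> y}" for \<xi>
  have fin: "finite T" "finite A" using T A F by (auto intro: finite_subset)
  then have P: "finite P" "P \<noteq> {}" using ne by (auto simp: P_def)
  have n: "n > 0" using P by (simp add: n_def card_gt_0_iff)
  have p: "p > 0" using F by (auto simp: p_def card_gt_0_iff)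
  have finC: "finite (C \<xi>)" for \<xi>
    unfolding C_def by (rule finite_subset[of _ "P \<times> P"]) (use P in auto)
  have few: "card {\<xi> \<in> carrier R. f \<xi> x = f \<xi> y} \<le> 1" if xy: "x \<in> P" "y \<in> P" "x \<noteq> y" for x y
  proof -
    obtain s b s' b' where eq: "x = (s, b)" "y = (s', b')" by (metis surj_pair)
    have car: "s \<in> carrier R" "s' \<in> carrier R" "b \<in> carrier R" "b' \<in> carrier R"
      using xy T A by (auto simp: eq P_def)
    have "\<xi> = \<eta>" if h: "\<xi> \<in> carrier R" "\<eta> \<in> carrier R" "f \<xi> x = f \<xi> y" "f \<eta> x = f \<eta> y" for \<xi> \<eta>
    proof (rule ccontr)
      assume ne: "\<xi> \<noteq> \<eta>"
      have e: "s \<oplus> b \<otimes> \<xi> = s' \<oplus> b' \<otimes> \<xi>" "s \<oplus> b \<otimes> \<eta> = s' \<oplus> b' \<otimes> \<eta>"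
        using h by (auto simp: f_def eq)
      have "(b \<ominus> b') \<otimes> (\<xi> \<ominus> \<eta>) = (s \<oplus> b \<otimes> \<xi>) \<ominus> (s \<oplus> b \<otimes> \<eta>) \<ominus> ((s' \<oplus> b' \<otimes> \<xi>) \<ominus> (s' \<oplus> b' \<otimes> \<eta>))"
        using car h(1,2) by algebra
      also have "\<dots> = \<zero>" unfolding e using car h(1,2) by algebra
      finally have "b \<ominus> b' = \<zero> \<or> \<xi> \<ominus> \<eta> = \<zero>" using car h by (simp add: integral_iff)
      then have "b = b'" using ne h car by simp
      moreover have "s = s'" using e(1) car h unfolding \<open>b = b'\<close> by simp
      ultimately show False using xy eq by simp
    qed
    then show ?thesis using F by (auto simp: card_le_Suc0_iff_eq)
  qed
  have "(\<Sum>\<xi>\<in>carrier R. card (C \<xi>)) = card (SIGMA \<xi>:carrier R. C \<xi>)"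
    using F finC by simp
  also have "\<dots> = card (SIGMA q:P \<times> P. {\<xi> \<in> carrier R. q \<in> C \<xi>})"
    by (rule bij_betw_same_card[of prod.swap], rule bij_betw_byWitness[where f' = prod.swap])
      (auto simp: C_def)
  also have "\<dots> = (\<Sum>q\<in>P \<times> P. card {\<xi> \<in> carrier R. q \<in> C \<xi>})"
    using P F by simp
  finally have "(\<Sum>\<xi>\<in>carrier R. real (card (C \<xi>))) = (\<Sum>q\<in>P \<times> P. real (card {\<xi> \<in> carrier R. q \<in> C \<xi>}))"
    by (metis (mono_tags, lifting) of_nat_sum sum.cong)
  also have "\<dots> \<le> (\<Sum>q\<in>P \<times> P. 1 + p * of_bool (fst q = snd q))"
  proof (rule sum_mono)
    fix q assume q: "q \<in> P \<times> P"
    obtain x y where xy: "q = (x, y)" by (cases q)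
    show "real (card {\<xi> \<in> carrier R. q \<in> C \<xi>}) \<le> 1 + p * of_bool (fst q = snd q)"
    proof (cases "x = y")
      case True
      have "card {\<xi> \<in> carrier R. q \<in> C \<xi>} \<le> card (carrier R)" using F by (intro card_mono) auto
      then show ?thesis using True by (simp add: xy p_def)
    next
      case False
      have "{\<xi> \<in> carrier R. q \<in> C \<xi>} = {\<xi> \<in> carrier R. f \<xi> x = f \<xi> y}"
        using q by (auto simp: C_def xy)
      then show ?thesis using few[of x y] False q by (simp add: xy)
    qed
  qed
  also have "\<dots> = n\<^sup>2 + p * (\<Sum>q\<in>P \<times> P. of_bool (fst q = snd q))"
    by (simp add: sum.distrib sum_distrib_left n_def power2_eq_square card_cartesian_product)
  also have "(\<Sum>q\<in>P \<times> P. of_bool (fst q = snd q)) = n"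
  proof -
    have "(\<Sum>q\<in>P \<times> P. of_bool (fst q = snd q)) = (\<Sum>q\<in>(\<lambda>x. (x, x)) ` P. 1::real)"
      using P by (intro sum.mono_neutral_cong_right) auto
    also have "\<dots> = n" by (simp add: card_image inj_on_def n_def)
    finally show ?thesis .
  qed
  finally have tot: "(\<Sum>\<xi>\<in>carrier R. real (card (C \<xi>))) \<le> n\<^sup>2 + p * n" .
  obtain \<xi> where \<xi>: "\<xi> \<in> carrier R" "p * real (card (C \<xi>)) \<le> n\<^sup>2 + p * n"
  proof -
    have "\<exists>\<xi>\<in>carrier R. p * real (card (C \<xi>)) \<le> n\<^sup>2 + p * n"
    proof (rule ccontr)
      assume "\<not> ?thesis"
      then have "\<forall>\<xi>\<in>carrier R. n\<^sup>2 + p * n < p * real (card (C \<xi>))" by (simp add: not_le)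
      then have "(\<Sum>\<xi>\<in>carrier R. n\<^sup>2 + p * n) < (\<Sum>\<xi>\<in>carrier R. p * real (card (C \<xi>)))"
        using F by (intro sum_strict_mono) auto
      then have "p * (n\<^sup>2 + p * n) < p * (\<Sum>\<xi>\<in>carrier R. real (card (C \<xi>)))"
        by (simp add: p_def sum_distrib_left)
      then show False using tot p by simp
    qed
    then show ?thesis using that by blast
  qed
  define I where "I = real (card (f \<xi> ` P))"
  have "n\<^sup>2 \<le> I * real (card (C \<xi>))"
    using card_square_le_collisions[OF P(1), of "f \<xi>"] by (simp add: n_def I_def C_def)
  then have "p * n\<^sup>2 \<le> I * (p * real (card (C \<xi>)))" using p by (simp add: mult_left_mono mult.left_commute)
  also have "\<dots> \<le> I * (n\<^sup>2 + p * n)" using \<xi> by (intro mult_left_mono) (auto simp: I_def)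
  finally have "n * (p * n) \<le> n * (I * (n + p))" by (simp add: power2_eq_square algebra_simps)
  then have pn: "p * n \<le> I * (n + p)" using n by simp
  \<comment> \<open>The bound \<open>pn\<close> says that \<open>I\<close> is at least half of the
    harmonic mean of \<open>n\<close> and \<open>p\<close>, which is at least their minimum.\<close>
  have "min n p \<le> 2 * I"
  proof (rule ccontr)
    assume "\<not> ?thesis"
    then have "2 * I < n" "2 * I < p" by auto
    then have "2 * I * n < p * n" "2 * I * p < n * p" using n p by simp_all
    then show False using pn by (simp add: algebra_simps)
  qed
  moreover have "n = real (card A) * real (card T)" by (simp add: n_def P_def card_cartesian_product)
  ultimately show ?thesis using \<xi> unfolding I_def f_def P_def p_def by auto
qed

text \<open>The pivot argument: a quotient \<open>\<xi>\<close> of differences such that \<open>\<xi> \<oplus> \<tau>\<close> is not one, or, if all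
  field elements are such quotients, a random \<open>\<xi>\<close>.\<close>

lemma exists_pivot:
  assumes inv: "no_invariant_finite_sets R"
    and T: "finite T" "T \<subseteq> carrier R" "\<tau> \<in> T" "\<tau> \<noteq> \<zero>" and A: "finite A" "A \<subseteq> carrier R" "card A \<ge> 2"
  shows "\<exists>a\<in>A. \<exists>a'\<in>A. \<exists>t\<in>T. \<exists>t'\<in>T. \<exists>\<xi>\<in>carrier R. \<exists>e\<in>{\<zero>, \<tau>}. a \<noteq> a' \<and>
    (a \<ominus> a') \<otimes> \<xi> = (t \<ominus> t') \<oplus> (a \<ominus> a') \<otimes> e \<and>
    (real (card A) * real (card T) \<le> 2 * real (card ((\<lambda>(s, b). s \<oplus> b \<otimes> \<xi>) ` (T \<times> A))) \<or>
     finite (carrier R) \<and> real (card (carrier R)) \<le> 2 * real (card ((\<lambda>(s, b). s \<oplus> b \<otimes> \<xi>) ` (T \<times> A))))"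
proof -
  \<comment> \<open>The quotients of differences of \<open>T\<close> by differences of
    \<open>A\<close>. For \<xi> outside \<open>D\<close> the map sending \<open>(s, b)\<close> to
    \<open>s \<oplus> b \<otimes> \<xi>\<close> is injective on \<open>T \<times> A\<close>.\<close>
  define D where "D = (\<lambda>((t, t'), (a, a')). inv (a \<ominus> a') \<otimes> (t \<ominus> t')) ` ((T \<times> T) \<times> {(a, a') \<in> A \<times> A. a \<noteq> a'})"
  have \<tau>: "\<tau> \<in> carrier R" using T by auto
  have AA: "finite {(a, a') \<in> A \<times> A. a \<noteq> a'}" by (rule finite_subset[of _ "A \<times> A"]) (use A in auto)
  have nz: "a \<ominus> a' \<in> carrier R - {\<zero>}" if "a \<in> A" "a' \<in> A" "a \<noteq> a'" for a a'
  proof -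
    have "a \<in> carrier R" "a' \<in> carrier R" using that A by auto
    then show ?thesis using that by simp
  qed
  have D: "finite D" "D \<subseteq> carrier R"
    using T A AA nz nonzero_inv(1)[OF nz] by (auto simp: D_def intro!: m_closed)
  have DE: "\<exists>a\<in>A. \<exists>a'\<in>A. \<exists>t\<in>T. \<exists>t'\<in>T. a \<noteq> a' \<and> (a \<ominus> a') \<otimes> \<xi> = t \<ominus> t'" if "\<xi> \<in> D" for \<xi>
  proof -
    from that obtain t t' a a' where h: "t \<in> T" "t' \<in> T" "a \<in> A" "a' \<in> A" "a \<noteq> a'"
      "\<xi> = inv (a \<ominus> a') \<otimes> (t \<ominus> t')" by (auto simp: D_def)
    have "t \<ominus> t' \<in> carrier R" using h T by auto
    then have "(a \<ominus> a') \<otimes> \<xi> = t \<ominus> t'"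
      using nonzero_inv[OF nz[OF h(3-5)]] nz[OF h(3-5)] h(6) by (simp add: m_assoc[symmetric])
    then show ?thesis using h by blast
  qed
  have Dne: "D \<noteq> {}"
  proof -
    have "\<not> card A \<le> Suc 0" using A by simp
    then obtain a a' where "a \<in> A" "a' \<in> A" "a \<noteq> a'" using A by (auto simp: card_le_Suc0_iff_eq)
    then show ?thesis using T(3) unfolding D_def by blast
  qed
  show ?thesis
  proof (cases "\<forall>d\<in>D. d \<oplus> \<tau> \<in> D")
    case True
    then have DR: "D = carrier R" using inv D Dne T(4) \<tau> unfolding no_invariant_finite_sets_def by blast
    then have F: "finite (carrier R)" using D by simp
    have "T \<noteq> {}" "A \<noteq> {}" using T A by auto
    then obtain \<xi> where \<xi>: "\<xi> \<in> carrier R" "min (real (card A) * real (card T)) (real (card (carrier R)))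
        \<le> 2 * real (card ((\<lambda>(s, b). s \<oplus> b \<otimes> \<xi>) ` (T \<times> A)))"
      using exists_expanding_dilate[OF F T(2) A(2)] by blast
    have "\<xi> \<in> D" using \<xi> DR by simp
    from DE[OF this] obtain a a' t t' where h: "a \<in> A" "a' \<in> A" "t \<in> T" "t' \<in> T" "a \<noteq> a'"
      "(a \<ominus> a') \<otimes> \<xi> = t \<ominus> t'" by blast
    have c: "a \<in> carrier R" "a' \<in> carrier R" "t \<in> carrier R" "t' \<in> carrier R" using h T A by auto
    \<comment> \<open>Here \<xi> is itself a quotient, so the correction \<open>e\<close> is zero;
      in the other case it is \<tau>.\<close>
    have "(a \<ominus> a') \<otimes> \<xi> = (t \<ominus> t') \<oplus> (a \<ominus> a') \<otimes> \<zero>" using h c by simp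
    moreover have "real (card A) * real (card T) \<le> 2 * real (card ((\<lambda>(s, b). s \<oplus> b \<otimes> \<xi>) ` (T \<times> A))) \<or>
      finite (carrier R) \<and> real (card (carrier R)) \<le> 2 * real (card ((\<lambda>(s, b). s \<oplus> b \<otimes> \<xi>) ` (T \<times> A)))"
      using \<xi>(2) F by (simp add: min_le_iff_disj)
    ultimately show ?thesis using h \<xi>(1) by blast
  next
    case False
    then obtain d where d: "d \<in> D" "d \<oplus> \<tau> \<notin> D" by blast
    have dc: "d \<in> carrier R" using d D by auto
    define \<xi> where "\<xi> = d \<oplus> \<tau>"
    have \<xi>: "\<xi> \<in> carrier R" using dc \<tau> by (simp add: \<xi>_def)
    from DE[OF d(1)] obtain a a' t t' where h: "a \<in> A" "a' \<in> A" "t \<in> T" "t' \<in> T" "a \<noteq> a'"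
      "(a \<ominus> a') \<otimes> d = t \<ominus> t'" by blast
    have c: "a \<in> carrier R" "a' \<in> carrier R" "t \<in> carrier R" "t' \<in> carrier R" using h T A by auto
    have "(a \<ominus> a') \<otimes> \<xi> = (a \<ominus> a') \<otimes> d \<oplus> (a \<ominus> a') \<otimes> \<tau>"
      using c dc \<tau> by (simp add: \<xi>_def r_distr)
    \<comment> \<open>Although \<xi> is not a quotient, clearing its denominator still gives a
      displacement reachable by short words, because it is only \<tau> away from one.\<close>
    then have e: "(a \<ominus> a') \<otimes> \<xi> = (t \<ominus> t') \<oplus> (a \<ominus> a') \<otimes> \<tau>" using h by simp
    have inj: "inj_on (\<lambda>(s, b). s \<oplus> b \<otimes> \<xi>) (T \<times> A)"
    proof (rule inj_onI, clarify)
      fix s b s' b' assume m: "s \<in> T" "b \<in> A" "s' \<in> T" "b' \<in> A" and eq: "s \<oplus> b \<otimes> \<xi> = s' \<oplus> b' \<otimes> \<xi>"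
      have k: "s \<in> carrier R" "s' \<in> carrier R" "b \<in> carrier R" "b' \<in> carrier R" using m T A by auto
      have "b = b'"
      proof (rule ccontr)
        assume ne: "b \<noteq> b'"
        have "(b \<ominus> b') \<otimes> \<xi> = (s \<oplus> b \<otimes> \<xi>) \<ominus> (s \<oplus> b' \<otimes> \<xi>)" using k \<xi> by algebra
        also have "\<dots> = s' \<ominus> s" unfolding eq using k \<xi> by algebra
        finally have "(b \<ominus> b') \<otimes> \<xi> = s' \<ominus> s" .
        then have "inv (b \<ominus> b') \<otimes> ((b \<ominus> b') \<otimes> \<xi>) = inv (b \<ominus> b') \<otimes> (s' \<ominus> s)" by simp
        then have "\<xi> = inv (b \<ominus> b') \<otimes> (s' \<ominus> s)"
          using nonzero_inv[OF nz[OF m(2,4) ne]] nz[OF m(2,4) ne] \<xi> by (simp add: m_assoc[symmetric])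
        then have "\<xi> \<in> D" using m ne unfolding D_def by (intro image_eqI[of _ _ "((s', s), (b, b'))"]) auto
        then show False using d by (simp add: \<xi>_def)
      qed
      then show "s = s' \<and> b = b'" using eq k \<xi> by simp
    qed
    have "card ((\<lambda>(s, b). s \<oplus> b \<otimes> \<xi>) ` (T \<times> A)) = card T * card A"
      using card_image[OF inj] by (simp add: card_cartesian_product)
    then have "real (card A) * real (card T) \<le> 2 * real (card ((\<lambda>(s, b). s \<oplus> b \<otimes> \<xi>) ` (T \<times> A)))"
      by simp
    then show ?thesis using e h \<xi> by blast
  qed
qed

text \<open>The translations used in the pivot argument are words of length at most 42 in \<open>H\<close>.\<close>

lemma approximate_affine_group:
  assumes inv: "no_invariant_finite_sets R"
    and H: "finite H" "H \<subseteq> affs R" "0 \<in> H" "\<forall>h\<in>H. - h \<in> H"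
    and Q: "Q \<ge> 1" "\<And>n. n \<le> 43 \<Longrightarrow> real (card (nsum H n)) \<le> Q * real (card H)"
  shows "real (card (slope R ` H)) \<le> 2 * Q \<or> (\<exists>x\<in>carrier R. \<forall>h\<in>H. app h x = x) \<or>
    finite (carrier R) \<and> real (card (slope R ` H)) * real (card (carrier R)) \<le> 2 * Q * real (card H)"
proof (cases "\<forall>g\<in>H. \<forall>h\<in>H. g + h = h + g")
  case True
  then consider "slope R ` H \<subseteq> {\<one>}" | "\<exists>x\<in>carrier R. \<forall>h\<in>H. app h x = x"
    using commuting_affs[OF H(2)] by blast
  then show ?thesis
  proof cases
    case 1
    then have "card (slope R ` H) \<le> 1" using card_mono[of "{\<one>}" "slope R ` H"] by simp
    then show ?thesis using Q by simp
  qed simp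
next
  case False
  then obtain g h where "g \<in> H" "h \<in> H" "g + h \<noteq> h + g" by blast
  then obtain \<tau> where \<tau>: "\<tau> \<in> shifts R (nsum H 4)" "\<tau> \<noteq> \<zero>"
    using noncommuting_translation[OF H(2,4)] by blast
  define A where "A = slope R ` H"
  define T where "T n = shifts R (nsum H n)" for n
  have A: "finite A" "A \<subseteq> carrier R" using H affs_eq(2) by (auto simp: A_def)
  have finT: "finite (T n)" for n using H by (simp add: T_def finite_shifts)
  have Tc: "T n \<subseteq> carrier R" for n by (auto simp: T_def shifts_def)
  have mono: "T m \<subseteq> T n" if "m \<le> n" for m n
    using nsum_mono[OF H(3) that] by (auto simp: T_def shifts_def)
  have add: "t \<oplus> s \<in> T (m + n)" if "t \<in> T m" "s \<in> T n" for t s m n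
    using that shifts_add by (auto simp: T_def)
  have sub: "t \<ominus> s \<in> T (m + n)" if "t \<in> T m" "s \<in> T n" for t s m n
    using that add shifts_minus[OF H(4)] by (auto simp: T_def a_minus_def)
  have mul: "a \<otimes> t \<in> T (m + 2)" if "a \<in> A" "t \<in> T m" for a t m
    using that shifts_mult[OF H(4,2)] by (auto simp: T_def A_def)
  show ?thesis
  proof (cases "card A \<ge> 2")
    case False
    then have "real (card A) \<le> 2 * Q" using Q by simp
    then show ?thesis by (simp add: A_def)
  next
    case A2: True
    have \<tau>4: "\<tau> \<in> T 4" using \<tau> by (simp add: T_def)
    obtain a a' t t' \<xi> e where h: "a \<in> A" "a' \<in> A" "t \<in> T 4" "t' \<in> T 4" "\<xi> \<in> carrier R" "e \<in> {\<zero>, \<tau>}" "a \<noteq> a'"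
      and eq: "(a \<ominus> a') \<otimes> \<xi> = (t \<ominus> t') \<oplus> (a \<ominus> a') \<otimes> e"
      and big: "real (card A) * real (card (T 4)) \<le> 2 * real (card ((\<lambda>(s, b). s \<oplus> b \<otimes> \<xi>) ` (T 4 \<times> A))) \<or>
        finite (carrier R) \<and> real (card (carrier R)) \<le> 2 * real (card ((\<lambda>(s, b). s \<oplus> b \<otimes> \<xi>) ` (T 4 \<times> A)))"
      using exists_pivot[OF inv finT Tc \<tau>4 \<tau>(2) A A2] by blast
    let ?I = "(\<lambda>(s, b). s \<oplus> b \<otimes> \<xi>) ` (T 4 \<times> A)"
    have ac: "a \<in> carrier R" "a' \<in> carrier R" using h A by auto
    have "\<tau> \<in> carrier R" using \<tau>4 Tc by blast
    then have "\<zero> = \<tau> \<ominus> \<tau>" by (simp add: a_minus_def r_neg)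
    \<comment> \<open>Zero is obtained as \<tau> minus \<tau>, a word of length 8, so that both
      values of \<open>e\<close> are covered.\<close>
    then have e8: "e \<in> T 8" using h(6) sub[OF \<tau>4 \<tau>4] mono[of 4 8] \<tau>4 by auto
    have ec: "e \<in> carrier R" using e8 Tc by auto
    \<comment> \<open>The pivot with its denominator cleared. The word lengths are 4 + 4 for
      \<open>t \<ominus> t'\<close> and twice 8 + 2 for the products with \<open>e\<close>.\<close>
    define \<zeta> where "\<zeta> = (a \<ominus> a') \<otimes> \<xi>"
    have \<zeta>: "\<zeta> \<in> T 28"
    proof -
      have "(a \<ominus> a') \<otimes> e = a \<otimes> e \<ominus> a' \<otimes> e" using ac ec by algebra
      moreover have "a \<otimes> e \<ominus> a' \<otimes> e \<in> T (8 + 2 + (8 + 2))" using h e8 by (intro sub mul)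
      ultimately have "(t \<ominus> t') \<oplus> (a \<ominus> a') \<otimes> e \<in> T (4 + 4 + (8 + 2 + (8 + 2)))"
        using h by (intro add sub) auto
      then show ?thesis using eq by (simp add: \<zeta>_def)
    qed
    \<comment> \<open>Multiplication by \<open>a \<ominus> a'\<close> is injective and turns the
      expanded set into displacements of words of length 6 + 6 + 30.\<close>
    have "card ?I \<le> card (T 42)"
    proof (rule card_inj_on_le[of "\<lambda>y. (a \<ominus> a') \<otimes> y"])
      have nz: "a \<ominus> a' \<in> carrier R - {\<zero>}" using ac h by simp
      have Ic: "?I \<subseteq> carrier R" using subsetD[OF Tc] subsetD[OF A(2)] h(5) by auto
      show "inj_on (\<lambda>y. (a \<ominus> a') \<otimes> y) ?I"
      proof (rule inj_onI)
        fix y z assume "y \<in> ?I" "z \<in> ?I" and "(a \<ominus> a') \<otimes> y = (a \<ominus> a') \<otimes> z"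
        then show "y = z" using nz Ic m_lcancel[of "a \<ominus> a'" y z] by blast
      qed
      show "(\<lambda>y. (a \<ominus> a') \<otimes> y) ` ?I \<subseteq> T 42"
      proof clarify
        fix s b assume sb: "s \<in> T 4" "b \<in> A"
        have c: "s \<in> carrier R" "b \<in> carrier R" using sb Tc A by auto
        have "(a \<ominus> a') \<otimes> (s \<oplus> b \<otimes> \<xi>) = (a \<otimes> s \<ominus> a' \<otimes> s) \<oplus> b \<otimes> \<zeta>"
          unfolding \<zeta>_def using c ac h(5) by algebra
        also have "\<dots> \<in> T (4 + 2 + (4 + 2) + (28 + 2))" using h sb \<zeta> by (intro add sub mul)
        finally show "(a \<ominus> a') \<otimes> (s \<oplus> b \<otimes> \<xi>) \<in> T 42" by simp
      qed
    qed (rule finT)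
    then have I: "real (card ?I) \<le> real (card (T 42))" by simp
    \<comment> \<open>A representative of the slope adds one letter to the 42, which is why the
      growth of \<open>H\<close> is assumed up to length 43.\<close>
    have up: "real (card A) * real (card (T 42)) \<le> Q * real (card H)"
      using card_slopes_shifts_le[OF H(1,2), of 42] Q(2)[of 43]
      by (simp add: A_def T_def eval_nat_numeral flip: of_nat_mult)
    have "card (T 2) \<le> card (T 4)" using mono[of 2 4] finT by (intro card_mono) auto
    then have "real (card A) * real (card (T 2)) \<le> real (card A) * real (card (T 4))"
      by (intro mult_left_mono) auto
    then have low: "real (card H) \<le> real (card A) * real (card (T 4))"
      using card_le_slopes_shifts[OF H(1,2,4)] by (simp add: A_def T_def)
    from big show ?thesis
    proof
      assume "real (card A) * real (card (T 4)) \<le> 2 * real (card ?I)"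
      then have "real (card A) * (real (card A) * real (card (T 4))) \<le> real (card A) * (2 * real (card (T 42)))"
        using I by (intro mult_left_mono) auto
      also have "\<dots> \<le> 2 * Q * real (card H)" using up by simp
      also have "\<dots> \<le> 2 * Q * (real (card A) * real (card (T 4)))"
        using low Q by (intro mult_left_mono) auto
      finally have "real (card A) * (real (card A) * real (card (T 4))) \<le> 2 * Q * (real (card A) * real (card (T 4)))" .
      moreover have "real (card A) * real (card (T 4)) > 0"
      proof -
        have "card (T 4) > 0" using \<tau>4 finT[of 4] by (auto simp: card_gt_0_iff)
        then show ?thesis using A2 by simp
      qed
      ultimately have "real (card A) \<le> 2 * Q" by (simp only: mult_le_cancel_right_pos)
      then show ?thesis by (simp add: A_def)
    next
      assume p: "finite (carrier R) \<and> real (card (carrier R)) \<le> 2 * real (card ?I)"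
      then have "real (card A) * real (card (carrier R)) \<le> real (card A) * (2 * real (card (T 42)))"
        using I by (intro mult_left_mono) auto
      also have "\<dots> \<le> 2 * Q * real (card H)" using up by simp
      finally show ?thesis using p by (simp add: A_def)
    qed
  qed
qed

text \<open>The second moment of the number of incidences over all \<open>p\<^sup>2\<close> lines, including those of
  slope zero.\<close>

lemma card_rich_affs_le:
  assumes F: "finite (carrier R)" and Y: "Y \<subseteq> carrier R" and M: "finite M" "M \<subseteq> affs R"
    and k: "\<And>g. g \<in> M \<Longrightarrow> k \<le> real (hits Y g)"
      "2 * real (card Y) ^ 2 \<le> k * real (card (carrier R))"
  shows "real (card M) * k ^ 2 \<le> 4 * real (card (carrier R)) * real (card Y) ^ 2"
proof -
  define C where "C = carrier R \<times> carrier R"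
  define p where "p = real (card (carrier R))"
  define N where "N = real (card Y)"
  define I where "I = (\<lambda>(a, b). \<Sum>y\<in>Y. of_bool (a \<otimes> y \<oplus> b \<in> Y) :: real)"
  \<comment> \<open>The mean of \<open>I\<close> over all pairs in \<open>C\<close>: the total is
    \<open>p * N\<^sup>2\<close>, and there are p^2 pairs.\<close>
  define c where "c = N\<^sup>2 / p"
  have finY: "finite Y" using F Y finite_subset by blast
  have C: "finite C" using F by (simp add: C_def)
  have p: "p > 0" using F by (auto simp: p_def card_gt_0_iff)
  have cC: "real (card C) = p * p" by (simp add: C_def p_def card_cartesian_product)
  have one: "(\<Sum>q\<in>C. of_bool ((\<lambda>(a, b). a \<otimes> y \<oplus> b \<in> Y) q)) = p * N" if y: "y \<in> Y" for y
  proof -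
    have yc: "y \<in> carrier R" using y Y by auto
    have "(\<Sum>q\<in>C. of_bool ((\<lambda>(a, b). a \<otimes> y \<oplus> b \<in> Y) q)) = real (card {q \<in> C. (\<lambda>(a, b). a \<otimes> y \<oplus> b \<in> Y) q})"
      using C by (simp add: Int_def)
    also have "card {q \<in> C. (\<lambda>(a, b). a \<otimes> y \<oplus> b \<in> Y) q} = card (carrier R \<times> Y)"
    proof (rule bij_betw_same_card[of "\<lambda>(a, b). (a, a \<otimes> y \<oplus> b)"],
        rule bij_betw_byWitness[where f' = "\<lambda>(a, z). (a, z \<ominus> a \<otimes> y)"])
      have e1: "a \<otimes> y \<oplus> b \<ominus> a \<otimes> y = b" if "a \<in> carrier R" "b \<in> carrier R" for a b
        using that yc by algebra
      have e2: "a \<otimes> y \<oplus> (z \<ominus> a \<otimes> y) = z" if "a \<in> carrier R" "z \<in> carrier R" for a z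
        using that yc by algebra
      show "\<forall>q\<in>{q \<in> C. (\<lambda>(a, b). a \<otimes> y \<oplus> b \<in> Y) q}. (\<lambda>(a, z). (a, z \<ominus> a \<otimes> y)) ((\<lambda>(a, b). (a, a \<otimes> y \<oplus> b)) q) = q"
        by (auto simp: C_def e1)
      show "\<forall>q\<in>carrier R \<times> Y. (\<lambda>(a, b). (a, a \<otimes> y \<oplus> b)) ((\<lambda>(a, z). (a, z \<ominus> a \<otimes> y)) q) = q"
        using Y by (auto simp: e2 subsetD)
      show "(\<lambda>(a, b). (a, a \<otimes> y \<oplus> b)) ` {q \<in> C. (\<lambda>(a, b). a \<otimes> y \<oplus> b \<in> Y) q} \<subseteq> carrier R \<times> Y"
        by (auto simp: C_def)
      show "(\<lambda>(a, z). (a, z \<ominus> a \<otimes> y)) ` (carrier R \<times> Y) \<subseteq> {q \<in> C. (\<lambda>(a, b). a \<otimes> y \<oplus> b \<in> Y) q}"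
        using Y yc by (auto simp: C_def e2 subsetD)
    qed
    also have "real (card (carrier R \<times> Y)) = p * N" by (simp add: card_cartesian_product p_def N_def)
    finally show ?thesis .
  qed
  have two: "(\<Sum>q\<in>C. of_bool ((\<lambda>(a, b). a \<otimes> y \<oplus> b \<in> Y \<and> a \<otimes> z \<oplus> b \<in> Y) q)) \<le> N\<^sup>2"
    if yz: "y \<in> Y" "z \<in> Y" "y \<noteq> z" for y z
  proof -
    have c: "y \<in> carrier R" "z \<in> carrier R" using yz Y by auto
    have "(\<Sum>q\<in>C. of_bool ((\<lambda>(a, b). a \<otimes> y \<oplus> b \<in> Y \<and> a \<otimes> z \<oplus> b \<in> Y) q))
        = real (card {q \<in> C. (\<lambda>(a, b). a \<otimes> y \<oplus> b \<in> Y \<and> a \<otimes> z \<oplus> b \<in> Y) q})"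
      using C by (simp add: Int_def)
    also have "card {q \<in> C. (\<lambda>(a, b). a \<otimes> y \<oplus> b \<in> Y \<and> a \<otimes> z \<oplus> b \<in> Y) q} \<le> card (Y \<times> Y)"
    proof (rule card_inj_on_le[of "\<lambda>(a, b). (a \<otimes> y \<oplus> b, a \<otimes> z \<oplus> b)"])
      show "inj_on (\<lambda>(a, b). (a \<otimes> y \<oplus> b, a \<otimes> z \<oplus> b)) {q \<in> C. (\<lambda>(a, b). a \<otimes> y \<oplus> b \<in> Y \<and> a \<otimes> z \<oplus> b \<in> Y) q}"
      proof (rule inj_onI, clarsimp simp: C_def)
        fix a b a' b' assume q: "a \<in> carrier R" "b \<in> carrier R" "a' \<in> carrier R" "b' \<in> carrier R"
          and e: "a \<otimes> y \<oplus> b = a' \<otimes> y \<oplus> b'" "a \<otimes> z \<oplus> b = a' \<otimes> z \<oplus> b'"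
        have "(a \<ominus> a') \<otimes> (y \<ominus> z) = (a \<otimes> y \<oplus> b) \<ominus> (a \<otimes> z \<oplus> b) \<ominus> ((a' \<otimes> y \<oplus> b') \<ominus> (a' \<otimes> z \<oplus> b'))"
          using q c by algebra
        also have "\<dots> = \<zero>" unfolding e using q c by algebra
        finally have "a \<ominus> a' = \<zero> \<or> y \<ominus> z = \<zero>" using q c by (simp add: integral_iff)
        then have "a = a'" using q c yz by simp
        moreover have "b = b'" using e(1) q c unfolding \<open>a = a'\<close> by simp
        ultimately show "a = a' \<and> b = b'" by simp
      qed
      show "(\<lambda>(a, b). (a \<otimes> y \<oplus> b, a \<otimes> z \<oplus> b)) ` {q \<in> C. (\<lambda>(a, b). a \<otimes> y \<oplus> b \<in> Y \<and> a \<otimes> z \<oplus> b \<in> Y) q} \<subseteq> Y \<times> Y"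
        by auto
    qed (use finY in simp)
    also have "real (card (Y \<times> Y)) = N\<^sup>2" by (simp add: card_cartesian_product N_def power2_eq_square)
    finally show ?thesis by simp
  qed
  have first: "(\<Sum>q\<in>C. I q) = p * N\<^sup>2"
  proof -
    have "(\<Sum>q\<in>C. I q) = (\<Sum>y\<in>Y. \<Sum>q\<in>C. of_bool ((\<lambda>(a, b). a \<otimes> y \<oplus> b \<in> Y) q))"
      unfolding I_def by (subst sum.swap) (auto intro!: sum.cong)
    also have "\<dots> = (\<Sum>y\<in>Y. p * N)" by (intro sum.cong one) auto
    finally show ?thesis by (simp add: N_def power2_eq_square)
  qed
  have second: "(\<Sum>q\<in>C. (I q)\<^sup>2) \<le> p * N\<^sup>2 + N ^ 4"
  proof -
    have "(\<Sum>q\<in>C. (I q)\<^sup>2) = (\<Sum>q\<in>C. \<Sum>y\<in>Y. \<Sum>z\<in>Y. of_bool ((\<lambda>(a, b). a \<otimes> y \<oplus> b \<in> Y \<and> a \<otimes> z \<oplus> b \<in> Y) q))"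
      unfolding I_def power2_eq_square by (auto simp: sum_product intro!: sum.cong)
    also have "\<dots> = (\<Sum>y\<in>Y. \<Sum>z\<in>Y. \<Sum>q\<in>C. of_bool ((\<lambda>(a, b). a \<otimes> y \<oplus> b \<in> Y \<and> a \<otimes> z \<oplus> b \<in> Y) q))"
      by (subst sum.swap, rule sum.cong[OF refl], rule sum.swap)
    also have "\<dots> \<le> (\<Sum>y\<in>Y. \<Sum>z\<in>Y. N\<^sup>2 + p * N * of_bool (z = y))"
    proof (intro sum_mono)
      fix y z assume yz: "y \<in> Y" "z \<in> Y"
      show "(\<Sum>q\<in>C. of_bool ((\<lambda>(a, b). a \<otimes> y \<oplus> b \<in> Y \<and> a \<otimes> z \<oplus> b \<in> Y) q)) \<le> N\<^sup>2 + p * N * of_bool (z = y)"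
        using one[of y] two[of y z] yz by (cases "z = y") auto
    qed
    also have "\<dots> = (\<Sum>y\<in>Y. N * N\<^sup>2 + p * N)"
      using finY by (intro sum.cong) (auto simp: sum.distrib N_def simp flip: sum_distrib_left)
    finally show ?thesis by (simp add: N_def eval_nat_numeral algebra_simps)
  qed
  \<comment> \<open>Centring at the mean cancels the term N^4 and leaves only the contribution of
    coinciding points.\<close>
  have "(\<Sum>q\<in>C. (I q - c)\<^sup>2) = (\<Sum>q\<in>C. (I q)\<^sup>2) - 2 * c * (\<Sum>q\<in>C. I q) + real (card C) * c\<^sup>2"
    by (simp add: power2_diff sum.distrib sum_subtractf sum_distrib_left sum_distrib_right mult_ac)
  also have "\<dots> \<le> p * N\<^sup>2 + N ^ 4 - 2 * c * (p * N\<^sup>2) + p * p * c\<^sup>2"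
    using second first cC by simp
  also have "\<dots> = p * N\<^sup>2"
    using p by (simp add: c_def power2_eq_square eval_nat_numeral)
  finally have var: "(\<Sum>q\<in>C. (I q - c)\<^sup>2) \<le> p * N\<^sup>2" .
  define e where "e g = (slope R g, app g \<zero>)" for g
  have inj: "inj_on e M"
  proof (rule inj_onI)
    fix g h assume "g \<in> M" "h \<in> M" and eq: "e g = e h"
    then have gh: "g \<in> affs R" "h \<in> affs R" using M(2) by auto
    have "g = aff R (slope R g) (app g \<zero>)" by (rule affs_eq(1)[OF gh(1)])
    also have "\<dots> = aff R (slope R h) (app h \<zero>)" using eq by (simp add: e_def)
    also have "\<dots> = h" by (rule affs_eq(1)[OF gh(2), symmetric])
    finally show "g = h" .
  qed
  have eC: "e ` M \<subseteq> C" using M(2) affs_eq(2,3) by (auto simp: e_def C_def)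
  \<comment> \<open>Richness is at least twice the mean, so each map in \<open>M\<close> deviates
    from the mean by at least \<open>k / 2\<close>.\<close>
  have kc: "2 * c \<le> k" using k(2) p by (simp add: c_def N_def p_def field_simps)
  have c0: "c \<ge> 0" using p by (simp add: c_def)
  have "real (card M) * (k / 2)\<^sup>2 = (\<Sum>g\<in>M. (k / 2)\<^sup>2)" by simp
  also have "\<dots> \<le> (\<Sum>g\<in>M. (I (e g) - c)\<^sup>2)"
  proof (rule sum_mono)
    fix g assume g: "g \<in> M"
    then have gA: "g \<in> affs R" using M by auto
    have ap: "app g y = slope R g \<otimes> y \<oplus> app g \<zero>" if "y \<in> Y" for y
      using affs_eq[OF gA] that Y app_aff[of "slope R g" "app g \<zero>" y] by auto
    have "I (e g) = (\<Sum>y\<in>Y. of_bool (app g y \<in> Y))"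
      unfolding I_def e_def by (auto simp: ap intro!: sum.cong)
    then have "I (e g) = real (hits Y g)" using finY by (simp add: hits_def Int_def)
    then have "k / 2 \<le> I (e g) - c" using k(1)[OF g] kc by simp
    then show "(k / 2)\<^sup>2 \<le> (I (e g) - c)\<^sup>2" using kc c0 by (intro power_mono) auto
  qed
  also have "\<dots> = (\<Sum>q\<in>e ` M. (I q - c)\<^sup>2)" using inj by (simp add: sum.reindex)
  also have "\<dots> \<le> (\<Sum>q\<in>C. (I q - c)\<^sup>2)" using eC C by (intro sum_mono2) auto
  also note var
  finally show ?thesis by (simp add: p_def N_def power_divide field_simps)
qed

text \<open>At least half of the mean comes from maps with at least \<open>\<beta> * N / 2\<close>
  hits. The second moment bound allows at most 16 p / \<beta>^2 of them, and each contributes at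
  most \<open>m * N\<close>. So the peak \<open>m\<close> is not much smaller than 1 / p, which
  turns a size bound for \<open>H\<close> in terms of 1 / m into one in terms of
  \<open>p\<close>.\<close>

lemma reciprocal_mass_le:
  assumes F: "finite (carrier R)" and Y: "Y \<subseteq> carrier R" "Y \<noteq> {}"
    and f: "fprob f" "{g. f g \<noteq> 0} \<subseteq> affs R" and m: "\<And>g. f g \<le> m" "m > 0"
    and N: "N = real (card Y)" and \<beta>: "\<beta> > 0" "4 * N \<le> \<beta> * real (card (carrier R))"
    and mean: "\<beta> * N \<le> (\<Sum>g | f g \<noteq> 0. f g * real (hits Y g))"
  shows "1 \<le> 32 * real (card (carrier R)) * m / \<beta> ^ 3"
proof -
  define p where "p = real (card (carrier R))"
  define k where "k = \<beta> * N / 2"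
  define M where "M = {g. f g \<noteq> 0 \<and> k \<le> real (hits Y g)}"
  let ?V = "{g. f g \<noteq> 0}"
  have finY: "finite Y" using F Y finite_subset by blast
  have N0: "N > 0" using finY Y N by (simp add: card_gt_0_iff)
  have k0: "k > 0" using \<beta> N0 by (simp add: k_def)
  have V: "finite ?V" using f fprob_finite by blast
  have M: "finite M" "M \<subseteq> affs R" using V f(2) by (auto simp: M_def)
  have "real (card M) * k ^ 2 \<le> 4 * p * N ^ 2"
    unfolding p_def N
  proof (rule card_rich_affs_le[OF F Y(1) M])
    show "k \<le> real (hits Y g)" if "g \<in> M" for g using that by (simp add: M_def)
    have "N * (4 * N) \<le> N * (\<beta> * real (card (carrier R)))" using \<beta>(2) N0 by (intro mult_left_mono) auto
    then show "2 * (real (card Y))\<^sup>2 \<le> k * real (card (carrier R))"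
      by (simp add: k_def N power2_eq_square algebra_simps)
  qed
  have "\<beta> * N \<le> (\<Sum>g\<in>?V. k * f g + m * N * of_bool (g \<in> M))"
  proof (rule order_trans[OF mean], rule sum_mono)
    fix g assume g: "g \<in> ?V"
    have nn: "0 \<le> f g" by (rule fprob_nonneg[OF f(1)])
    show "f g * real (hits Y g) \<le> k * f g + m * N * of_bool (g \<in> M)"
    proof (cases "g \<in> M")
      case True
      have "real (hits Y g) \<le> N" unfolding hits_def N using finY by (intro of_nat_mono card_mono) auto
      then have "f g * real (hits Y g) \<le> m * N" using m by (intro mult_mono) auto
      then show ?thesis using True nn k0 by (simp add: add_increasing)
    next
      case False
      then have "real (hits Y g) \<le> k" using g by (simp add: M_def)
      then have "f g * real (hits Y g) \<le> f g * k" using nn by (rule mult_left_mono)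
      then show ?thesis using False by (simp add: mult.commute)
    qed
  qed
  also have "\<dots> = k * (\<Sum>g\<in>?V. f g) + m * N * (\<Sum>g\<in>?V. of_bool (g \<in> M))"
    by (simp add: sum.distrib sum_distrib_left)
  also have "(\<Sum>g\<in>?V. of_bool (g \<in> M)) = real (card M)"
  proof -
    have "(\<Sum>g\<in>?V. of_bool (g \<in> M)) = (\<Sum>g\<in>M. 1::real)"
      using V by (intro sum.mono_neutral_cong_right) (auto simp: M_def)
    then show ?thesis by simp
  qed
  also have "(\<Sum>g\<in>?V. f g) = 1" using f(1) by (rule fprob_sum)
  finally have "k \<le> m * N * real (card M)" by (simp add: k_def)
  then have "k * k\<^sup>2 \<le> m * N * real (card M) * k\<^sup>2" by (intro mult_right_mono) auto
  also have "\<dots> \<le> m * N * (4 * p * N ^ 2)"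
    using \<open>real (card M) * k ^ 2 \<le> 4 * p * N ^ 2\<close> m N0 by (simp add: mult.assoc mult_left_mono)
  finally have "N ^ 3 * \<beta> ^ 3 \<le> N ^ 3 * (32 * p * m)"
    by (simp add: k_def power2_eq_square power3_eq_cube mult_ac)
  then have "\<beta> ^ 3 \<le> 32 * p * m" using N0 by simp
  then show ?thesis using \<beta> by (simp add: p_def field_simps)
qed

end

section \<open>The structure theorem for rich sets of affine maps\<close>

lemma one_plus_inverse_le:
  assumes "N \<ge> (2::real)" "s \<le> 1 / 4"
  shows "1 + 1 / N \<le> N powr (1 - s)"
proof -
  have "1 / N \<le> 1 / 2" using assms(1) by (intro divide_left_mono) auto
  then have "1 + 1 / N \<le> 3 / 2" by simp
  also have "(3 / 2 :: real) \<le> 2 powr (3 / 4)"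
    by (rule power_le_imp_le_base[of _ 3]) (simp_all add: powr_power power_divide)
  also have "\<dots> \<le> N powr (3 / 4)" using assms by (intro powr_mono2) auto
  also have "\<dots> \<le> N powr (1 - s)" using assms by (intro powr_mono) auto
  finally show ?thesis .
qed

lemma coset_mass_autocorr_iter_le:
  assumes f: "fprob f" and c: "\<And>z. (\<Sum>x | f x \<noteq> 0 \<and> x - z \<in> H. f x) \<le> c"
  shows "(\<Sum>x | (autocorr ^^ j) f x \<noteq> 0 \<and> x - z \<in> H. (autocorr ^^ j) f x) \<le> c"
proof (induction j arbitrary: z)
  case (Suc j)
  then show ?case using autocorr_coset_mass_le[OF fprob_autocorr_iter[OF f]] by simp
qed (simp add: c)

context field
begin

lemma affs_diffset: "V \<subseteq> affs R \<Longrightarrow> diffset V \<subseteq> affs R"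
  using affs_diff by (auto simp: diffset_def)

lemma autocorr_iter_support:
  assumes "{g. f g \<noteq> 0} \<subseteq> affs R"
  shows "{g. (autocorr ^^ j) f g \<noteq> 0} \<subseteq> affs R"
proof (induction j)
  case (Suc j)
  have "diffset {g. (autocorr ^^ j) f g \<noteq> 0} \<subseteq> affs R"
    using Suc by (rule affs_diffset)
  then show ?case using autocorr_support[of "(autocorr ^^ j) f"] by auto
qed (use assms in simp)

text \<open>On the coset of \<open>z\<close> a slope is a slope of \<open>H\<close> times that of
  \<open>z\<close>, so few slopes of \<open>H\<close> leave a popular one in \<open>L\<close>. If
  \<open>H\<close> fixes \<open>x\<close>, every map of the coset sends the preimage of
  \<open>x\<close> under \<open>z\<close> to \<open>x\<close>.\<close>

lemma large_pencil_of_coset: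
  assumes H: "finite H" "H \<subseteq> affs R" and L: "finite L" "L \<subseteq> affs R"
    and sl: "real (card (slope R ` H)) \<le> k \<or> (\<exists>x\<in>carrier R. \<forall>h\<in>H. app h x = x)" and k: "k \<ge> 1"
    and ne: "{g \<in> L. g - z \<in> H} \<noteq> {}"
  shows "\<exists>L'\<subseteq>L. real (card {g \<in> L. g - z \<in> H}) / k \<le> real (card L') \<and>
    ((\<exists>a\<in>carrier R - {\<zero>}. \<forall>g\<in>L'. slope R g = a) \<or> (\<exists>x\<in>carrier R. \<exists>y\<in>carrier R. \<forall>g\<in>L'. app g x = y))"
proof -
  define L1 where "L1 = {g \<in> L. g - z \<in> H}"
  obtain g0 where g0: "g0 \<in> L1" using ne by (auto simp: L1_def)
  have L1: "finite L1" "L1 \<subseteq> L" "real (card L1) > 0"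
    using L g0 by (auto simp: L1_def card_gt_0_iff)
  \<comment> \<open>The translating element comes from the group of all bijections; a single member
    of the coset shows that it is affine.\<close>
  have z: "z \<in> affs R"
  proof -
    have "- (g0 - z) + g0 \<in> affs R"
      using g0 H(2) L(2) by (intro affs_plus affs_minus) (auto simp: L1_def)
    then show ?thesis by (simp only: minus_minus_add_cancel)
  qed
  from sl show ?thesis
  proof
    assume s: "real (card (slope R ` H)) \<le> k"
    have sub: "slope R ` L1 \<subseteq> (\<lambda>a. a \<otimes> slope R z) ` (slope R ` H)"
    proof clarify
      fix g assume g: "g \<in> L1"
      then have h: "g - z \<in> H" by (simp add: L1_def)
      have "slope R g = slope R (g - z + z)" by simp
      also have "\<dots> = slope R (g - z) \<otimes> slope R z" using h H z by (intro slope_plus) auto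
      finally show "slope R g \<in> (\<lambda>a. a \<otimes> slope R z) ` (slope R ` H)" using h by blast
    qed
    have "card (slope R ` L1) \<le> card ((\<lambda>a. a \<otimes> slope R z) ` (slope R ` H))"
      using H sub by (intro card_mono) auto
    also have "\<dots> \<le> card (slope R ` H)" using H by (intro card_image_le) auto
    finally have "real (card (slope R ` L1)) \<le> k" using s by simp
    then obtain a where a: "real (card L1) / k \<le> real (card {g \<in> L1. slope R g = a})"
      using exists_fibre_ge[OF L1(1), of "slope R" k] k g0 by auto
    have "real (card L1) / k > 0" using L1 k by simp
    then have "{g \<in> L1. slope R g = a} \<noteq> {}" using a by (metis card.empty less_le_trans not_less_iff_gr_or_eq of_nat_0)
    then have "a \<in> carrier R - {\<zero>}" using L1(2) L(2) affs_eq(2) by auto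
    then show ?thesis using a L1
      by (intro exI[of _ "{g \<in> L1. slope R g = a}"]) (auto simp: L1_def)
  next
    assume "\<exists>x\<in>carrier R. \<forall>h\<in>H. app h x = x"
    then obtain x where x: "x \<in> carrier R" "\<And>h. h \<in> H \<Longrightarrow> app h x = x" by blast
    have "app g (app (- z) x) = x" if "g \<in> L1" for g
    proof -
      have "app g (app (- z) x) = app (g - z) x" by (simp flip: app_plus)
      then show ?thesis using x that by (simp add: L1_def)
    qed
    moreover have "app (- z) x \<in> carrier R" using x z by (intro affs_app_closed affs_minus)
    moreover have "real (card L1) / k \<le> real (card L1)" using k L1 by (simp add: field_simps)
    ultimately show ?thesis using x(1) L1(2) unfolding L1_def[symmetric] by blast
  qed
qed

text \<open>Of the exponent 6000, passing to a coset of \<open>H\<close> accounts for 269 and passing to lines of the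
  same slope for 5697.\<close>

lemma exists_large_pencil:
  fixes Y :: "'a set"
  assumes inv: "no_invariant_finite_sets R"
    and Y: "Y \<subseteq> carrier R" "finite Y" "N = real (card Y)" "N \<ge> 2"
    and L: "finite L" "L \<noteq> {}" "L \<subseteq> affs R"
    and J: "J \<ge> 4" "\<delta> = 1 / (real J * 2 ^ J)"
    and rich: "\<And>g. g \<in> L \<Longrightarrow> N powr (- \<delta>) * N \<le> real (hits Y g)"
    and p: "finite (carrier R) \<Longrightarrow> 4 * N * N powr (1 / real J) \<le> real (card (carrier R))"
  shows "\<exists>L'\<subseteq>L. real (card L) / (2 * N powr (24 / real J)) ^ 6000 \<le> real (card L') \<and>
    ((\<exists>a\<in>carrier R - {\<zero>}. \<forall>g\<in>L'. slope R g = a) \<or> (\<exists>x\<in>carrier R. \<exists>y\<in>carrier R. \<forall>g\<in>L'. app g x = y))"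
proof -
  define K where "K = N powr (24 / real J)"
  have K: "K \<ge> 1" using Y(4) by (simp add: K_def ge_one_powr_ge_zero)
  define \<mu> where "\<mu> g = of_bool (g \<in> L) / real (card L)" for g
  have cL: "real (card L) > 0" using L by (simp add: card_gt_0_iff)
  have supp: "{g. \<mu> g \<noteq> 0} = L" using cL by (auto simp: \<mu>_def)
  have \<mu>: "fprob \<mu>" unfolding fprob_def supp using cL L by (simp add: \<mu>_def)
  define \<nu> where "\<nu> j = (autocorr ^^ j) \<mu>" for j
  have \<nu>: "fprob (\<nu> j)" for j unfolding \<nu>_def by (rule fprob_autocorr_iter[OF \<mu>])
  have \<nu>Suc: "\<nu> (Suc j) = autocorr (\<nu> j)" for j by (simp add: \<nu>_def)
  have \<nu>supp: "{g. \<nu> j g \<noteq> 0} \<subseteq> affs R" for j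
    unfolding \<nu>_def by (rule autocorr_iter_support) (simp add: supp L)
  have \<nu>le: "\<nu> j g \<le> \<nu> j 0" if "j \<ge> 1" for j g
    using that autocorr_le_0[OF \<nu>] by (cases j) (auto simp: \<nu>Suc)
  \<comment> \<open>A lower bound for the relative mean of hits at every index up to
    \<open>J\<close>: the choice of \<delta> makes \<delta> times 2^J equal to 1 / J.\<close>
  define \<beta> where "\<beta> = N powr (- (1 / real J))"
  have \<beta>: "\<beta> > 0" "\<beta> \<le> 1" using Y(4) J powr_mono[of "- (1 / real J)" 0 N] by (simp_all add: \<beta>_def)
  have mean: "\<beta> * N \<le> (\<Sum>g | \<nu> j g \<noteq> 0. \<nu> j g * real (hits Y g))" if j: "j \<le> J" for j
  proof -
    have "N powr (- \<delta>) * real (card Y) \<le> (\<Sum>g | \<mu> g \<noteq> 0. \<mu> g * real (hits Y g))"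
    proof -
      have "N powr (- \<delta>) * N = (\<Sum>g\<in>L. N powr (- \<delta>) * N / real (card L))" using cL by simp
      also have "\<dots> \<le> (\<Sum>g\<in>L. \<mu> g * real (hits Y g))"
        using rich by (intro sum_mono) (simp add: \<mu>_def divide_right_mono)
      finally show ?thesis using Y supp by simp
    qed
    then have "(N powr (- \<delta>)) ^ 2 ^ j * real (card Y) \<le> (\<Sum>g | \<nu> j g \<noteq> 0. \<nu> j g * real (hits Y g))"
      unfolding \<nu>_def using Y by (intro mean_hits_autocorr_iter[OF \<mu>]) auto
    moreover have "\<beta> \<le> (N powr (- \<delta>)) ^ 2 ^ j"
    proof -
      have "(2::real) ^ j \<le> 2 ^ J" using j by (intro power_increasing) auto
      then have "\<delta> * 2 ^ j \<le> \<delta> * 2 ^ J" using J by (intro mult_left_mono) auto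
      also have "\<delta> * 2 ^ J = 1 / real J" using J by simp
      finally have "\<delta> * 2 ^ j \<le> 1 / real J" .
      then have "\<beta> \<le> N powr (- \<delta> * 2 ^ j)" unfolding \<beta>_def using Y(4) by (intro powr_mono) auto
      also have "\<dots> = (N powr (- \<delta>)) ^ 2 ^ j"
        using Y(4) by (simp add: powr_power mult.commute)
      finally show ?thesis .
    qed
    then have "\<beta> * N \<le> (N powr (- \<delta>)) ^ 2 ^ j * N" using Y(4) by (intro mult_right_mono) auto
    ultimately show ?thesis unfolding Y(3) by linarith
  qed
  have aJ: "N powr (-6) \<le> \<nu> J 0"
  proof (rule ccontr)
    assume "\<not> ?thesis"
    then have lt: "\<nu> J 0 < N powr (-6)" by simp
    have "\<beta> * N \<le> 1 + \<nu> J 0 * N ^ 5"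
      unfolding Y(3)
    proof (rule order_trans[OF mean[OF order_refl, unfolded Y(3)] mean_hits_le[OF \<nu> \<nu>le Y(2)]])
      show "1 \<le> J" using J by simp
      fix g h x y assume "\<nu> J g \<noteq> 0" "\<nu> J h \<noteq> 0" "x \<noteq> y" "x \<in> Y" "y \<in> Y" "app g x = app h x" "app g y = app h y"
      then show "g = h" using \<nu>supp[of J] Y(1) by (intro affs_determined[of g h x y]) auto
    qed
    also have "\<dots> < 1 + N powr (-6) * N ^ 5" using lt Y(4) by simp
    \<comment> \<open>The exponent 6 is one more than the 5 in \<open>mean_hits_le\<close>, so that
      the contribution of maps with two or more hits drops to 1 / N.\<close>
    also have "N powr (-6) * N ^ 5 = 1 / N" using Y(4) by (simp add: powr_minus_divide power_eq_if)
    also have "1 + 1 / N \<le> N powr (1 - 1 / real J)" using Y(4) J by (intro one_plus_inverse_le) (auto simp: field_simps)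
    also have "\<dots> = \<beta> * N" using Y(4) by (simp add: \<beta>_def powr_diff powr_minus_divide)
    finally show False by simp
  qed
  have "\<exists>j\<ge>1. j + 2 \<le> J \<and> \<nu> j 0 / N powr (24 / real J) \<le> \<nu> (j + 2) 0"
  proof (rule exists_flat_step[where a = "\<lambda>j. \<nu> j 0", OF J(1) _ _ _ aJ])
    show "N \<ge> 1" using Y(4) by simp
    show "\<nu> 1 0 \<le> 1" using fprob_sum_le[OF \<nu>, of "{0}" 1] by simp
    show "\<nu> j 0 \<le> \<nu> i 0" if "1 \<le> i" "i \<le> j" for i j
      unfolding \<nu>_def using that by (intro autocorr_iter_0_antimono \<mu>)
  qed
  then obtain j where j: "j \<ge> 1" "j + 2 \<le> J" "\<nu> j 0 / K \<le> \<nu> (j + 2) 0" by (auto simp: K_def)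
  define m where "m = \<nu> j 0"
  have "\<nu> J 0 \<le> m" unfolding m_def \<nu>_def using j by (intro autocorr_iter_0_antimono \<mu>) auto
  moreover have "N powr (-6) > 0" using Y(4) by simp
  ultimately have m: "m > 0" using aJ by linarith
  have flat: "m / K \<le> autocorr (autocorr (\<nu> j)) 0" using j by (simp add: m_def \<nu>Suc numeral_2_eq_2)
  define B where "B = 2 * K"
  have B: "B \<ge> 2" using K by (simp add: B_def)
  have Bpow: "B ^ i \<le> B ^ k" if "i \<le> k" for i k using that B by (intro power_increasing) auto
  obtain H z where H: "finite H" "0 \<in> H" "\<forall>h\<in>H. - h \<in> H" "H \<subseteq> diffset {x. \<nu> j x \<noteq> 0}"
    and nH: "\<And>n. real (card (nsum H n)) \<le> B ^ (125 * Suc n) * real (card H)"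
    and cH: "real (card H) \<le> B ^ 190 / m"
    and mass: "1 / B ^ 268 \<le> (\<Sum>x | \<nu> j x \<noteq> 0 \<and> x - z \<in> H. \<nu> j x)"
    using approximate_group_of_flat[OF \<nu> \<nu>le[OF j(1)] m[unfolded m_def] K flat[unfolded m_def]]
    unfolding B_def m_def by blast
  have HA: "H \<subseteq> affs R" using H(4) affs_diffset[OF \<nu>supp] by (rule order_trans)
  \<comment> \<open>One power of \<open>B\<close> is given up: assuming that every coset has
    \<mu>-mass below the smaller value, the transfer to \<nu> gives a non-strict bound that still
    contradicts \<open>mass\<close>.\<close>
  have "1 / B ^ 269 < 1 / B ^ 268"
    using B power_strict_increasing[of 268 269 B] by (intro divide_strict_left_mono) auto
  obtain y where y: "1 / B ^ 269 \<le> (\<Sum>x | \<mu> x \<noteq> 0 \<and> x - y \<in> H. \<mu> x)"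
  proof -
    have "\<exists>y. 1 / B ^ 269 \<le> (\<Sum>x | \<mu> x \<noteq> 0 \<and> x - y \<in> H. \<mu> x)"
    proof (rule ccontr)
      assume "\<not> ?thesis"
      then have "(\<Sum>x | \<nu> j x \<noteq> 0 \<and> x - z \<in> H. \<nu> j x) \<le> 1 / B ^ 269"
        unfolding \<nu>_def by (intro coset_mass_autocorr_iter_le[OF \<mu>]) (simp add: not_le less_imp_le)
      then show False using mass \<open>1 / B ^ 269 < 1 / B ^ 268\<close> by simp
    qed
    then show ?thesis using that by blast
  qed
  define L1 where "L1 = {g \<in> L. g - y \<in> H}"
  have "(\<Sum>x | \<mu> x \<noteq> 0 \<and> x - y \<in> H. \<mu> x) = (\<Sum>x\<in>L1. 1 / real (card L))"
    using cL by (intro sum.cong) (auto simp: L1_def \<mu>_def)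
  then have "1 / B ^ 269 \<le> real (card L1) / real (card L)" using y by simp
  then have "real (card L) * (1 / B ^ 269) \<le> real (card L) * (real (card L1) / real (card L))"
    by (intro mult_left_mono) auto
  then have L1: "real (card L) / B ^ 269 \<le> real (card L1)" using cL by simp
  then have "real (card L1) > 0" using cL B by (smt (verit) divide_pos_pos zero_less_power)
  then have L1ne: "L1 \<noteq> {}" by auto
  \<comment> \<open>The exponent 5500 is 125 times 44, the growth bound for words of length
    43.\<close>
  have trich: "real (card (slope R ` H)) \<le> 2 * B ^ 5500 \<or> (\<exists>x\<in>carrier R. \<forall>h\<in>H. app h x = x) \<or>
      finite (carrier R) \<and> real (card (slope R ` H)) * real (card (carrier R)) \<le> 2 * B ^ 5500 * real (card H)"
  proof (rule approximate_affine_group[OF inv H(1) HA H(2,3)])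
    show "1 \<le> B ^ 5500" using B by (intro one_le_power) auto
    fix n :: nat assume "n \<le> 43"
    then have "B ^ (125 * Suc n) \<le> B ^ 5500" by (intro Bpow) auto
    then show "real (card (nsum H n)) \<le> B ^ 5500 * real (card H)"
      using nH[of n] by (meson mult_right_mono of_nat_0_le_iff order_trans)
  qed
  have sl: "real (card (slope R ` H)) \<le> B ^ 5697 \<or> (\<exists>x\<in>carrier R. \<forall>h\<in>H. app h x = x)"
    using trich
  proof (elim disjE)
    assume "real (card (slope R ` H)) \<le> 2 * B ^ 5500"
    also have "\<dots> \<le> B * B ^ 5500" using B by (intro mult_right_mono) auto
    also have "\<dots> = B ^ 5501" by (simp flip: power_Suc)
    also have "\<dots> \<le> B ^ 5697" by (intro Bpow) auto
    finally show ?thesis by simp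
  next
    assume *: "finite (carrier R) \<and> real (card (slope R ` H)) * real (card (carrier R)) \<le> 2 * B ^ 5500 * real (card H)"
    define P where "P = real (card (carrier R))"
    have P: "P > 0" using * by (auto simp: P_def card_gt_0_iff)
    \<comment> \<open>The loss in \<beta> has exponent 3 / J and is absorbed by the 24 / J of
      \<open>K\<close>.\<close>
    have b3: "1 / \<beta> ^ 3 \<le> K"
    proof -
      have "1 / \<beta> ^ 3 = N powr (3 / real J)"
        using Y(4) J by (simp add: \<beta>_def powr_minus_divide power_divide powr_power)
      also have "\<dots> \<le> K" unfolding K_def using Y(4) J by (intro powr_mono divide_right_mono) auto
      finally show ?thesis .
    qed
    have "1 \<le> 32 * P * m / \<beta> ^ 3"
      unfolding P_def
    proof (rule reciprocal_mass_le[OF _ Y(1) _ \<nu>[of j] \<nu>supp _ m Y(3) \<beta>(1) _ mean])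
      have "\<beta> * N powr (1 / real J) = 1" using Y(4) by (simp add: \<beta>_def powr_minus_divide)
      then have "4 * N = \<beta> * N powr (1 / real J) * (4 * N)" by simp
      also have "\<dots> = \<beta> * (4 * N * N powr (1 / real J))" by (simp only: mult_ac)
      also have "\<dots> \<le> \<beta> * real (card (carrier R))"
        using p * \<beta> by (intro mult_left_mono) auto
      finally show "4 * N \<le> \<beta> * real (card (carrier R))" .
    qed (use * Y j \<nu>le[OF j(1)] in \<open>auto simp: m_def\<close>)
    also have "\<dots> = 32 * P * m * (1 / \<beta> ^ 3)" by simp
    also have "\<dots> \<le> 32 * P * m * K" using b3 P m by (intro mult_left_mono) auto
    finally have m1: "1 / m \<le> 32 * P * K" using m by (simp add: field_simps)
    have "real (card (slope R ` H)) * P \<le> 2 * B ^ 5500 * real (card H)" using * by (simp add: P_def)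
    also have "\<dots> \<le> 2 * B ^ 5500 * (B ^ 190 * (1 / m))" using cH B by (intro mult_left_mono) auto
    also have "\<dots> \<le> 2 * B ^ 5500 * (B ^ 190 * (32 * P * K))" using m1 B by (intro mult_left_mono) auto
    \<comment> \<open>The factor \<open>2 * 32 * K\<close> is 2^5 times \<open>B\<close>, hence at
      most the sixth power of \<open>B\<close>. The factor \<open>P\<close> cancels, which leaves a
      bound for the slopes alone.\<close>
    also have "\<dots> = 2 ^ 5 * B * (B ^ 5500 * B ^ 190) * P" by (simp add: B_def)
    also have "\<dots> \<le> B ^ 5 * B * (B ^ 5500 * B ^ 190) * P"
      using B P by (intro mult_right_mono power_mono) auto
    also have "\<dots> = B ^ (5 + 1 + (5500 + 190)) * P" by (simp only: power_add power_one_right)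
    finally have "real (card (slope R ` H)) \<le> B ^ (5 + 1 + (5500 + 190))" using P by (simp only: mult_le_cancel_right_pos)
    also have "\<dots> \<le> B ^ 5697" by (intro Bpow) auto
    finally show ?thesis by simp
  qed simp
  have "B ^ 5697 \<ge> 1" using B by (intro one_le_power) auto
  from large_pencil_of_coset[OF H(1) HA L(1,3) sl this L1ne[unfolded L1_def]]
  obtain L' where L': "L' \<subseteq> L" "real (card L1) / B ^ 5697 \<le> real (card L')"
    "(\<exists>a\<in>carrier R - {\<zero>}. \<forall>g\<in>L'. slope R g = a) \<or> (\<exists>x\<in>carrier R. \<exists>y\<in>carrier R. \<forall>g\<in>L'. app g x = y)"
    unfolding L1_def by blast
  have "real (card L) / B ^ 6000 \<le> real (card L) / B ^ (269 + 5697)"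
    using B by (intro divide_left_mono Bpow) auto
  also have "\<dots> = real (card L) / B ^ 269 / B ^ 5697" by (simp only: power_add divide_divide_eq_left)
  also have "\<dots> \<le> real (card L1) / B ^ 5697" using L1 B by (intro divide_right_mono) auto
  also note L'(2)
  finally show ?thesis using L' unfolding B_def K_def by blast
qed

end

section \<open>Lines as graphs of affine maps\<close>

definition graph :: "('a, 'm) ring_scheme \<Rightarrow> 'a bijection \<Rightarrow> ('a \<times> 'a) set" where
  "graph F g = {(x, app g x) | x. x \<in> carrier F}"

context field
begin

lemma graph_aff:
  assumes "a \<in> carrier R - {\<zero>}" "b \<in> carrier R"
  shows "graph R (aff R a b) = affine_line R a b"
  using assms by (auto simp: graph_def affine_line_def app_aff)

lemma graph_eq_affine_line:
  assumes "g \<in> affs R"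
  shows "graph R g = affine_line R (slope R g) (app g \<zero>)"
  using graph_aff[OF affs_eq(2,3)[OF assms]] affs_eq(1)[OF assms] by simp

lemma affine_lines_eq: "affine_lines R = graph R ` affs R"
proof
  show "affine_lines R \<subseteq> graph R ` affs R"
  proof
    fix l assume "l \<in> affine_lines R"
    then obtain a b where ab: "a \<in> carrier R - {\<zero>}" "b \<in> carrier R" "l = affine_line R a b"
      unfolding affine_lines_def by blast
    then have "l = graph R (aff R a b)" by (simp add: graph_aff)
    then show "l \<in> graph R ` affs R" using aff_in_affs[OF ab(1,2)] by (rule image_eqI)
  qed
  show "graph R ` affs R \<subseteq> affine_lines R"
  proof clarify
    fix g assume g: "g \<in> affs R"
    show "graph R g \<in> affine_lines R"
      unfolding affine_lines_def graph_eq_affine_line[OF g] using affs_eq(2,3)[OF g] by blast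
  qed
qed

lemma inj_on_graph: "inj_on (graph R) (affs R)"
proof (rule inj_onI)
  fix g h assume gh: "g \<in> affs R" "h \<in> affs R" "graph R g = graph R h"
  have "app g x = app h x" if "x \<in> carrier R" for x
  proof -
    have "(x, app g x) \<in> graph R g" using that by (auto simp: graph_def)
    then have "(x, app g x) \<in> graph R h" by (simp only: gh(3))
    then show ?thesis by (auto simp: graph_def)
  qed
  then show "g = h" using gh(1,2) by (intro affs_determined[of g h \<zero> \<one>]) auto
qed

lemma card_graph_grid:
  assumes "Y \<subseteq> carrier R"
  shows "card (graph R g \<inter> (Y \<times> Y)) = hits Y g"
proof -
  have "graph R g \<inter> (Y \<times> Y) = (\<lambda>y. (y, app g y)) ` {y \<in> Y. app g y \<in> Y}"
    using assms by (auto simp: graph_def)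
  then show ?thesis by (simp add: hits_def card_image inj_on_def)
qed

text \<open>The loss is 2^6000 times \<open>N\<close> to the power 144000 / J. By the size of
  \<open>J\<close> the second factor is at most \<open>N\<close> to the power \<gamma> \<epsilon>,
  which is the power \<gamma> of the number of lines up to a constant factor.\<close>

lemma has_large_pencil_of_config:
  assumes inv: "no_invariant_finite_sets R"
    and cfg: "rich_lines_config R \<epsilon> \<delta> N Y L" and N: "N > 0"
    and J: "J \<ge> 4" "\<delta> = 1 / (real J * 2 ^ J)" "144000 / (\<gamma> * \<epsilon>) \<le> real J"
    and \<epsilon>: "\<epsilon> > 0" and \<gamma>: "0 < \<gamma>" "\<gamma> < 1"
    and p: "finite (carrier R) \<Longrightarrow> 4 * real N * real N powr (1 / real J) \<le> real (card (carrier R))"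
    and c: "0 < c" "c \<le> 1" "2 * c * 2 ^ 6000 \<le> 1"
  shows "has_large_pencil R c \<gamma> L"
proof -
  have Y: "Y \<subseteq> carrier R" "finite Y" "card Y = N"
    and L: "L \<subseteq> affine_lines R" "finite L" "\<bar>real (card L) - real N powr \<epsilon>\<bar> < 1"
    and rich: "\<And>l. l \<in> L \<Longrightarrow> real N powr (-\<delta>) * real N \<le> real (card (l \<inter> (Y \<times> Y)))"
    using cfg by (auto simp: rich_lines_config_def rich_def)
  define M where "M = {g \<in> affs R. graph R g \<in> L}"
  have LM: "L = graph R ` M" using L(1) by (auto simp: M_def affine_lines_eq)
  have MA: "M \<subseteq> affs R" by (auto simp: M_def)
  have card_graph: "card (graph R ` P) = card P" if "P \<subseteq> M" for P
    using that MA by (intro card_image inj_on_subset[OF inj_on_graph]) auto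
  have finM: "finite M"
    using L(2) unfolding LM by (rule finite_imageD) (rule inj_on_subset[OF inj_on_graph MA])
  have parallel: "all_parallel R (graph R ` P)"
    if "P \<subseteq> M" "a \<in> carrier R - {\<zero>}" "\<forall>g\<in>P. slope R g = a" for P a
    unfolding all_parallel_def
  proof (rule bexI[OF _ that(2)], clarify)
    fix g assume g: "g \<in> P"
    then have "g \<in> affs R" using that MA by auto
    then show "\<exists>b\<in>carrier R. graph R g = affine_line R a b"
      using graph_eq_affine_line[of g] affs_eq(3)[of g] that g by auto
  qed
  have concurrent: "all_concurrent R (graph R ` P)"
    if "x \<in> carrier R" "y \<in> carrier R" "\<forall>g\<in>P. app g x = y" for P x y
    unfolding all_concurrent_def using that by (intro bexI[of _ "(x, y)"]) (auto simp: graph_def)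
  define n where "n = real (card L)"
  have nM: "n = real (card M)" using card_graph[of M] LM by (simp add: n_def)
  \<comment> \<open>For \<open>N = 1\<close> the configuration has at most one line, and a single
    line is parallel to itself; the main argument needs \<open>N\<close> at least 2.\<close>
  consider "n = 0" | "N = 1" "n > 0" | "N \<ge> 2" "n > 0" using N by (fastforce simp: n_def)
  then show ?thesis
  proof cases
    case 1
    then have "M = {}" using nM finM by simp
    then have "all_parallel R L" using parallel[of "{}" \<one>] LM one_nonzero by auto
    then show ?thesis unfolding has_large_pencil_def using 1 by (intro exI[of _ L]) (simp add: n_def)
  next
    case 2
    then have "n < 2" using L(3) by (simp add: n_def)
    then have n1: "card L = 1" using 2 by (simp add: n_def)
    then have "card M = 1" using nM by (simp add: n_def)
    then obtain g where g: "M = {g}" by (rule card_1_singletonE)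
    have "g \<in> affs R" using MA unfolding g by simp
    then have "all_parallel R (graph R ` M)"
      by (rule parallel[OF order_refl affs_eq(2)]) (simp add: g)
    then have "all_parallel R L" by (simp only: LM)
    then show ?thesis unfolding has_large_pencil_def using c(2) by (intro exI[of _ L]) (simp add: n1)
  next
    case 3
    define K where "K = real N powr (24 / real J)"
    have K: "K > 0" using 3 by (simp add: K_def)
    have "\<exists>M'\<subseteq>M. real (card M) / (2 * real N powr (24 / real J)) ^ 6000 \<le> real (card M') \<and>
      ((\<exists>a\<in>carrier R - {\<zero>}. \<forall>g\<in>M'. slope R g = a) \<or> (\<exists>x\<in>carrier R. \<exists>y\<in>carrier R. \<forall>g\<in>M'. app g x = y))"
    proof (rule exists_large_pencil[OF inv Y(1,2) _ _ finM _ MA J(1,2) _ p])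
      show "real N powr (-\<delta>) * real N \<le> real (hits Y g)" if "g \<in> M" for g
        using rich[of "graph R g"] that card_graph_grid[OF Y(1)] by (simp add: M_def)
      show "M \<noteq> {}" using 3 nM by auto
    qed (use 3 Y in auto)
    then obtain M' where M': "M' \<subseteq> M" "n / (2 * K) ^ 6000 \<le> real (card M')"
      "(\<exists>a\<in>carrier R - {\<zero>}. \<forall>g\<in>M'. slope R g = a) \<or> (\<exists>x\<in>carrier R. \<exists>y\<in>carrier R. \<forall>g\<in>M'. app g x = y)"
      unfolding nM K_def by blast
    have "c * n powr (1 - \<gamma>) \<le> n / (2 * K) ^ 6000"
    proof -
      have "K ^ 6000 = real N powr (144000 / real J)"
        using 3 by (simp add: K_def powr_power)
      also have "\<dots> \<le> real N powr (\<gamma> * \<epsilon>)"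
        using J \<epsilon> \<gamma> 3 by (intro powr_mono) (auto simp: field_simps)
      also have "\<dots> = (real N powr \<epsilon>) powr \<gamma>" by (simp add: powr_powr mult.commute)
      also have "\<dots> \<le> (2 * n) powr \<gamma>"
      proof (rule powr_mono2)
        \<comment> \<open>Rounding: \<open>N powr \<epsilon>\<close> is less than
          \<open>n + 1\<close>, which is at most \<open>2 * n\<close> as soon as there is a
          line.\<close>
        have "1 \<le> n" using 3 by (simp add: n_def)
        then show "real N powr \<epsilon> \<le> 2 * n" using L(3) by (simp add: n_def)
      qed (use \<gamma> in auto)
      also have "\<dots> = 2 powr \<gamma> * n powr \<gamma>" using 3 by (simp add: powr_mult)
      also have "\<dots> \<le> 2 * n powr \<gamma>"
        using \<gamma> powr_mono[of \<gamma> 1 2] by (intro mult_right_mono) auto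
      finally have K6: "K ^ 6000 \<le> 2 * n powr \<gamma>" .
      \<comment> \<open>The name keeps 2^6000 as an opaque positive number.\<close>
      define w :: real where "w = 2 ^ 6000"
      have w: "w > 0" unfolding w_def by (rule zero_less_power) simp
      have "c * n powr (1 - \<gamma>) = 2 * c * w * (n / (w * (2 * n powr \<gamma>)))"
        using 3 w by (simp add: powr_diff)
      also have "\<dots> \<le> 1 * (n / (w * (2 * n powr \<gamma>)))"
        using c(3) 3 w unfolding w_def[symmetric] by (intro mult_right_mono) auto
      also have "\<dots> = n / (w * (2 * n powr \<gamma>))" by simp
      also have "\<dots> \<le> n / (w * K ^ 6000)"
        using K6 K 3 w by (intro divide_left_mono mult_left_mono mult_pos_pos) auto
      also have "\<dots> = n / (2 * K) ^ 6000" by (simp only: power_mult_distrib w_def)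
      finally show ?thesis .
    qed
    then have "c * n powr (1 - \<gamma>) \<le> real (card M')" using M'(2) by (rule order_trans)
    then have "c * real (card L) powr (1 - \<gamma>) \<le> real (card (graph R ` M'))"
      by (simp only: n_def card_graph[OF M'(1)])
    moreover have "graph R ` M' \<subseteq> L" using M'(1) LM by auto
    moreover have "all_parallel R (graph R ` M') \<or> all_concurrent R (graph R ` M')"
      using M'(3) parallel[OF M'(1)] concurrent by blast
    ultimately show ?thesis unfolding has_large_pencil_def by blast
  qed
qed

end

section \<open>The complex numbers and the prime fields\<close>

lemma no_invariant_finite_sets_complex:
  "no_invariant_finite_sets (ring_of_type_algebra :: complex ring)"
  unfolding no_invariant_finite_sets_def
proof (intro allI impI, elim conjE)
  fix D :: "complex set" and \<tau>
  assume D: "finite D" "D \<noteq> {}" and \<tau>: "\<tau> \<in> carrier ring_of_type_algebra - {\<zero>\<^bsub>ring_of_type_algebra\<^esub>}"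
    and cl: "\<forall>d\<in>D. d \<oplus>\<^bsub>ring_of_type_algebra\<^esub> \<tau> \<in> D"
  have \<tau>0: "\<tau> \<noteq> 0" and step: "\<And>d. d \<in> D \<Longrightarrow> d + \<tau> \<in> D"
    using \<tau> cl by (auto simp: ring_of_type_algebra_def)
  obtain d where d: "d \<in> D" using D by auto
  have "d + of_nat n * \<tau> \<in> D" for n
    by (induction n) (use d step in \<open>auto simp: algebra_simps, metis add.assoc add.commute\<close>)
  then have "range (\<lambda>n. d + of_nat n * \<tau>) \<subseteq> D" by auto
  moreover have "inj (\<lambda>n. d + of_nat n * \<tau>)" using \<tau>0 by (auto simp: inj_on_def)
  ultimately have "infinite D" using finite_subset range_inj_infinite by blast
  then show "D = carrier ring_of_type_algebra" using D by simp
qed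

text \<open>A nonzero \<tau> generates the additive group of a prime field: with \<open>s\<close>
  its inverse modulo \<open>p\<close>, adding \<tau> to \<open>d\<close> as often as
  \<open>(x - d) * s\<close> prescribes leads to \<open>x\<close>.\<close>

lemma no_invariant_finite_sets_residue_ring:
  assumes p: "Factorial_Ring.prime (p::nat)"
  shows "no_invariant_finite_sets (residue_ring (int p))"
  unfolding no_invariant_finite_sets_def
proof (intro allI impI, elim conjE)
  fix D :: "int set" and \<tau>
  assume D: "D \<noteq> {}" "D \<subseteq> carrier (residue_ring (int p))"
    and \<tau>: "\<tau> \<in> carrier (residue_ring (int p)) - {\<zero>\<^bsub>residue_ring (int p)\<^esub>}"
    and cl: "\<forall>d\<in>D. d \<oplus>\<^bsub>residue_ring (int p)\<^esub> \<tau> \<in> D"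
  have step: "\<And>d. d \<in> D \<Longrightarrow> (d + \<tau>) mod int p \<in> D" and \<tau>': "0 < \<tau>" "\<tau> < int p"
    using cl \<tau> by (auto simp: residue_ring_def)
  have p0: "int p > 0" using p by (simp add: prime_gt_0_nat)
  have "coprime \<tau> (int p)"
    using p \<tau>' by (metis coprime_commute prime_imp_coprime prime_nat_int_transfer zdvd_not_zless)
  then obtain s where s: "[\<tau> * s = 1] (mod int p)" using cong_solve_coprime_int by blast
  obtain d where d: "d \<in> D" using D by auto
  have dm: "d mod int p = d" using d D by (auto simp: residue_ring_def)
  have iter: "(d + int n * \<tau>) mod int p \<in> D" for n
  proof (induction n)
    case 0
    then show ?case using d dm by simp
  next
    case (Suc n)
    have "((d + int n * \<tau>) mod int p + \<tau>) mod int p = (d + int n * \<tau> + \<tau>) mod int p"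
      by (rule mod_add_left_eq)
    also have "d + int n * \<tau> + \<tau> = d + int (Suc n) * \<tau>" by (simp add: algebra_simps)
    finally have "((d + int n * \<tau>) mod int p + \<tau>) mod int p = (d + int (Suc n) * \<tau>) mod int p" .
    then show ?case using step[OF Suc] by simp
  qed
  show "D = carrier (residue_ring (int p))"
  proof
    show "carrier (residue_ring (int p)) \<subseteq> D"
    proof
      fix x assume "x \<in> carrier (residue_ring (int p))"
      then have x: "x mod int p = x" by (auto simp: residue_ring_def)
      define n where "n = nat (((x - d) * s) mod int p)"
      have n: "int n = ((x - d) * s) mod int p" using p0 by (simp add: n_def)
      have "[int n * \<tau> = (x - d) * s * \<tau>] (mod int p)"
        unfolding n by (intro cong_scalar_right) (simp add: cong_def)
      also have "(x - d) * s * \<tau> = (x - d) * (\<tau> * s)" by (simp add: mult_ac)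
      also have "[\<dots> = (x - d) * 1] (mod int p)" using s by (rule cong_scalar_left)
      finally have "[d + int n * \<tau> = d + (x - d)] (mod int p)" by (intro cong_add) auto
      then have "(d + int n * \<tau>) mod int p = x" using x by (simp add: cong_def)
      then show "x \<in> D" using iter[of n] by simp
    qed
  qed (rule D)
qed

lemma exists_small_constant: "\<exists>c>0. c \<le> 1 \<and> 2 * c * 2 ^ n \<le> (1::real)"
proof -
  have "(1::real) \<le> 2 * 2 ^ n" using one_le_power[of "2::real" n] by linarith
  then show ?thesis by (intro exI[of _ "1 / (2 * 2 ^ n)"]) (simp add: divide_simps)
qed

theorem theorem3p1:
  shows "\<exists>c c\<^sub>p k\<^sub>p a\<^sub>J b\<^sub>J :: real.
    c > 0 \<and> c\<^sub>p > 0 \<and> k\<^sub>p > 0 \<and> a\<^sub>J > 0 \<and> b\<^sub>J > 0 \<and>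
    (\<forall>\<epsilon> \<gamma> :: real. \<epsilon> > 0 \<longrightarrow> 0 < \<gamma> \<longrightarrow> \<gamma> < 1 \<longrightarrow>
      (\<exists>\<delta> > 0.
        (\<exists>J::nat. J > 0 \<and> a\<^sub>J / (\<gamma> * \<epsilon>) \<le> real J \<and> real J \<le> b\<^sub>J * max 1 (1 / (\<gamma> * \<epsilon>)) \<and>
                  \<delta> = 1 / (real J * 2 ^ J)) \<and>
        (\<forall>N::nat. N > 0 \<longrightarrow>
          (\<forall>Y L. rich_lines_config (ring_of_type_algebra :: complex ring) \<epsilon> \<delta> N Y L \<longrightarrow>
             has_large_pencil (ring_of_type_algebra :: complex ring) c \<gamma> L) \<and>
          (\<forall>p::nat. Factorial_Ring.prime p \<longrightarrow> real N \<le> c\<^sub>p * real p powr (1 - k\<^sub>p * \<gamma> * \<epsilon>) \<longrightarrow>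
             (\<forall>Y L. rich_lines_config (residue_ring (int p)) \<epsilon> \<delta> N Y L \<longrightarrow>
                has_large_pencil (residue_ring (int p)) c \<gamma> L)))))"
proof -
  obtain c :: real where c: "0 < c" "c \<le> 1" "2 * c * 2 ^ 6000 \<le> 1"
    using exists_small_constant by blast
  show ?thesis
  proof (rule exI[of _ c], rule exI[of _ "1 / 4"], rule exI[of _ 1], rule exI[of _ 144000],
      rule exI[of _ 144005], intro conjI allI impI)
    fix \<epsilon> \<gamma> :: real
    assume \<epsilon>: "\<epsilon> > 0" and \<gamma>: "0 < \<gamma>" "\<gamma> < 1"
    define r where "r = 1 / (\<gamma> * \<epsilon>)"
    have r: "r > 0" using \<epsilon> \<gamma> by (simp add: r_def)
    \<comment> \<open>The summand 4 guarantees \<open>J \<ge> 4\<close> also for large \<gamma>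
      \<epsilon>. With rounding up, \<open>J\<close> is at most \<open>144000 * r + 5\<close>, hence
      the constant 144005.\<close>
    define J where "J = nat \<lceil>144000 * r\<rceil> + 4"
    have J: "J \<ge> 4" "144000 / (\<gamma> * \<epsilon>) \<le> real J"
      by (auto simp: J_def r_def) linarith
    have "real J \<le> 144000 * r + 5" using r by (simp add: J_def) linarith
    then have Jup: "real J \<le> 144005 * max 1 (1 / (\<gamma> * \<epsilon>))" by (simp add: r_def[symmetric] max_def)
    define \<delta> where "\<delta> = 1 / (real J * 2 ^ J)"
    show "\<exists>\<delta>>0. (\<exists>J::nat. J > 0 \<and> 144000 / (\<gamma> * \<epsilon>) \<le> real J \<and>
            real J \<le> 144005 * max 1 (1 / (\<gamma> * \<epsilon>)) \<and> \<delta> = 1 / (real J * 2 ^ J)) \<and>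
          (\<forall>N::nat. N > 0 \<longrightarrow>
            (\<forall>Y L. rich_lines_config (ring_of_type_algebra :: complex ring) \<epsilon> \<delta> N Y L \<longrightarrow>
               has_large_pencil (ring_of_type_algebra :: complex ring) c \<gamma> L) \<and>
            (\<forall>p::nat. Factorial_Ring.prime p \<longrightarrow> real N \<le> 1 / 4 * real p powr (1 - 1 * \<gamma> * \<epsilon>) \<longrightarrow>
               (\<forall>Y L. rich_lines_config (residue_ring (int p)) \<epsilon> \<delta> N Y L \<longrightarrow>
                  has_large_pencil (residue_ring (int p)) c \<gamma> L)))"
    proof (rule exI[of _ \<delta>], intro conjI allI impI)
      show "\<delta> > 0" using J by (simp add: \<delta>_def)
      show "\<exists>J::nat. J > 0 \<and> 144000 / (\<gamma> * \<epsilon>) \<le> real J \<and>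
          real J \<le> 144005 * max 1 (1 / (\<gamma> * \<epsilon>)) \<and> \<delta> = 1 / (real J * 2 ^ J)"
        using J Jup by (intro exI[of _ J]) (simp add: \<delta>_def)
    next
      fix N :: nat and Y :: "complex set" and L
      assume N: "N > 0" and cfg: "rich_lines_config ring_of_type_algebra \<epsilon> \<delta> N Y L"
      have "\<not> finite (carrier (ring_of_type_algebra :: complex ring))"
        by (simp add: ring_of_type_algebra_def infinite_UNIV_char_0)
      then show "has_large_pencil ring_of_type_algebra c \<gamma> L"
        using field.has_large_pencil_of_config[OF field_from_type_algebra
            no_invariant_finite_sets_complex cfg N J(1) \<delta>_def J(2) \<epsilon> \<gamma> _ c] by blast
    next
      fix N p :: nat and Y L
      assume N: "N > 0" and p: "Factorial_Ring.prime p" and Np: "real N \<le> 1 / 4 * real p powr (1 - 1 * \<gamma> * \<epsilon>)"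
        and cfg: "rich_lines_config (residue_ring (int p)) \<epsilon> \<delta> N Y L"
      interpret residues_prime p "residue_ring (int p)"
        using p by unfold_locales auto
      have p1: "real p \<ge> 1" using prime_gt_0_nat[OF p] by simp
      \<comment> \<open>This lets the saving \<gamma> \<epsilon> in the exponent of \<open>p\<close>
        pay for the factor \<open>N powr (1 / real J)\<close> in the size condition on the
        field.\<close>
      have "1 / real J \<le> \<gamma> * \<epsilon>"
      proof -
        have "r \<le> real J" using J(2) r by (simp add: r_def field_simps)
        then have "1 / real J \<le> 1 / r" using r J(1) by (intro divide_left_mono) auto
        then show ?thesis by (simp add: r_def)
      qed
      have "4 * real N * real N powr (1 / real J) \<le> real (card (carrier (residue_ring (int p))))"
      proof -
        have le: "4 * real N \<le> real p powr (1 - \<gamma> * \<epsilon>)" using Np by simp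
        also have "\<dots> \<le> real p powr 1" using p1 \<epsilon> \<gamma> by (intro powr_mono) auto
        finally have "real N \<le> real p" using p1 by simp
        then have "real N powr (1 / real J) \<le> real p powr (1 / real J)"
          by (intro powr_mono2) auto
        also have "\<dots> \<le> real p powr (\<gamma> * \<epsilon>)" using p1 \<open>1 / real J \<le> \<gamma> * \<epsilon>\<close> by (intro powr_mono) auto
        finally have "4 * real N * real N powr (1 / real J) \<le> real p powr (1 - \<gamma> * \<epsilon>) * real p powr (\<gamma> * \<epsilon>)"
          using le by (intro mult_mono) auto
        also have "\<dots> = real p" using p1 by (simp flip: powr_add)
        finally show ?thesis by (simp add: res_carrier_eq)
      qed
      then show "has_large_pencil (residue_ring (int p)) c \<gamma> L"
        using has_large_pencil_of_config[OF no_invariant_finite_sets_residue_ring[OF p] cfg N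
            J(1) \<delta>_def J(2) \<epsilon> \<gamma> _ c] by blast
    qed
  qed (use c(1) in simp_all)
qed

end
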